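(* Let $\mathcal{H}$ be a complex separable Hilbert space and $X\subset\mathbb{R}^d$ a relatively separated set. For every $s>d$ and every $\alpha=(\alpha_j)_{j=1}^d\in\mathbb{N}_0^d$, the class of $\mathcal{B}(\mathcal{H})$-valued matrices $[A_{k,l}]_{k,l\in X}$ for which there is a constant $C>0$ with $$\|A_{k,l}\|\le C(1+|k-l|)^{-s}\prod_{j=1}^d(1+|k_j-l_j|)^{-\alpha_j}\qquad\text{for all } k,l\in X$$ is (with respect to a suitable norm) a solid unital Banach *-algebra which is inverse-closed in $\mathcal{B}(\ell^2(X;\mathcal{H}))$ and thus symmetric.
   Context: $|\cdot|$ is the Euclidean norm on $\mathbb{R}^d$ (absolute value on coordinates), $k_j$ the $j$-th coordinate of $k\in X\subset\mathbb{R}^d$. A countable set $X\subset\mathbb{R}^d$ is relatively separated if $\sup_{x\in\mathbb{R}^d}|X\cap(x+[0,1]^d)|<\infty$ (cardinality). $\ell^2(X;\mathcal{H})$ is the Hilbert space of families $(f_k)_{k\in X}$ in $\mathcal{H}$ with $\sum_k\|f_k\|^2<\infty$. Matrices act by $A(f_l)_l=(\sum_lA_{k,l}f_l)_k$, which identifies the class with a subalgebra of $\mathcal{B}(\ell^2(X;\mathcal{H}))$; multiplication is $[AB]_{k,l}=\sum_nA_{k,n}B_{n,l}$ and involution is $[A^*]_{k,l}=(A_{l,k})^*$. A Banach *-algebra is a complex Banach algebra with isometric involution. A normed space $\mathcal{A}$ of $\mathcal{B}(\mathcal{H})$-valued matrices is solid if, whenever $A\in\mathcal{A}$ and $\|B_{k,l}\|\le\|A_{k,l}\|$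 for all $k,l$, then $B\in\mathcal{A}$ and $\|B\|_{\mathcal{A}}\le\|A\|_{\mathcal{A}}$. $\mathcal{A}\subseteq\mathcal{B}$ (common identity) is inverse-closed in $\mathcal{B}$ if $A\in\mathcal{A}$ invertible in $\mathcal{B}$ implies $A^{-1}\in\mathcal{A}$. $\mathcal{A}$ is symmetric if the spectrum $\sigma_{\mathcal{A}}(A^*A)\subseteq[0,\infty)$ for all $A\in\mathcal{A}$. *)

theory Defs
  imports "HOL-Algebra.Module" "HOL-Analysis.Analysis"
begin

section \<open>Complex Hilbert spaces and their bounded operators\<close>

text \<open>
  The inner product is linear in its first argument. Completeness and the real normed structure
  are inherited from the class \<^class>\<open>banach\<close>.
\<close>

class complex_hilbert = banach +
  fixes scaleC :: "complex \<Rightarrow> 'a \<Rightarrow> 'a" (infixr \<open>*\<^sub>C\<close> 75)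
    and cinner :: "'a \<Rightarrow> 'a \<Rightarrow> complex"
  assumes scaleC_add_right: "c *\<^sub>C (x + y) = c *\<^sub>C x + c *\<^sub>C y"
    and scaleC_add_left: "(b + c) *\<^sub>C x = b *\<^sub>C x + c *\<^sub>C x"
    and scaleC_scaleC: "b *\<^sub>C c *\<^sub>C x = (b * c) *\<^sub>C x"
    and scaleC_of_real: "complex_of_real r *\<^sub>C x = r *\<^sub>R x"
    and cinner_commute: "cinner y x = cnj (cinner x y)"
    and cinner_add_left: "cinner (x + y) z = cinner x z + cinner y z"
    and cinner_scaleC_left: "cinner (c *\<^sub>C x) y = c * cinner x y"
    and cinner_self_nonneg: "0 \<le> Re (cinner x x)"
    and norm_eq_sqrt_cinner: "norm x = sqrt (Re (cinner x x))"

text \<open>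
  \<open>\<B>(\<H>)\<close> is the set of those bounded real-linear operators that are complex-linear; the norm of
  \<^typ>\<open>'h \<Rightarrow>\<^sub>L 'h\<close> is the operator norm.
\<close>

definition clinear_op :: "('h::complex_hilbert \<Rightarrow>\<^sub>L 'h) \<Rightarrow> bool" where
  "clinear_op T \<longleftrightarrow> (\<forall>c x. blinfun_apply T (c *\<^sub>C x) = c *\<^sub>C blinfun_apply T x)"

definition scale_op :: "complex \<Rightarrow> ('h::complex_hilbert \<Rightarrow>\<^sub>L 'h) \<Rightarrow> ('h \<Rightarrow>\<^sub>L 'h)" where
  "scale_op c T = Blinfun (\<lambda>x. c *\<^sub>C blinfun_apply T x)"

definition adj_op :: "('h::complex_hilbert \<Rightarrow>\<^sub>L 'h) \<Rightarrow> ('h \<Rightarrow>\<^sub>L 'h)" where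
  "adj_op T = (THE S. \<forall>x y. cinner (blinfun_apply T x) y = cinner x (blinfun_apply S y))"


section \<open>Banach *-algebras\<close>

record 'a star_algebra = "(complex, 'a) module" +
  star :: "'a \<Rightarrow> 'a"
  nrm :: "'a \<Rightarrow> real"

definition complex_scalars :: "complex ring" where
  "complex_scalars =
    \<lparr>carrier = UNIV, monoid.mult = (*), one = 1, ring.zero = 0, add = (+)\<rparr>"

text \<open>
  The locale \<^locale>\<open>Ring.ring\<close> includes the existence of a multiplicative identity. It is not
  required that the identity has norm 1, nor that it differs from zero.
\<close>

locale banach_star_algebra = Module.module complex_scalars A + Ring.ring A
  for A :: "('a, 'm) star_algebra_scheme" (structure) +
  assumes smult_mult_left:
      "\<lbrakk>x \<in> carrier A; y \<in> carrier A\<rbrakk> \<Longrightarrow> (c \<odot> x) \<otimes> y = c \<odot> (x \<otimes> y)"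
    and smult_mult_right:
      "\<lbrakk>x \<in> carrier A; y \<in> carrier A\<rbrakk> \<Longrightarrow> x \<otimes> (c \<odot> y) = c \<odot> (x \<otimes> y)"
    and nrm_nonneg: "x \<in> carrier A \<Longrightarrow> 0 \<le> nrm A x"
    and nrm_eq_zero: "x \<in> carrier A \<Longrightarrow> nrm A x = 0 \<longleftrightarrow> x = \<zero>"
    and nrm_triangle:
      "\<lbrakk>x \<in> carrier A; y \<in> carrier A\<rbrakk> \<Longrightarrow> nrm A (x \<oplus> y) \<le> nrm A x + nrm A y"
    and nrm_smult: "x \<in> carrier A \<Longrightarrow> nrm A (c \<odot> x) = cmod c * nrm A x"
    and nrm_mult:
      "\<lbrakk>x \<in> carrier A; y \<in> carrier A\<rbrakk> \<Longrightarrow> nrm A (x \<otimes> y) \<le> nrm A x * nrm A y"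
    and nrm_complete:
      "\<lbrakk>\<And>n::nat. u n \<in> carrier A;
        \<And>e. e > 0 \<Longrightarrow> \<exists>N. \<forall>m\<ge>N. \<forall>n\<ge>N. nrm A (u m \<ominus> u n) < e\<rbrakk>
       \<Longrightarrow> \<exists>x\<in>carrier A. (\<lambda>n. nrm A (u n \<ominus> x)) \<longlonglongrightarrow> 0"
    and star_closed: "x \<in> carrier A \<Longrightarrow> star A x \<in> carrier A"
    and star_star: "x \<in> carrier A \<Longrightarrow> star A (star A x) = x"
    and star_add:
      "\<lbrakk>x \<in> carrier A; y \<in> carrier A\<rbrakk> \<Longrightarrow> star A (x \<oplus> y) = star A x \<oplus> star A y"
    and star_smult: "x \<in> carrier A \<Longrightarrow> star A (c \<odot> x) = cnj c \<odot> star A x"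
    and star_mult:
      "\<lbrakk>x \<in> carrier A; y \<in> carrier A\<rbrakk> \<Longrightarrow> star A (x \<otimes> y) = star A y \<otimes> star A x"
    and nrm_star: "x \<in> carrier A \<Longrightarrow> nrm A (star A x) = nrm A x"

definition spectrum :: "('a, 'm) star_algebra_scheme \<Rightarrow> 'a \<Rightarrow> complex set" where
  "spectrum A x = {c. (c \<odot>\<^bsub>A\<^esub> \<one>\<^bsub>A\<^esub>) \<ominus>\<^bsub>A\<^esub> x \<notin> Units A}"

definition symmetric_algebra :: "('a, 'm) star_algebra_scheme \<Rightarrow> bool" where
  "symmetric_algebra A \<longleftrightarrow>
    (\<forall>x\<in>carrier A. spectrum A (star A x \<otimes>\<^bsub>A\<^esub> x) \<subseteq> \<real>\<^sub>\<ge>\<^sub>0)"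

definition star_hom ::
    "('a, 'm) star_algebra_scheme \<Rightarrow> ('b, 'n) star_algebra_scheme \<Rightarrow> ('a \<Rightarrow> 'b) set" where
  "star_hom A B = {\<phi> \<in> ring_hom A B.
     (\<forall>c. \<forall>x\<in>carrier A. \<phi> (c \<odot>\<^bsub>A\<^esub> x) = c \<odot>\<^bsub>B\<^esub> \<phi> x) \<and>
     (\<forall>x\<in>carrier A. \<phi> (star A x) = star B (\<phi> x))}"

text \<open>
  \<open>A\<close> is regarded as a subalgebra of \<open>B\<close> with the same identity through the injective
  *-homomorphism \<open>\<phi>\<close>; members of \<^const>\<open>ring_hom\<close> preserve the identity.
\<close>

definition inverse_closed_via ::
    "('a \<Rightarrow> 'b) \<Rightarrow> ('a, 'm) star_algebra_scheme \<Rightarrow> ('b, 'n) star_algebra_scheme \<Rightarrow> bool" where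
  "inverse_closed_via \<phi> A B \<longleftrightarrow>
    \<phi> \<in> star_hom A B \<and> inj_on \<phi> (carrier A) \<and>
    (\<forall>x\<in>carrier A. \<phi> x \<in> Units B \<longrightarrow> inv\<^bsub>B\<^esub> (\<phi> x) \<in> \<phi> ` carrier A)"


section \<open>Bounded operators on the Hilbert space of square-summable families\<close>

text \<open>
  A family indexed by \<open>X\<close> is a function that vanishes outside \<open>X\<close>.
\<close>

definition ell2 :: "'i set \<Rightarrow> ('i \<Rightarrow> 'h::complex_hilbert) set" where
  "ell2 X = {f. (\<forall>k. k \<notin> X \<longrightarrow> f k = 0) \<and> (\<lambda>k. (norm (f k))\<^sup>2) summable_on X}"

definition ell2_inner :: "'i set \<Rightarrow> ('i \<Rightarrow> 'h::complex_hilbert) \<Rightarrow> ('i \<Rightarrow> 'h) \<Rightarrow> complex" where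
  "ell2_inner X f g = (\<Sum>\<^sub>\<infinity>k\<in>X. cinner (f k) (g k))"

definition ell2_norm :: "'i set \<Rightarrow> ('i \<Rightarrow> 'h::complex_hilbert) \<Rightarrow> real" where
  "ell2_norm X f = sqrt (\<Sum>\<^sub>\<infinity>k\<in>X. (norm (f k))\<^sup>2)"

definition bounded_ell2_ops ::
    "'i set \<Rightarrow> (('i \<Rightarrow> 'h::complex_hilbert) \<Rightarrow> ('i \<Rightarrow> 'h)) set" where
  "bounded_ell2_ops X = {T \<in> ell2 X \<rightarrow>\<^sub>E ell2 X.
     (\<forall>f\<in>ell2 X. \<forall>g\<in>ell2 X. T (\<lambda>k. f k + g k) = (\<lambda>k. T f k + T g k)) \<and>
     (\<forall>c. \<forall>f\<in>ell2 X. T (\<lambda>k. c *\<^sub>C f k) = (\<lambda>k. c *\<^sub>C T f k)) \<and>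
     (\<exists>C. \<forall>f\<in>ell2 X. ell2_norm X (T f) \<le> C * ell2_norm X f)}"

definition B_ell2 ::
    "'i set \<Rightarrow> (('i \<Rightarrow> 'h::complex_hilbert) \<Rightarrow> ('i \<Rightarrow> 'h)) star_algebra" where
  "B_ell2 X =
    \<lparr>carrier = bounded_ell2_ops X,
     monoid.mult = compose (ell2 X),
     one = (\<lambda>f\<in>ell2 X. f),
     ring.zero = (\<lambda>f\<in>ell2 X. \<lambda>k. 0),
     add = (\<lambda>S T. \<lambda>f\<in>ell2 X. \<lambda>k. S f k + T f k),
     module.smult = (\<lambda>c T. \<lambda>f\<in>ell2 X. \<lambda>k. c *\<^sub>C T f k),
     star = (\<lambda>T. THE S. S \<in> bounded_ell2_ops X \<and>
       (\<forall>f\<in>ell2 X. \<forall>g\<in>ell2 X. ell2_inner X (T f) g = ell2_inner X f (S g))),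
     nrm = (\<lambda>T. Inf {C. 0 \<le> C \<and> (\<forall>f\<in>ell2 X. ell2_norm X (T f) \<le> C * ell2_norm X f)})\<rparr>"


section \<open>Operator-valued matrices\<close>

type_synonym ('i, 'h) op_matrix = "'i \<Rightarrow> 'i \<Rightarrow> ('h \<Rightarrow>\<^sub>L 'h)"

text \<open>
  A \<open>\<B>(\<H>)\<close>-valued matrix indexed by \<open>X\<close> vanishes outside \<open>X \<times> X\<close>.
\<close>

definition op_matrices :: "'i set \<Rightarrow> ('i, 'h::complex_hilbert) op_matrix set" where
  "op_matrices X = {A. (\<forall>k l. clinear_op (A k l)) \<and> (\<forall>k l. k \<notin> X \<or> l \<notin> X \<longrightarrow> A k l = 0)}"

definition matrix_mult ::
    "'i set \<Rightarrow> ('i, 'h::complex_hilbert) op_matrix \<Rightarrow> ('i, 'h) op_matrix \<Rightarrow> ('i, 'h) op_matrix" where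
  "matrix_mult X A B = (\<lambda>k l. \<Sum>\<^sub>\<infinity>n\<in>X. A k n o\<^sub>L B n l)"

definition matrix_op ::
    "'i set \<Rightarrow> ('i, 'h::complex_hilbert) op_matrix \<Rightarrow> ('i \<Rightarrow> 'h) \<Rightarrow> ('i \<Rightarrow> 'h)" where
  "matrix_op X A = (\<lambda>f\<in>ell2 X. \<lambda>k. \<Sum>\<^sub>\<infinity>l\<in>X. blinfun_apply (A k l) (f l))"

text \<open>
  \<^const>\<open>infsum\<close> has the default value 0, so the convergence of the series in \<^const>\<open>matrix_mult\<close>
  and \<^const>\<open>matrix_op\<close> is a separate property of a set \<open>\<A>\<close> of matrices.
\<close>

definition series_converge :: "'i set \<Rightarrow> ('i, 'h::complex_hilbert) op_matrix set \<Rightarrow> bool" where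
  "series_converge X \<A> \<longleftrightarrow>
    (\<forall>A\<in>\<A>. \<forall>B\<in>\<A>. \<forall>k\<in>X. \<forall>l\<in>X. (\<lambda>n. A k n o\<^sub>L B n l) summable_on X) \<and>
    (\<forall>A\<in>\<A>. \<forall>f\<in>ell2 X. \<forall>k\<in>X. (\<lambda>l. blinfun_apply (A k l) (f l)) summable_on X)"

definition matrix_algebra ::
    "'i set \<Rightarrow> ('i, 'h::complex_hilbert) op_matrix set \<Rightarrow> (('i, 'h) op_matrix \<Rightarrow> real) \<Rightarrow>
     ('i, 'h) op_matrix star_algebra" where
  "matrix_algebra X \<A> \<nu> =
    \<lparr>carrier = \<A>,
     monoid.mult = matrix_mult X,
     one = (\<lambda>k l. if k \<in> X \<and> k = l then id_blinfun else 0),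
     ring.zero = (\<lambda>k l. 0),
     add = (\<lambda>A B k l. A k l + B k l),
     module.smult = (\<lambda>c A k l. scale_op c (A k l)),
     star = (\<lambda>A k l. adj_op (A l k)),
     nrm = \<nu>\<rparr>"

definition solid ::
    "'i set \<Rightarrow> (('i, 'h::complex_hilbert) op_matrix, 'm) star_algebra_scheme \<Rightarrow> bool" where
  "solid X M \<longleftrightarrow>
    (\<forall>A\<in>carrier M. \<forall>B\<in>op_matrices X.
       (\<forall>k\<in>X. \<forall>l\<in>X. norm (B k l) \<le> norm (A k l)) \<longrightarrow> B \<in> carrier M \<and> nrm M B \<le> nrm M A)"


section \<open>Relatively separated sets and off-diagonal decay\<close>

definition relatively_separated :: "(real ^ 'd) set \<Rightarrow> bool" where
  "relatively_separated X \<longleftrightarrow> countable X \<and>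
    (\<exists>N. \<forall>x. finite (X \<inter> (+) x ` cbox 0 1) \<and> card (X \<inter> (+) x ` cbox 0 1) \<le> N)"

definition decay_matrices ::
    "(real ^ 'd) set \<Rightarrow> real \<Rightarrow> nat ^ 'd \<Rightarrow> (real ^ 'd, 'h::complex_hilbert) op_matrix set" where
  "decay_matrices X s \<alpha> = {A \<in> op_matrices X. \<exists>C>0. \<forall>k\<in>X. \<forall>l\<in>X.
     norm (A k l) \<le> C * (1 + norm (k - l)) powr (- s) *
       (\<Prod>j\<in>UNIV. (1 + \<bar>k $ j - l $ j\<bar>) powr (- real (\<alpha> $ j)))}"

end

theory Submission
  imports Defs
begin

text \<open>
  Let \<open>\<A>\<^sub>\<alpha>\<close> be the class of matrices with \<open>sup \<parallel>A\<^sub>k\<^sub>l\<parallel> W\<^sub>\<alpha>(k, l) < \<infinity>\<close> for the weight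
  \<open>W\<^sub>\<alpha>(k, l) = (1 + \<bar>k - l\<bar>)\<^sup>s (\<Prod>j. (1 + \<bar>k\<^sub>j - l\<^sub>j\<bar>) ^ \<alpha>\<^sub>j)\<close>. The first factor is subconvolutive on a
  relatively separated set because \<open>s > d\<close>, and the second is submultiplicative, so a multiple of the
  weighted supremum is a Banach algebra norm.

  If \<open>A \<in> \<A>\<^sub>0\<close> is bounded below on \<open>\<ell>\<^sup>2\<close>, then \<open>R = 1 - t A\<^sup>* A\<close> is a strict contraction for small \<open>t > 0\<close>.
  Interpolating between the decay of the entries and the operator norm gives
  \<open>\<parallel>B\<^sup>2\<parallel> \<le> C \<parallel>B\<parallel>\<^bsup>2 - \<theta>\<^esup> \<parallel>B\<parallel>\<^sub>o\<^sub>p\<^bsup>\<theta>\<^esup>\<close> (Brandenburg's trick), so a power of \<open>R\<close> has norm less than 1 in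
  \<open>\<A>\<^sub>0\<close>, and the Neumann series inverts \<open>A\<^sup>* A\<close> in \<open>\<A>\<^sub>0\<close>.
  For general \<open>\<alpha>\<close> one inducts on \<open>\<bar>\<alpha>\<bar>\<close>: \<open>\<A>\<^sub>\<alpha>\<^sub>+\<^sub>e\<^sub>j\<close> is the domain of the derivation
  \<open>\<delta>\<^sub>j A = ((k\<^sub>j - l\<^sub>j) A\<^sub>k\<^sub>l)\<close> in \<open>\<A>\<^sub>\<alpha>\<close>, and \<open>\<delta>\<^sub>j(P\<^sup>-\<^sup>1) = - P\<^sup>-\<^sup>1 \<delta>\<^sub>j(P) P\<^sup>-\<^sup>1\<close>.

  An invertible operator is bounded below, and so is \<open>z - A\<^sup>* A\<close> for \<open>z \<notin> [0, \<infinity>)\<close>; this yields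
  inverse-closedness and symmetry.
\<close>

section \<open>Complex Hilbert spaces\<close>

text \<open>Brandenburg's trick needs W(k,l) \<le> c (W(k,n) + W(n,l)), so that the weight of a
  product falls on a single factor. The isotropic weight has this property, but the coordinate
  powers can destroy it: if k - n and n - l are long steps along two different axes with positive
  exponents in \<alpha>, the left side carries both gains and each summand on the right only one.
  Hence the trick is run for \<alpha> = 0 alone, and the coordinate powers are recovered one at a
  time. Derivations could not do the whole work either, because the Leibniz argument starts from an
  inverse that already lies in the class. The strict inequality s > d leaves room for interpolation:
  part of the decay is exchanged for smallness of the operator norm while the rest stays summable. A
  lower bound on the square-summable families yields only a left inverse in the class. The other
  side comes from uniqueness of the inverse operator for inverse-closedness, and from passing to the
  adjoint for symmetry.\<close>

lemma cinner_add_right: "cinner x (y + z) = cinner x y + cinner x z"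
  by (metis cinner_add_left cinner_commute complex_cnj_add)

lemma cinner_scaleC_right: "cinner x (c *\<^sub>C y) = cnj c * cinner x y"
  by (metis cinner_scaleC_left cinner_commute complex_cnj_mult)

lemma cinner_scaleR_left: "cinner (r *\<^sub>R x) y = of_real r * cinner x y"
  by (metis cinner_scaleC_left scaleC_of_real)

lemma cinner_scaleR_right: "cinner x (r *\<^sub>R y) = of_real r * cinner x y"
  by (metis cinner_scaleC_right scaleC_of_real complex_cnj_complex_of_real)

lemma cinner_zero_left [simp]: "cinner 0 y = 0"
  using cinner_scaleR_left[of 0 0 y] by simp

lemma cinner_zero_right [simp]: "cinner y 0 = 0"
  using cinner_scaleR_right[of y 0 0] by simp

lemma cinner_minus_left: "cinner (- x) y = - cinner x y"
  using cinner_scaleR_left[of "-1" x y] by simp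

lemma cinner_minus_right: "cinner x (- y) = - cinner x y"
  using cinner_scaleR_right[of x "-1" y] by simp

lemma cinner_diff_left: "cinner (x - y) z = cinner x z - cinner y z"
  using cinner_add_left[of x "- y" z] by (simp add: cinner_minus_left)

lemma cinner_diff_right: "cinner x (y - z) = cinner x y - cinner x z"
  using cinner_add_right[of x y "- z"] by (simp add: cinner_minus_right)

lemma Re_cinner_self: "Re (cinner x x) = (norm x)\<^sup>2"
  by (simp add: norm_eq_sqrt_cinner cinner_self_nonneg)

lemma cinner_self: "cinner x x = of_real ((norm x)\<^sup>2)"
  using Re_cinner_self[of x] arg_cong[OF cinner_commute[of x x], of Im]
  by (simp add: complex_eq_iff)

lemma Re_cinner_commute: "Re (cinner x y) = Re (cinner y x)"
  by (subst cinner_commute) simp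

lemma norm_add_sq: "(norm (x + y))\<^sup>2 = (norm x)\<^sup>2 + 2 * Re (cinner x y) + (norm y)\<^sup>2"
  for x y :: "'h::complex_hilbert"
  using Re_cinner_commute[of x y]
  by (simp flip: Re_cinner_self add: cinner_add_left cinner_add_right)

lemma norm_diff_sq: "(norm (x - y))\<^sup>2 = (norm x)\<^sup>2 - 2 * Re (cinner x y) + (norm y)\<^sup>2"
  for x y :: "'h::complex_hilbert"
  using norm_add_sq[of x "- y"] by (simp add: cinner_minus_right)

lemma norm_scaleC: "norm (c *\<^sub>C x) = cmod c * norm x"
proof -
  have "cinner (c *\<^sub>C x) (c *\<^sub>C x) = of_real ((cmod c * norm x)\<^sup>2)"
    using complex_norm_square[of c]
    by (simp add: cinner_scaleC_left cinner_scaleC_right cinner_self[of x] power_mult_distrib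
        mult.assoc[symmetric])
  then have "(norm (c *\<^sub>C x))\<^sup>2 = (cmod c * norm x)\<^sup>2"
    unfolding cinner_self of_real_eq_iff .
  then show ?thesis by simp
qed

lemma scaleC_zero_right [simp]: "c *\<^sub>C 0 = 0"
  using norm_scaleC[of c 0] by simp

lemma scaleC_one [simp]: "1 *\<^sub>C x = x"
  using scaleC_of_real[of 1 x] by simp

lemma scaleC_zero_left [simp]: "0 *\<^sub>C x = 0"
  using scaleC_of_real[of 0 x] by simp

lemma scaleC_minus_left: "(- c) *\<^sub>C x = - (c *\<^sub>C x)"
  using scaleC_add_left[of c "- c" x] by (simp add: eq_neg_iff_add_eq_0 add.commute)

lemma scaleC_minus_right: "c *\<^sub>C (- x) = - (c *\<^sub>C x)"
  using scaleC_add_right[of c x "- x"] by (simp add: eq_neg_iff_add_eq_0 add.commute)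

lemma scaleC_diff_right: "c *\<^sub>C (x - y) = c *\<^sub>C x - c *\<^sub>C y"
  using scaleC_add_right[of c x "- y"] by (simp add: scaleC_minus_right)

lemma scaleC_scaleR_commute: "c *\<^sub>C (r *\<^sub>R x) = r *\<^sub>R (c *\<^sub>C x)"
  by (simp add: scaleC_scaleC mult.commute flip: scaleC_of_real)

lemma bounded_linear_scaleC: "bounded_linear ((*\<^sub>C) c)"
  by (rule bounded_linear_intro[where K="cmod c"])
    (auto simp: scaleC_add_right scaleC_scaleR_commute norm_scaleC)

lemma cinner_Cauchy_Schwarz: "cmod (cinner x y) \<le> norm x * norm y"
proof (cases "y = 0")
  case False
  define t where "t = cinner x y / of_real ((norm y)\<^sup>2)"
  have "(norm (x - t *\<^sub>C y))\<^sup>2 = (norm x)\<^sup>2 - (cmod (cinner x y))\<^sup>2 / (norm y)\<^sup>2"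
  proof -
    have *: "cnj z * z = complex_of_real ((cmod z)\<^sup>2)" for z
      using complex_norm_square[of z] by (simp add: mult.commute)
    have "Re (cinner x (t *\<^sub>C y)) = (cmod (cinner x y))\<^sup>2 / (norm y)\<^sup>2"
      by (simp add: cinner_scaleC_right t_def * del: of_real_power flip: of_real_divide)
    moreover have "(norm (t *\<^sub>C y))\<^sup>2 = (cmod (cinner x y))\<^sup>2 / (norm y)\<^sup>2"
      using False by (simp add: norm_scaleC t_def norm_divide norm_mult power_divide
          field_simps power2_eq_square)
    ultimately show ?thesis by (simp add: norm_diff_sq)
  qed
  then have "(cmod (cinner x y))\<^sup>2 / (norm y)\<^sup>2 \<le> (norm x)\<^sup>2"
    using zero_le_power2[of "norm (x - t *\<^sub>C y)"] by linarith
  then have "(cmod (cinner x y))\<^sup>2 \<le> (norm x * norm y)\<^sup>2"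
    using False by (simp add: field_simps power_mult_distrib)
  then show ?thesis
    by (rule power2_le_imp_le) simp
qed simp

lemma bounded_bilinear_cinner: "bounded_bilinear cinner"
proof
  show "\<exists>K. \<forall>a b. norm (cinner a b) \<le> norm a * norm b * K"
    by (rule exI[of _ 1]) (simp add: cinner_Cauchy_Schwarz)
qed (auto simp: cinner_add_left cinner_add_right cinner_scaleR_left cinner_scaleR_right
    scaleR_conv_of_real)

lemma bounded_linear_cinner_left: "bounded_linear (\<lambda>x. cinner x y)"
  by (rule bounded_bilinear.bounded_linear_left[OF bounded_bilinear_cinner])

lemma bounded_linear_cinner_right: "bounded_linear (cinner x)"
  by (rule bounded_bilinear.bounded_linear_right[OF bounded_bilinear_cinner])

lemma cinner_eqI:
  assumes "\<And>x. cinner x y = cinner x z"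
  shows "y = z"
proof -
  have "cinner (y - z) (y - z) = 0"
    using assms[of "y - z"] by (simp add: cinner_diff_right)
  then show ?thesis by (simp add: cinner_self)
qed

text \<open>
  The representing vector minimizes \<open>\<parallel>x\<parallel>\<^sup>2 - 2 \<phi> x\<close>; a minimizing sequence is Cauchy by the
  parallelogram law.
\<close>

lemma Riesz_representation_real:
  fixes \<phi> :: "'h::complex_hilbert \<Rightarrow> real"
  assumes "bounded_linear \<phi>"
  obtains z where "\<And>x. \<phi> x = Re (cinner x z)"
proof -
  interpret bounded_linear \<phi> by fact
  obtain M where M: "\<And>x. norm (\<phi> x) \<le> norm x * M"
    using bounded by blast
  define J where "J x = (norm x)\<^sup>2 - 2 * \<phi> x" for x
  have "- M\<^sup>2 \<le> J x" for x
  proof -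
    have "\<phi> x \<le> norm x * M" using M[of x] by simp
    moreover have "0 \<le> (norm x - M)\<^sup>2" by simp
    ultimately show ?thesis by (simp add: J_def power2_diff)
  qed
  then have bdd: "bdd_below (range J)" by (auto intro!: bdd_belowI[of _ "- M\<^sup>2"])
  define m where "m = Inf (range J)"
  have mle: "m \<le> J x" for x unfolding m_def by (rule cInf_lower) (use bdd in auto)
  have "\<exists>x. J x < m + inverse (real (Suc n))" for n
  proof -
    have "Inf (range J) < m + inverse (real (Suc n))"
      unfolding m_def by simp
    then show ?thesis using bdd by (subst (asm) cInf_less_iff) auto
  qed
  then obtain x where x: "\<And>n. J (x n) < m + inverse (real (Suc n))" by metis
  have par: "(norm (a - b))\<^sup>2 \<le> 2 * (J a - m) + 2 * (J b - m)" for a b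
  proof -
    have "J ((1/2) *\<^sub>R (a + b)) = (J a + J b) / 2 - (norm (a - b))\<^sup>2 / 4"
    proof -
      have "(norm ((1/2) *\<^sub>R (a + b)))\<^sup>2 = (norm (a + b))\<^sup>2 / 4"
        by (simp add: power_divide)
      moreover have "\<phi> ((1/2) *\<^sub>R (a + b)) = (\<phi> a + \<phi> b) / 2"
        by (simp add: scaleR add)
      ultimately show ?thesis unfolding J_def
        by (simp add: norm_add_sq norm_diff_sq field_simps)
    qed
    then show ?thesis using mle[of "(1/2) *\<^sub>R (a + b)"] by argo
  qed
  have "Cauchy x"
  proof (rule CauchyI)
    fix e :: real assume e: "0 < e"
    obtain N where N: "inverse (real (Suc N)) < e\<^sup>2 / 4"
      using reals_Archimedean[of "e\<^sup>2/4"] e by auto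
    have "norm (x i - x j) < e" if "N \<le> i" "N \<le> j" for i j
    proof -
      have small: "J (x i) - m < e\<^sup>2 / 4" if "N \<le> i" for i
      proof -
        have "inverse (real (Suc i)) \<le> inverse (real (Suc N))"
          using that by (intro le_imp_inverse_le) auto
        then have "inverse (real (Suc i)) < e\<^sup>2 / 4" using N by (rule order.strict_trans1)
        with x[of i] show ?thesis by argo
      qed
      have "(norm (x i - x j))\<^sup>2 < e\<^sup>2"
        using par[of "x i" "x j"] small[OF that(1)] small[OF that(2)] by argo
      then show ?thesis using e by (simp add: power_less_imp_less_base)
    qed
    then show "\<exists>M. \<forall>m\<ge>M. \<forall>n\<ge>M. norm (x m - x n) < e" by blast
  qed
  then obtain z where z: "x \<longlonglongrightarrow> z" using Cauchy_convergent_iff convergent_def by blast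
  have "(\<lambda>n. J (x n)) \<longlonglongrightarrow> J z"
    unfolding J_def by (intro tendsto_intros tendsto z)
  moreover have "(\<lambda>n. m + inverse (real (Suc n))) \<longlonglongrightarrow> m + 0"
    by (intro tendsto_intros LIMSEQ_inverse_real_of_nat)
  ultimately have Jz: "J z \<le> m"
    by (intro LIMSEQ_le[of "\<lambda>n. J (x n)" "J z" "\<lambda>n. m + inverse (real (Suc n))" m])
      (use x in \<open>auto intro: less_imp_le\<close>)
  have le: "2 * t * (\<phi> h - Re (cinner h z)) \<le> t\<^sup>2 * (norm h)\<^sup>2" for t h
  proof -
    have "J z \<le> J (z + t *\<^sub>R h)" using Jz mle[of "z + t *\<^sub>R h"] by simp
    also have "\<dots> = J z + 2 * t * (Re (cinner h z) - \<phi> h) + t\<^sup>2 * (norm h)\<^sup>2"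
      by (simp add: J_def norm_add_sq cinner_scaleR_right add scaleR
          Re_cinner_commute[of z h] power_mult_distrib algebra_simps)
    finally show ?thesis by (simp add: algebra_simps)
  qed
  have "\<phi> h = Re (cinner h z)" for h
  proof (cases "h = 0")
    case False
    define r where "r = \<phi> h - Re (cinner h z)"
    \<comment> \<open>The quadratic 2 t r - t^2 ||h||^2, nonpositive by \<open>le\<close>, is
      largest at t = r / ||h||^2.\<close>
    have "2 * (r / (norm h)\<^sup>2) * r \<le> (r / (norm h)\<^sup>2)\<^sup>2 * (norm h)\<^sup>2"
      using le[of "r / (norm h)\<^sup>2" h] unfolding r_def .
    then have "2 * r\<^sup>2 / (norm h)\<^sup>2 \<le> r\<^sup>2 / (norm h)\<^sup>2"
      using False by (simp add: power2_eq_square)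
    then have "r = 0" using False by (simp add: field_simps)
    then show ?thesis by (simp add: r_def)
  qed (simp add: zero)
  then show ?thesis using that by blast
qed

section \<open>Complex-linear operators and their adjoints\<close>

lemma adj_op_eqI:
  assumes "\<And>x y. cinner (blinfun_apply T x) y = cinner x (blinfun_apply S y)"
  shows "adj_op T = S"
  unfolding adj_op_def
proof (rule the_equality)
  fix S' assume "\<forall>x y. cinner (blinfun_apply T x) y = cinner x (blinfun_apply S' y)"
  then show "S' = S" using assms by (intro blinfun_eqI cinner_eqI) metis
qed (use assms in blast)

lemma clinear_op_adj_exists:
  fixes T :: "'h::complex_hilbert \<Rightarrow>\<^sub>L 'h"
  assumes "clinear_op T"
  shows "\<exists>S. \<forall>x y. cinner (blinfun_apply T x) y = cinner x (blinfun_apply S y)"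
proof -
  have "\<exists>z. \<forall>x. Re (cinner (blinfun_apply T x) y) = Re (cinner x z)" for y
    by (rule Riesz_representation_real[of "\<lambda>x. Re (cinner (blinfun_apply T x) y)"])
      (auto intro!: bounded_linear_compose[OF bounded_linear_Re]
        bounded_linear_compose[OF bounded_linear_cinner_left] blinfun.bounded_linear_right)
  then obtain S where S: "\<And>x y. Re (cinner (blinfun_apply T x) y) = Re (cinner x (S y))"
    by metis
  \<comment> \<open>The real representation gives real parts only. The imaginary part of an inner
    product is minus its real part with x replaced by i x, and complex linearity moves i through
    T.\<close>
  have adj: "cinner (blinfun_apply T x) y = cinner x (S y)" for x y
    using S[of x y] S[of "\<i> *\<^sub>C x" y] assms
    by (simp add: clinear_op_def cinner_scaleC_left complex_eq_iff)
  have "bounded_linear S"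
  proof (rule bounded_linear_intro[where K="norm T"])
    show "S (x + y) = S x + S y" for x y
      by (rule cinner_eqI) (simp add: cinner_add_right flip: adj)
    show "S (r *\<^sub>R x) = r *\<^sub>R S x" for r x
      by (rule cinner_eqI) (simp add: cinner_scaleR_right flip: adj)
    show "norm (S x) \<le> norm x * norm T" for x
    proof (cases "S x = 0")
      case False
      have "(norm (S x))\<^sup>2 = cmod (cinner (blinfun_apply T (S x)) x)"
        by (simp add: adj cinner_self norm_power)
      also have "\<dots> \<le> norm (blinfun_apply T (S x)) * norm x"
        by (rule cinner_Cauchy_Schwarz)
      also have "\<dots> \<le> (norm T * norm (S x)) * norm x"
        by (intro mult_right_mono norm_blinfun) simp
      finally have "norm (S x) * norm (S x) \<le> norm (S x) * (norm x * norm T)"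
        by (simp add: power2_eq_square mult_ac)
      then show ?thesis using False by simp
    qed simp
  qed
  then show ?thesis
    using adj by (intro exI[of _ "Blinfun S"]) (simp add: bounded_linear_Blinfun_apply)
qed

lemma cinner_adj_op:
  assumes "clinear_op T"
  shows "cinner (blinfun_apply T x) y = cinner x (blinfun_apply (adj_op T) y)"
  using clinear_op_adj_exists[OF assms] adj_op_eqI by metis

lemma cinner_adj_op':
  assumes "clinear_op T"
  shows "cinner (blinfun_apply (adj_op T) x) y = cinner x (blinfun_apply T y)"
  by (metis assms cinner_adj_op cinner_commute)

lemma adj_op_adj_op: "clinear_op T \<Longrightarrow> adj_op (adj_op T) = T"
  by (rule adj_op_eqI) (simp add: cinner_adj_op')

lemma clinear_op_adj_op:
  assumes "clinear_op T"
  shows "clinear_op (adj_op T)"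
  unfolding clinear_op_def
proof (intro allI)
  fix c x
  show "blinfun_apply (adj_op T) (c *\<^sub>C x) = c *\<^sub>C blinfun_apply (adj_op T) x"
    by (rule cinner_eqI) (simp add: cinner_scaleC_right assms flip: cinner_adj_op)
qed

lemma norm_adj_op_le:
  assumes "clinear_op T"
  shows "norm (adj_op T) \<le> norm T"
proof (rule norm_blinfun_bound)
  let ?S = "blinfun_apply (adj_op T)"
  show "norm (?S x) \<le> norm T * norm x" for x
  proof (cases "?S x = 0")
    case False
    have "(norm (?S x))\<^sup>2 = cmod (cinner (blinfun_apply T (?S x)) x)"
      by (simp add: cinner_adj_op assms cinner_self norm_power)
    also have "\<dots> \<le> norm (blinfun_apply T (?S x)) * norm x"
      by (rule cinner_Cauchy_Schwarz)
    also have "\<dots> \<le> (norm T * norm (?S x)) * norm x"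
      by (intro mult_right_mono norm_blinfun) simp
    finally have "norm (?S x) * norm (?S x) \<le> norm (?S x) * (norm T * norm x)"
      by (simp add: power2_eq_square mult_ac)
    then show ?thesis using False by simp
  qed simp
qed simp

lemma norm_adj_op: "clinear_op T \<Longrightarrow> norm (adj_op T) = norm T"
  by (metis adj_op_adj_op antisym clinear_op_adj_op norm_adj_op_le)

lemma blinfun_apply_scale_op [simp]: "blinfun_apply (scale_op c T) x = c *\<^sub>C blinfun_apply T x"
proof -
  have "bounded_linear (\<lambda>x. c *\<^sub>C blinfun_apply T x)"
    by (rule bounded_linear_compose[OF bounded_linear_scaleC blinfun.bounded_linear_right])
  then show ?thesis by (simp add: scale_op_def bounded_linear_Blinfun_apply)
qed

lemma clinear_op_zero [simp]: "clinear_op 0"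
  and clinear_op_id [simp]: "clinear_op id_blinfun"
  by (auto simp: clinear_op_def)

lemma clinear_op_add: "clinear_op S \<Longrightarrow> clinear_op T \<Longrightarrow> clinear_op (S + T)"
  and clinear_op_diff: "clinear_op S \<Longrightarrow> clinear_op T \<Longrightarrow> clinear_op (S - T)"
  and clinear_op_scaleR: "clinear_op S \<Longrightarrow> clinear_op (r *\<^sub>R S)"
  and clinear_op_scale_op: "clinear_op S \<Longrightarrow> clinear_op (scale_op c S)"
  and clinear_op_compose: "clinear_op S \<Longrightarrow> clinear_op T \<Longrightarrow> clinear_op (S o\<^sub>L T)"
  by (auto simp: clinear_op_def blinfun.bilinear_simps scaleC_add_right scaleC_diff_right
      scaleC_scaleR_commute scaleC_scaleC mult.commute)

lemma norm_scale_op: "norm (scale_op c T) = cmod c * norm T"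
proof (cases "c = 0")
  case True
  then have "scale_op c T = 0" by (intro blinfun_eqI) simp
  with True show ?thesis by simp
next
  case False
  have le: "norm (scale_op b S) \<le> cmod b * norm S" for b and S :: "'a \<Rightarrow>\<^sub>L 'a"
    by (rule norm_blinfun_bound) (auto simp: norm_scaleC mult.assoc norm_blinfun intro!: mult_left_mono)
  have "scale_op (inverse c) (scale_op c T) = T"
    using False by (intro blinfun_eqI) (simp add: scaleC_scaleC)
  then have "norm T \<le> cmod (inverse c) * norm (scale_op c T)"
    using le[of "inverse c" "scale_op c T"] by simp
  then have "cmod c * norm T \<le> norm (scale_op c T)"
    using False by (simp add: norm_divide norm_inverse field_simps)
  with le[of c T] show ?thesis by simp
qed

lemma bounded_linear_scale_op: "bounded_linear (scale_op c)"
  by (rule bounded_linear_intro[where K="cmod c"])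
    (auto intro!: blinfun_eqI simp: norm_scale_op blinfun.bilinear_simps scaleC_add_right scaleC_scaleR_commute)

lemma infsum_blinfun_apply:
  assumes "T summable_on X"
  shows "blinfun_apply (infsum T X) x = (\<Sum>\<^sub>\<infinity>n\<in>X. blinfun_apply (T n) x)"
    and "(\<lambda>n. blinfun_apply (T n) x) summable_on X"
  using has_sum_bounded_linear[OF blinfun.bounded_linear_left has_sum_infsum[OF assms], of x]
  by (auto simp: infsumI summable_on_def)

lemma clinear_op_infsum:
  assumes "\<And>n. n \<in> X \<Longrightarrow> clinear_op (T n)"
  shows "clinear_op (infsum T X)"
proof (cases "T summable_on X")
  case True
  have "blinfun_apply (infsum T X) (c *\<^sub>C x) = c *\<^sub>C blinfun_apply (infsum T X) x" for c x
  proof -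
    have "blinfun_apply (infsum T X) (c *\<^sub>C x) = (\<Sum>\<^sub>\<infinity>n\<in>X. c *\<^sub>C blinfun_apply (T n) x)"
      unfolding infsum_blinfun_apply(1)[OF True]
      by (rule infsum_cong) (use assms in \<open>simp add: clinear_op_def\<close>)
    also have "\<dots> = c *\<^sub>C (\<Sum>\<^sub>\<infinity>n\<in>X. blinfun_apply (T n) x)"
      by (rule infsumI has_sum_bounded_linear bounded_linear_scaleC has_sum_infsum
          infsum_blinfun_apply(2) True)+
    finally show ?thesis by (simp add: infsum_blinfun_apply(1)[OF True])
  qed
  then show ?thesis by (simp add: clinear_op_def)
\<comment> \<open>Otherwise \<open>infsum\<close> has its default value 0, which is complex-linear.
  Thus \<open>op_matrices\<close> is closed under \<open>matrix_mult\<close> whether or not the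
  series converge.\<close>
qed (simp add: infsum_not_exists)

lemma clinear_op_limit:
  assumes "T \<longlonglongrightarrow> S" "\<And>n. clinear_op (T n)"
  shows "clinear_op S"
  unfolding clinear_op_def
proof (intro allI)
  fix c x
  have lim: "(\<lambda>n. blinfun_apply (T n) y) \<longlonglongrightarrow> blinfun_apply S y" for y
    by (intro tendsto_intros assms(1))
  have "(\<lambda>n. blinfun_apply (T n) (c *\<^sub>C x)) \<longlonglongrightarrow> c *\<^sub>C blinfun_apply S x"
    using bounded_linear.tendsto[OF bounded_linear_scaleC lim] assms(2)
    by (simp add: clinear_op_def)
  then show "blinfun_apply S (c *\<^sub>C x) = c *\<^sub>C blinfun_apply S x"
    using lim LIMSEQ_unique by blast
qed

lemma adj_op_zero [simp]: "adj_op 0 = 0"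
  and adj_op_id [simp]: "adj_op id_blinfun = id_blinfun"
  by (auto intro!: adj_op_eqI)

lemma adj_op_add: "clinear_op S \<Longrightarrow> clinear_op T \<Longrightarrow> adj_op (S + T) = adj_op S + adj_op T"
  and adj_op_diff: "clinear_op S \<Longrightarrow> clinear_op T \<Longrightarrow> adj_op (S - T) = adj_op S - adj_op T"
  and adj_op_scale_op: "clinear_op S \<Longrightarrow> adj_op (scale_op c S) = scale_op (cnj c) (adj_op S)"
  and adj_op_compose: "clinear_op S \<Longrightarrow> clinear_op T \<Longrightarrow> adj_op (S o\<^sub>L T) = adj_op T o\<^sub>L adj_op S"
  by (auto intro!: adj_op_eqI simp: blinfun.bilinear_simps cinner_adj_op cinner_add_left
      cinner_add_right cinner_diff_left cinner_diff_right cinner_scaleC_left cinner_scaleC_right)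

text \<open>\<open>adj_op\<close> is a description that yields an adjoint on complex-linear
  operators only, so it cannot be treated as a continuous map on the whole operator space. The two
  sums are compared weakly, through inner products.\<close>

lemma adj_op_infsum:
  assumes "T summable_on X" "(\<lambda>n. adj_op (T n)) summable_on X"
    and "\<And>n. n \<in> X \<Longrightarrow> clinear_op (T n)"
  shows "adj_op (infsum T X) = (\<Sum>\<^sub>\<infinity>n\<in>X. adj_op (T n))"
proof (rule adj_op_eqI)
  fix x y
  have "cinner (blinfun_apply (infsum T X) x) y = (\<Sum>\<^sub>\<infinity>n\<in>X. cinner (blinfun_apply (T n) x) y)"
    unfolding infsum_blinfun_apply(1)[OF assms(1)]
    by (rule infsumI[symmetric] has_sum_bounded_linear bounded_linear_cinner_left has_sum_infsum
        infsum_blinfun_apply(2) assms)+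
  also have "\<dots> = (\<Sum>\<^sub>\<infinity>n\<in>X. cinner x (blinfun_apply (adj_op (T n)) y))"
    by (rule infsum_cong) (simp add: cinner_adj_op assms)
  also have "\<dots> = cinner x (blinfun_apply (\<Sum>\<^sub>\<infinity>n\<in>X. adj_op (T n)) y)"
    unfolding infsum_blinfun_apply(1)[OF assms(2)]
    by (rule infsumI has_sum_bounded_linear bounded_linear_cinner_right has_sum_infsum
        infsum_blinfun_apply(2) assms)+
  finally show "cinner (blinfun_apply (infsum T X) x) y
      = cinner x (blinfun_apply (\<Sum>\<^sub>\<infinity>n\<in>X. adj_op (T n)) y)" .
qed

section \<open>Weighted classes of operator-valued matrices\<close>

text \<open>The criterion behind every interchange of sums below: a summable outer majorant and
  uniformly bounded inner sums. Typical choices are a row of A outside and rows of B inside, or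
  squared norms of a family outside and columns of A inside.\<close>

lemma abs_summable_on_double:
  fixes g :: "'a \<Rightarrow> 'b \<Rightarrow> 'c::banach" and p :: "'a \<Rightarrow> real"
  assumes p: "p summable_on X" "\<And>n. n \<in> X \<Longrightarrow> 0 \<le> p n"
    and b: "\<And>n. n \<in> X \<Longrightarrow> b n summable_on Y" "\<And>n. n \<in> X \<Longrightarrow> infsum (b n) Y \<le> C"
    and le: "\<And>n l. n \<in> X \<Longrightarrow> l \<in> Y \<Longrightarrow> norm (g n l) \<le> p n * b n l"
  shows "(\<lambda>(n, l). norm (g n l)) summable_on X \<times> Y"
proof -
  have row: "(\<lambda>l. norm (g n l)) summable_on Y" if "n \<in> X" for n
    by (rule Infinite_Sum.abs_summable_on_comparison_test'[OF summable_on_cmult_right[OF b(1)[OF that], of "p n"]])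
      (use le that in auto)
  have "norm (\<Sum>\<^sub>\<infinity>l\<in>Y. norm (g n l)) \<le> p n * C" if n: "n \<in> X" for n
  proof -
    have "(\<Sum>\<^sub>\<infinity>l\<in>Y. norm (g n l)) \<le> (\<Sum>\<^sub>\<infinity>l\<in>Y. p n * b n l)"
      by (rule infsum_mono) (use n row le b in \<open>auto intro: summable_on_cmult_right\<close>)
    also have "\<dots> = p n * infsum (b n) Y"
      by (rule infsum_cmult_right) (use n b in auto)
    also have "\<dots> \<le> p n * C" by (intro mult_left_mono b p n)
    finally show ?thesis by (simp add: infsum_nonneg)
  qed
  then have "(\<lambda>n. norm (\<Sum>\<^sub>\<infinity>l\<in>Y. norm (g n l))) summable_on X"
    by (intro Infinite_Sum.abs_summable_on_comparison_test'[OF summable_on_cmult_left[OF p(1), of C]]) auto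
  then show ?thesis
    using Infinite_Sum.abs_summable_on_Sigma_iff[of "\<lambda>(n, l). g n l" X "\<lambda>_. Y"] row
    by (simp add: case_prod_unfold)
qed

lemma abs_summable_on_double_swap:
  fixes g :: "'a \<Rightarrow> 'b \<Rightarrow> 'c::banach"
  assumes "(\<lambda>(n, l). norm (g n l)) summable_on X \<times> Y"
  shows "(\<lambda>(l, n). norm (g n l)) summable_on Y \<times> X"
  using assms summable_on_swap[of "\<lambda>(n, l). norm (g n l)" X Y]
  by (simp add: case_prod_unfold)

lemma abs_summable_on_double_rows:
  fixes g :: "'a \<Rightarrow> 'b \<Rightarrow> 'c::banach"
  assumes "(\<lambda>(n, l). norm (g n l)) summable_on X \<times> Y" "n \<in> X"
  shows "(\<lambda>l. norm (g n l)) summable_on Y"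
  using assms Infinite_Sum.abs_summable_on_Sigma_iff[of "\<lambda>(n, l). g n l" X "\<lambda>_. Y"]
  by (simp add: case_prod_unfold)

lemma abs_summable_on_double_sums:
  fixes g :: "'a \<Rightarrow> 'b \<Rightarrow> 'c::banach"
  assumes "(\<lambda>(n, l). norm (g n l)) summable_on X \<times> Y"
  shows "(\<lambda>n. \<Sum>\<^sub>\<infinity>l\<in>Y. g n l) summable_on X"
    and "(\<Sum>\<^sub>\<infinity>n\<in>X. \<Sum>\<^sub>\<infinity>l\<in>Y. g n l) = (\<Sum>\<^sub>\<infinity>l\<in>Y. \<Sum>\<^sub>\<infinity>n\<in>X. g n l)"
proof -
  have "(\<lambda>(n, l). g n l) summable_on X \<times> Y"
    by (rule abs_summable_summable) (use assms in \<open>simp add: case_prod_unfold\<close>)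
  then show "(\<lambda>n. \<Sum>\<^sub>\<infinity>l\<in>Y. g n l) summable_on X"
    "(\<Sum>\<^sub>\<infinity>n\<in>X. \<Sum>\<^sub>\<infinity>l\<in>Y. g n l) = (\<Sum>\<^sub>\<infinity>l\<in>Y. \<Sum>\<^sub>\<infinity>n\<in>X. g n l)"
    by (rule summable_on_Sigma_banach infsum_swap_banach)+
qed

section \<open>The weighted class and its operations\<close>

definition weighted_matrices ::
    "'i set \<Rightarrow> ('i \<Rightarrow> 'i \<Rightarrow> real) \<Rightarrow> ('i, 'h::complex_hilbert) op_matrix set" where
  "weighted_matrices X W =
    {A \<in> op_matrices X. \<exists>C. \<forall>k\<in>X. \<forall>l\<in>X. norm (A k l) * W k l \<le> C}"

text \<open>The supremum runs over all index pairs. Entries outside \<open>X\<close> vanish, so at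
  most the value 0 is added, and the supremum is taken over a nonempty set even when
  \<open>X\<close> is empty.\<close>

definition weighted_norm ::
    "('i \<Rightarrow> 'i \<Rightarrow> real) \<Rightarrow> ('i, 'h::complex_hilbert) op_matrix \<Rightarrow> real" where
  "weighted_norm W A = (SUP (k, l). norm (A k l) * W k l)"

definition one_matrix :: "'i set \<Rightarrow> ('i, 'h::complex_hilbert) op_matrix" where
  "one_matrix X = (\<lambda>k l. if k \<in> X \<and> k = l then id_blinfun else 0)"

definition adj_matrix :: "('i, 'h::complex_hilbert) op_matrix \<Rightarrow> ('i, 'h) op_matrix" where
  "adj_matrix A = (\<lambda>k l. adj_op (A l k))"

definition scale_matrix :: "complex \<Rightarrow> ('i, 'h::complex_hilbert) op_matrix \<Rightarrow> ('i, 'h) op_matrix" where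
  "scale_matrix c A = (\<lambda>k l. scale_op c (A k l))"

lemma op_matricesD:
  assumes "A \<in> op_matrices X"
  shows "clinear_op (A k l)" "k \<notin> X \<Longrightarrow> A k l = 0" "l \<notin> X \<Longrightarrow> A k l = 0"
  using assms by (auto simp: op_matrices_def)

lemma one_matrix_in_op_matrices: "one_matrix X \<in> op_matrices X"
  by (auto simp: op_matrices_def one_matrix_def)

lemma adj_matrix_in_op_matrices: "A \<in> op_matrices X \<Longrightarrow> adj_matrix A \<in> op_matrices X"
  by (auto simp: op_matrices_def adj_matrix_def clinear_op_adj_op)

lemma adj_matrix_adj_matrix: "A \<in> op_matrices X \<Longrightarrow> adj_matrix (adj_matrix A) = A"
  by (auto simp: op_matrices_def adj_matrix_def adj_op_adj_op)

lemma scale_op_zero [simp]: "scale_op c 0 = 0"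
  by (rule blinfun_eqI) simp

lemma scale_matrix_in_op_matrices: "A \<in> op_matrices X \<Longrightarrow> scale_matrix c A \<in> op_matrices X"
  by (auto simp: op_matrices_def scale_matrix_def clinear_op_scale_op)

lemma matrix_mult_in_op_matrices:
  "A \<in> op_matrices X \<Longrightarrow> B \<in> op_matrices X \<Longrightarrow> matrix_mult X A B \<in> op_matrices X"
  by (auto simp: op_matrices_def matrix_mult_def blinfun.zero_left
      intro!: clinear_op_infsum clinear_op_compose)

lemma blinfun_compose_assoc: "(A o\<^sub>L B) o\<^sub>L C = A o\<^sub>L (B o\<^sub>L C)"
  by (rule blinfun_eqI) simp

text \<open>The first sum bound feeds Schur's test and so gives bounded operators; the second is
  subconvolutivity of 1/W and gives closure under products. One constant serves both, so K times the
  weighted supremum is submultiplicative and also dominates the operator norm. Bounding finite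
  partial sums makes convergence a conclusion.\<close>

locale decay_weight =
  fixes X :: "'i set" and W :: "'i \<Rightarrow> 'i \<Rightarrow> real" and K :: real
  assumes W_ge_1: "1 \<le> W k l"
    and W_refl: "W k k = 1"
    and W_sym: "W k l = W l k"
    and K_pos: "0 < K"
    and sum_inverse_W_le: "\<lbrakk>k \<in> X; finite F; F \<subseteq> X\<rbrakk> \<Longrightarrow> (\<Sum>n\<in>F. 1 / W k n) \<le> K"
    and sum_convolution_W_le:
      "\<lbrakk>k \<in> X; l \<in> X; finite F; F \<subseteq> X\<rbrakk> \<Longrightarrow> (\<Sum>n\<in>F. W k l / (W k n * W n l)) \<le> K"
begin

lemma W_pos: "0 < W k l"
  using W_ge_1[of k l] by simp

lemma weighted_entry_le:
  assumes "A \<in> weighted_matrices X W"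
  shows "norm (A k l) * W k l \<le> weighted_norm W A"
proof -
  obtain C where C: "\<And>k l. k \<in> X \<Longrightarrow> l \<in> X \<Longrightarrow> norm (A k l) * W k l \<le> C"
    using assms by (auto simp: weighted_matrices_def)
  \<comment> \<open>The maximum with 0 covers the vanishing entries outside \<open>X\<close>; if
    \<open>X\<close> is empty, \<open>C\<close> may be negative.\<close>
  have "norm (A k l) * W k l \<le> max 0 C" for k l
    using C[of k l] op_matricesD(2)[of A X k l] op_matricesD(3)[of A X l k] assms
    by (cases "k \<in> X \<and> l \<in> X") (auto simp: weighted_matrices_def)
  then have "bdd_above (range (\<lambda>(k, l). norm (A k l) * W k l))"
    by (intro bdd_aboveI[of _ "max 0 C"]) auto
  from cSUP_upper[OF _ this, of "(k, l)"] show ?thesis by (simp add: weighted_norm_def)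
qed

lemma weighted_norm_nonneg: "A \<in> weighted_matrices X W \<Longrightarrow> 0 \<le> weighted_norm W A"
  by (rule order_trans[OF _ weighted_entry_le]) (intro mult_nonneg_nonneg norm_ge_zero less_imp_le W_pos)

lemma norm_entry_le:
  assumes "A \<in> weighted_matrices X W"
  shows "norm (A k l) \<le> weighted_norm W A / W k l" "norm (A k l) \<le> weighted_norm W A"
proof -
  show "norm (A k l) \<le> weighted_norm W A / W k l"
    using weighted_entry_le[OF assms, of k l] by (simp add: pos_le_divide_eq W_pos)
  also have "\<dots> \<le> weighted_norm W A / 1"
    by (rule divide_left_mono) (auto simp: W_ge_1 W_pos weighted_norm_nonneg assms)
  finally show "norm (A k l) \<le> weighted_norm W A" by simp
qed

lemma weighted_matricesI:
  assumes "A \<in> op_matrices X"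
    and "\<And>k l. k \<in> X \<Longrightarrow> l \<in> X \<Longrightarrow> norm (A k l) * W k l \<le> C"
  shows "A \<in> weighted_matrices X W" and "0 \<le> C \<Longrightarrow> weighted_norm W A \<le> C"
proof -
  show "A \<in> weighted_matrices X W" using assms by (auto simp: weighted_matrices_def)
  assume "0 \<le> C"
  then have "norm (A k l) * W k l \<le> C" for k l
    using assms(2) op_matricesD(2)[OF assms(1), of k l] op_matricesD(3)[OF assms(1), of l k] by (cases "k \<in> X \<and> l \<in> X") auto
  then show "weighted_norm W A \<le> C" unfolding weighted_norm_def by (intro cSUP_least) auto
qed

lemma weighted_matrices_op: "A \<in> weighted_matrices X W \<Longrightarrow> A \<in> op_matrices X"
  by (simp add: weighted_matrices_def)

lemma weighted_rows:
  assumes "A \<in> weighted_matrices X W" "k \<in> X"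
  shows "(\<lambda>l. norm (A k l)) summable_on X" "(\<Sum>\<^sub>\<infinity>l\<in>X. norm (A k l)) \<le> K * weighted_norm W A"
proof -
  have fin: "(\<Sum>l\<in>F. norm (A k l)) \<le> K * weighted_norm W A" if F: "finite F" "F \<subseteq> X" for F
  proof -
    have "(\<Sum>l\<in>F. norm (A k l)) \<le> (\<Sum>l\<in>F. (1 / W k l) * weighted_norm W A)"
      using norm_entry_le(1)[OF assms(1)] by (intro sum_mono) simp
    also have "\<dots> = (\<Sum>l\<in>F. 1 / W k l) * weighted_norm W A" by (simp add: sum_distrib_right)
    also have "\<dots> \<le> K * weighted_norm W A"
      by (intro mult_right_mono sum_inverse_W_le weighted_norm_nonneg assms F)
    finally show ?thesis .
  qed
  show "(\<lambda>l. norm (A k l)) summable_on X"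
    by (rule nonneg_bdd_above_summable_on)
      (auto intro!: bdd_aboveI[of _ "K * weighted_norm W A"] fin)
  then show "(\<Sum>\<^sub>\<infinity>l\<in>X. norm (A k l)) \<le> K * weighted_norm W A"
    by (rule infsum_le_finite_sums) (rule fin)
qed

lemma adj_matrix_weighted:
  assumes "A \<in> weighted_matrices X W"
  shows "adj_matrix A \<in> weighted_matrices X W" "weighted_norm W (adj_matrix A) = weighted_norm W A"
proof -
  have *: "adj_matrix A \<in> weighted_matrices X W \<and> weighted_norm W (adj_matrix A) \<le> weighted_norm W A"
    if "A \<in> weighted_matrices X W" for A :: "('i, 'b::complex_hilbert) op_matrix"
  proof -
    have "norm (adj_matrix A k l) * W k l \<le> weighted_norm W A" for k l
      using weighted_entry_le[OF that, of l k] op_matricesD(1)[OF weighted_matrices_op[OF that]]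
      by (simp add: adj_matrix_def norm_adj_op W_sym)
    then show ?thesis
      by (intro conjI weighted_matricesI[OF adj_matrix_in_op_matrices[OF weighted_matrices_op[OF that]]]
          weighted_norm_nonneg that)
  qed
  from *[OF assms] show "adj_matrix A \<in> weighted_matrices X W" by simp
  moreover have "weighted_norm W A \<le> weighted_norm W (adj_matrix A)"
    using *[OF calculation] adj_matrix_adj_matrix[OF weighted_matrices_op[OF assms]] by simp
  ultimately show "weighted_norm W (adj_matrix A) = weighted_norm W A" using *[OF assms] by simp
qed

lemma weighted_columns:
  assumes "A \<in> weighted_matrices X W" "l \<in> X"
  shows "(\<lambda>k. norm (A k l)) summable_on X" "(\<Sum>\<^sub>\<infinity>k\<in>X. norm (A k l)) \<le> K * weighted_norm W A"
  using weighted_rows[OF adj_matrix_weighted(1)[OF assms(1)] assms(2)]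
    op_matricesD(1)[OF weighted_matrices_op[OF assms(1)]] adj_matrix_weighted(2)[OF assms(1)]
  by (simp_all add: adj_matrix_def norm_adj_op)

text \<open>The second factor only has a bounded column. In \<open>derivation_inverse\<close> it is
  the derivative of the inverse, whose decay is what has to be shown.\<close>

lemma matrix_mult_abs_summable:
  assumes "A \<in> weighted_matrices X W" "k \<in> X" "\<And>n. n \<in> X \<Longrightarrow> norm (B n l) \<le> c"
  shows "(\<lambda>n. norm (A k n o\<^sub>L B n l)) summable_on X"
proof (rule Infinite_Sum.abs_summable_on_comparison_test'[OF summable_on_cmult_left[OF weighted_rows(1)[OF assms(1,2)]]])
  show "norm (A k n o\<^sub>L B n l) \<le> norm (A k n) * c" if "n \<in> X" for n
    using norm_blinfun_compose[of "A k n" "B n l"] mult_left_mono[OF assms(3)[OF that], of "norm (A k n)"]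
    by simp
qed

lemma matrix_mult_summable:
  assumes "A \<in> weighted_matrices X W" "B \<in> weighted_matrices X W"
  shows "(\<lambda>n. A k n o\<^sub>L B n l) summable_on X"
proof (cases "k \<in> X")
  case True
  then show ?thesis
    by (intro abs_summable_summable[OF matrix_mult_abs_summable[where c="weighted_norm W B"]] assms
        norm_entry_le(2))
next
  case False
  then show ?thesis using op_matricesD(2)[OF weighted_matrices_op[OF assms(1)]] by simp
qed

lemma matrix_mult_weighted:
  assumes "A \<in> weighted_matrices X W" "B \<in> weighted_matrices X W"
  shows "matrix_mult X A B \<in> weighted_matrices X W"
    and "weighted_norm W (matrix_mult X A B) \<le> K * weighted_norm W A * weighted_norm W B"
proof -
  let ?a = "weighted_norm W A" and ?b = "weighted_norm W B"
  have le: "norm (matrix_mult X A B k l) * W k l \<le> K * ?a * ?b" if kl: "k \<in> X" "l \<in> X" for k l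
  proof -
    have abs: "(\<lambda>n. norm (A k n o\<^sub>L B n l)) summable_on X"
      by (rule matrix_mult_abs_summable[where c="weighted_norm W B"]) (use assms kl norm_entry_le(2) in blast)+
    have "norm (matrix_mult X A B k l) \<le> (\<Sum>\<^sub>\<infinity>n\<in>X. norm (A k n o\<^sub>L B n l))"
      unfolding matrix_mult_def by (rule norm_infsum_bound[OF abs])
    also have "\<dots> \<le> K * ?a * ?b / W k l"
    proof (rule infsum_le_finite_sums[OF abs])
      fix F assume F: "finite F" "F \<subseteq> X"
      \<comment> \<open>The summand is arranged so that the factor depending on n is the one in
        \<open>sum_convolution_W_le\<close>; the rest is the desired bound without K.\<close>
      have "(\<Sum>n\<in>F. norm (A k n o\<^sub>L B n l)) \<le> (\<Sum>n\<in>F. W k l / (W k n * W n l) * (?a * ?b / W k l))"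
      proof (rule sum_mono)
        fix n
        have "norm (A k n o\<^sub>L B n l) \<le> norm (A k n) * norm (B n l)"
          by (rule norm_blinfun_compose)
        also have "\<dots> \<le> (?a / W k n) * (?b / W n l)"
          by (intro mult_mono norm_entry_le assms norm_ge_zero divide_nonneg_pos weighted_norm_nonneg W_pos)
        also have "\<dots> = W k l / (W k n * W n l) * (?a * ?b / W k l)"
          using W_pos[of k l] by (simp add: field_simps)
        finally show "norm (A k n o\<^sub>L B n l) \<le> \<dots>" .
      qed
      also have "\<dots> = (\<Sum>n\<in>F. W k l / (W k n * W n l)) * (?a * ?b / W k l)"
        by (rule sum_distrib_right[symmetric])
      also have "\<dots> \<le> K * (?a * ?b / W k l)"
        by (intro mult_right_mono sum_convolution_W_le kl F divide_nonneg_pos mult_nonneg_nonneg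
            weighted_norm_nonneg assms W_pos)
      finally show "(\<Sum>n\<in>F. norm (A k n o\<^sub>L B n l)) \<le> K * ?a * ?b / W k l" by simp
    qed
    finally show ?thesis by (simp add: pos_le_divide_eq W_pos)
  qed
  note op = matrix_mult_in_op_matrices[OF assms[THEN weighted_matrices_op]]
  show "matrix_mult X A B \<in> weighted_matrices X W"
    by (rule weighted_matricesI(1)[OF op le])
  show "weighted_norm W (matrix_mult X A B) \<le> K * ?a * ?b"
    by (intro weighted_matricesI(2)[OF op le] mult_nonneg_nonneg weighted_norm_nonneg assms
        less_imp_le[OF K_pos])
qed

text \<open>The rows of A and B are absolutely summable, uniformly for B, so a third factor with
  bounded entries still gives an absolutely convergent double series. This generality is what the
  Leibniz argument uses.\<close>

lemma matrix_mult_assoc_bounded: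
  assumes A: "A \<in> weighted_matrices X W" and B: "B \<in> weighted_matrices X W"
    and C: "\<And>n l. norm (C n l) \<le> c"
  shows "matrix_mult X (matrix_mult X A B) C = matrix_mult X A (matrix_mult X B C)"
proof (intro ext)
  fix k l
  show "matrix_mult X (matrix_mult X A B) C k l = matrix_mult X A (matrix_mult X B C) k l"
  proof (cases "k \<in> X")
    case False
    then show ?thesis
      using op_matricesD(2)[OF weighted_matrices_op[OF A]] by (simp add: matrix_mult_def)
  next
    case k: True
    define g where "g n m = A k n o\<^sub>L (B n m o\<^sub>L C m l)" for n m
    have c0: "0 \<le> c" using C[of k l] norm_ge_zero order_trans by blast
    have "(\<lambda>(n, m). norm (g n m)) summable_on X \<times> X"
    proof (rule abs_summable_on_double)
      show "(\<lambda>m. norm (B n m) * c) summable_on X" if "n \<in> X" for n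
        by (rule summable_on_cmult_left[OF weighted_rows(1)[OF B that]])
      show "(\<Sum>\<^sub>\<infinity>m\<in>X. norm (B n m) * c) \<le> K * weighted_norm W B * c" if "n \<in> X" for n
        using weighted_rows[OF B that] c0
        by (subst infsum_cmult_left) (auto intro!: mult_right_mono)
      show "norm (g n m) \<le> norm (A k n) * (norm (B n m) * c)" for n m
        unfolding g_def
        by (intro order_trans[OF norm_blinfun_compose] mult_left_mono mult_mono C) auto
    qed (auto intro: weighted_rows A k)
    note swap = abs_summable_on_double_sums(2)[OF this]
    have "matrix_mult X (matrix_mult X A B) C k l = (\<Sum>\<^sub>\<infinity>m\<in>X. \<Sum>\<^sub>\<infinity>n\<in>X. g n m)"
      unfolding matrix_mult_def
    proof (rule infsum_cong)
      fix m
      have "((\<lambda>n. (A k n o\<^sub>L B n m) o\<^sub>L C m l) has_sum (\<Sum>\<^sub>\<infinity>n\<in>X. A k n o\<^sub>L B n m) o\<^sub>L C m l) X"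
        by (rule has_sum_bounded_linear[OF bounded_bilinear.bounded_linear_left[OF bounded_bilinear_blinfun_compose]
              has_sum_infsum[OF matrix_mult_summable[OF A B]]])
      then show "(\<Sum>\<^sub>\<infinity>n\<in>X. A k n o\<^sub>L B n m) o\<^sub>L C m l = (\<Sum>\<^sub>\<infinity>n\<in>X. g n m)"
        by (simp add: infsumI g_def blinfun_compose_assoc)
    qed
    also have "\<dots> = (\<Sum>\<^sub>\<infinity>n\<in>X. \<Sum>\<^sub>\<infinity>m\<in>X. g n m)" by (rule swap[symmetric])
    also have "\<dots> = matrix_mult X A (matrix_mult X B C) k l"
      unfolding matrix_mult_def
    proof (rule infsum_cong)
      fix n assume n: "n \<in> X"
      have "(\<lambda>m. B n m o\<^sub>L C m l) summable_on X"
        by (rule abs_summable_summable[OF matrix_mult_abs_summable[where c=c, OF B n]]) (rule C)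
      from has_sum_bounded_linear[OF bounded_bilinear.bounded_linear_right[OF bounded_bilinear_blinfun_compose]
          has_sum_infsum[OF this], of "A k n"]
      show "(\<Sum>\<^sub>\<infinity>m\<in>X. g n m) = A k n o\<^sub>L (\<Sum>\<^sub>\<infinity>m\<in>X. B n m o\<^sub>L C m l)"
        by (simp add: infsumI g_def)
    qed
    finally show ?thesis .
  qed
qed

lemma one_matrix_weighted: "(one_matrix X :: ('i, 'h::complex_hilbert) op_matrix) \<in> weighted_matrices X W"
  by (rule weighted_matricesI(1)[OF one_matrix_in_op_matrices, where C=1])
    (auto simp: one_matrix_def W_refl norm_blinfun_id_le)

lemma weighted_norm_triangle:
  assumes "A \<in> weighted_matrices X W" "B \<in> weighted_matrices X W"
  shows "(\<lambda>k l. A k l + B k l) \<in> weighted_matrices X W"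
    and "weighted_norm W (\<lambda>k l. A k l + B k l) \<le> weighted_norm W A + weighted_norm W B"
proof -
  have op: "(\<lambda>k l. A k l + B k l) \<in> op_matrices X"
    using assms by (auto simp: weighted_matrices_def op_matrices_def clinear_op_add)
  have le: "norm (A k l + B k l) * W k l \<le> weighted_norm W A + weighted_norm W B" for k l
  proof -
    have "norm (A k l + B k l) * W k l \<le> (norm (A k l) + norm (B k l)) * W k l"
      by (intro mult_right_mono norm_triangle_ineq less_imp_le W_pos)
    then show ?thesis
      using weighted_entry_le[OF assms(1), of k l] weighted_entry_le[OF assms(2), of k l]
      by (simp add: distrib_right)
  qed
  show "(\<lambda>k l. A k l + B k l) \<in> weighted_matrices X W"
    by (rule weighted_matricesI(1)[OF op le])
  show "weighted_norm W (\<lambda>k l. A k l + B k l) \<le> weighted_norm W A + weighted_norm W B"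
    by (intro weighted_matricesI(2)[OF op le] add_nonneg_nonneg weighted_norm_nonneg assms)
qed

lemma scale_matrix_weighted:
  assumes "A \<in> weighted_matrices X W"
  shows "scale_matrix c A \<in> weighted_matrices X W"
    and "weighted_norm W (scale_matrix c A) = cmod c * weighted_norm W A"
proof -
  have *: "scale_matrix c A \<in> weighted_matrices X W
      \<and> weighted_norm W (scale_matrix c A) \<le> cmod c * weighted_norm W A"
    if A: "A \<in> weighted_matrices X W" for c and A :: "('i, 'b::complex_hilbert) op_matrix"
  proof -
    have le: "norm (scale_matrix c A k l) * W k l \<le> cmod c * weighted_norm W A" for k l
      using mult_left_mono[OF weighted_entry_le[OF A, of k l], of "cmod c"]
      by (simp add: scale_matrix_def norm_scale_op mult.assoc)
    show ?thesis
      by (intro conjI weighted_matricesI[OF scale_matrix_in_op_matrices[OF weighted_matrices_op[OF A]] le]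
          mult_nonneg_nonneg weighted_norm_nonneg A norm_ge_zero)
  qed
  show 1: "scale_matrix c A \<in> weighted_matrices X W" using *[OF assms] by simp
  have "cmod c * weighted_norm W A \<le> weighted_norm W (scale_matrix c A)"
  proof (cases "c = 0")
    case False
    have "scale_matrix (inverse c) (scale_matrix c A) = A"
      using False by (auto simp: scale_matrix_def fun_eq_iff scaleC_scaleC intro!: blinfun_eqI)
    then have "weighted_norm W A \<le> cmod (inverse c) * weighted_norm W (scale_matrix c A)"
      using *[OF 1, of "inverse c"] by simp
    then show ?thesis using False by (simp add: norm_inverse norm_divide field_simps)
  qed (use weighted_norm_nonneg[OF 1] in simp)
  then show "weighted_norm W (scale_matrix c A) = cmod c * weighted_norm W A"
    using *[OF assms, of c] by simp
qed

lemma weighted_norm_eq_0: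
  assumes "A \<in> weighted_matrices X W"
  shows "weighted_norm W A = 0 \<longleftrightarrow> A = (\<lambda>k l. 0)"
proof
  assume "weighted_norm W A = 0"
  then show "A = (\<lambda>k l. 0)"
    using norm_entry_le(2)[OF assms] by (auto simp: fun_eq_iff)
qed (simp add: weighted_norm_def case_prod_unfold)

lemma weighted_diff:
  assumes "A \<in> weighted_matrices X W" "B \<in> weighted_matrices X W"
  shows "(\<lambda>k l. A k l - B k l) \<in> weighted_matrices X W"
proof -
  have "(\<lambda>k l. A k l - B k l) = (\<lambda>k l. A k l + scale_matrix (-1) B k l)"
    by (auto simp: fun_eq_iff scale_matrix_def blinfun.bilinear_simps scaleC_minus_left intro!: blinfun_eqI)
  then show ?thesis
    using weighted_norm_triangle(1)[OF assms(1) scale_matrix_weighted(1)[OF assms(2), of "-1"]] by simp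
qed

text \<open>As W \<ge> 1, a Cauchy sequence converges entrywise. The Cauchy estimate for fixed n is
  closed under the entrywise limit in m, which gives convergence in the weighted norm.\<close>

lemma weighted_complete:
  assumes u: "\<And>n::nat. u n \<in> weighted_matrices X W"
    and Cauchy: "\<And>e. e > 0 \<Longrightarrow> \<exists>N. \<forall>m\<ge>N. \<forall>n\<ge>N. weighted_norm W (\<lambda>k l. u m k l - u n k l) < e"
  shows "\<exists>A \<in> (weighted_matrices X W :: ('i, 'h::complex_hilbert) op_matrix set).
    (\<lambda>n. weighted_norm W (\<lambda>k l. u n k l - A k l)) \<longlonglongrightarrow> 0"
proof -
  have "Cauchy (\<lambda>n. u n k l)" for k l
  proof (rule CauchyI)
    fix e :: real assume "0 < e"
    from Cauchy[OF this] obtain N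
      where N: "\<And>m n. m \<ge> N \<Longrightarrow> n \<ge> N \<Longrightarrow> weighted_norm W (\<lambda>k l. u m k l - u n k l) < e" by blast
    show "\<exists>M. \<forall>m\<ge>M. \<forall>n\<ge>M. norm (u m k l - u n k l) < e"
    proof (intro exI allI impI)
      fix m n assume "N \<le> m" "N \<le> n"
      from le_less_trans[OF norm_entry_le(2)[OF weighted_diff[OF u u]] N[OF this]]
      show "norm (u m k l - u n k l) < e" .
    qed
  qed
  then have "\<exists>L. (\<lambda>n. u n k l) \<longlonglongrightarrow> L" for k l
    by (simp add: Cauchy_convergent_iff convergent_def)
  then obtain A where A: "\<And>k l. (\<lambda>n. u n k l) \<longlonglongrightarrow> A k l" by metis
  have op: "A \<in> op_matrices X"
    unfolding op_matrices_def
  proof (intro CollectI conjI allI impI)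
    show "clinear_op (A k l)" for k l
      by (rule clinear_op_limit[OF A op_matricesD(1)[OF weighted_matrices_op[OF u]]])
    fix k l assume "k \<notin> X \<or> l \<notin> X"
    then have "u n k l = 0" for n
      using op_matricesD(2,3)[OF weighted_matrices_op[OF u]] by blast
    then show "A k l = 0" using A[of k l] by (simp add: LIMSEQ_const_iff)
  qed
  have tail: "norm (u n k l - A k l) * W k l \<le> e"
    if N: "\<And>m n. m \<ge> N \<Longrightarrow> n \<ge> N \<Longrightarrow> weighted_norm W (\<lambda>k l. u m k l - u n k l) < e"
      and n: "n \<ge> N" for n N e k l
  proof (rule tendsto_upperbound[where F=sequentially])
    show "(\<lambda>m. norm (u n k l - u m k l) * W k l) \<longlonglongrightarrow> norm (u n k l - A k l) * W k l"
      by (intro tendsto_intros A)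
    show "\<forall>\<^sub>F m in sequentially. norm (u n k l - u m k l) * W k l \<le> e"
    proof (rule eventually_sequentiallyI)
      fix m assume "N \<le> m"
      from le_less_trans[OF weighted_entry_le[OF weighted_diff[OF u u]] N[OF n this], of k l]
      show "norm (u n k l - u m k l) * W k l \<le> e" by simp
    qed
  qed simp
  have op': "(\<lambda>k l. u n k l - A k l) \<in> op_matrices X" for n
    using op op_matricesD[OF weighted_matrices_op[OF u]]
    by (auto simp: op_matrices_def intro!: clinear_op_diff)
  \<comment> \<open>Tolerance 1 already puts \<open>u N - A\<close> into the class, hence also A, as
    the difference of \<open>u N\<close> and it.\<close>
  obtain N where N: "\<And>m n. m \<ge> N \<Longrightarrow> n \<ge> N \<Longrightarrow> weighted_norm W (\<lambda>k l. u m k l - u n k l) < 1"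
    using Cauchy[of 1] by auto
  have "(\<lambda>k l. u N k l - A k l) \<in> weighted_matrices X W"
    by (rule weighted_matricesI(1)[OF op' tail[OF N]]) auto
  from weighted_diff[OF u[of N] this] have AJ: "A \<in> weighted_matrices X W" by simp
  have "(\<lambda>n. weighted_norm W (\<lambda>k l. u n k l - A k l)) \<longlonglongrightarrow> 0"
  proof (rule LIMSEQ_I)
    fix e :: real assume e: "0 < e"
    then obtain N where N: "\<And>m n. m \<ge> N \<Longrightarrow> n \<ge> N \<Longrightarrow> weighted_norm W (\<lambda>k l. u m k l - u n k l) < e / 2"
      using Cauchy[of "e / 2"] by auto
    show "\<exists>N. \<forall>n\<ge>N. norm (weighted_norm W (\<lambda>k l. u n k l - A k l) - 0) < e"
    proof (intro exI allI impI)
      fix n assume n: "N \<le> n"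
      have "weighted_norm W (\<lambda>k l. u n k l - A k l) \<le> e / 2"
        by (rule weighted_matricesI(2)[OF op' tail[OF N n]]) (use e in auto)
      moreover have "0 \<le> weighted_norm W (\<lambda>k l. u n k l - A k l)"
        by (intro weighted_norm_nonneg weighted_diff u AJ)
      ultimately show "norm (weighted_norm W (\<lambda>k l. u n k l - A k l) - 0) < e" using e by simp
    qed
  qed
  with AJ show ?thesis by blast
qed

end

section \<open>Weighted matrices form a Banach *-algebra\<close>

lemma cring_complex_scalars: "cring complex_scalars"
  by (unfold_locales)
    (auto simp: complex_scalars_def algebra_simps Units_def intro: exI[of _ "- _"] add.right_inverse)

context decay_weight
begin

text \<open>The factor K absorbs the constant of \<open>matrix_mult_weighted\<close>. The price is
  that the identity need not have norm 1.\<close>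

abbreviation weighted_algebra :: "('i, 'h::complex_hilbert) op_matrix star_algebra" where
  "weighted_algebra \<equiv> matrix_algebra X (weighted_matrices X W) (\<lambda>A. K * weighted_norm W A)"

lemma weighted_algebra_simps:
  "carrier weighted_algebra = weighted_matrices X W"
  "A \<otimes>\<^bsub>weighted_algebra\<^esub> B = matrix_mult X A B"
  "\<one>\<^bsub>weighted_algebra\<^esub> = one_matrix X"
  "\<zero>\<^bsub>weighted_algebra\<^esub> = (\<lambda>k l. 0)"
  "A \<oplus>\<^bsub>weighted_algebra\<^esub> B = (\<lambda>k l. A k l + B k l)"
  "c \<odot>\<^bsub>weighted_algebra\<^esub> A = scale_matrix c A"
  "star weighted_algebra A = adj_matrix A"
  "nrm weighted_algebra A = K * weighted_norm W A"
  by (simp_all add: matrix_algebra_def one_matrix_def scale_matrix_def adj_matrix_def)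

lemma zero_weighted: "(\<lambda>k l. 0) \<in> weighted_matrices X W"
  by (auto simp: weighted_matrices_def op_matrices_def)

lemma matrix_mult_assoc:
  assumes "A \<in> weighted_matrices X W" "B \<in> weighted_matrices X W" "C \<in> weighted_matrices X W"
  shows "matrix_mult X (matrix_mult X A B) C = matrix_mult X A (matrix_mult X B C)"
  by (rule matrix_mult_assoc_bounded[OF assms(1,2) norm_entry_le(2)[OF assms(3)]])

lemma one_matrix_mult:
  assumes "A \<in> op_matrices X"
  shows "matrix_mult X (one_matrix X) A = A" "matrix_mult X A (one_matrix X) = A"
proof -
  have "matrix_mult X (one_matrix X) A k l = A k l" for k l
  proof (cases "k \<in> X")
    case True
    have "matrix_mult X (one_matrix X) A k l = (\<Sum>\<^sub>\<infinity>n\<in>{k}. one_matrix X k n o\<^sub>L A n l)"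
      unfolding matrix_mult_def
      by (rule infsum_cong_neutral) (use True in \<open>auto simp: one_matrix_def blinfun.zero_left\<close>)
    then show ?thesis using True by (auto simp: one_matrix_def intro!: blinfun_eqI)
  qed (use op_matricesD(2)[OF assms] in \<open>simp add: matrix_mult_def one_matrix_def\<close>)
  then show "matrix_mult X (one_matrix X) A = A" by blast
  have "matrix_mult X A (one_matrix X) k l = A k l" for k l
  proof (cases "l \<in> X")
    case True
    have "matrix_mult X A (one_matrix X) k l = (\<Sum>\<^sub>\<infinity>n\<in>{l}. A k n o\<^sub>L one_matrix X n l)"
      unfolding matrix_mult_def
      by (rule infsum_cong_neutral) (use True in \<open>auto simp: one_matrix_def\<close>)
    then show ?thesis using True by (auto simp: one_matrix_def intro!: blinfun_eqI)
  next
    case False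
    have "matrix_mult X A (one_matrix X) k l = (\<Sum>\<^sub>\<infinity>n\<in>X. 0)"
      unfolding matrix_mult_def
      by (rule infsum_cong) (use False in \<open>auto simp: one_matrix_def\<close>)
    with False show ?thesis using op_matricesD(3)[OF assms] by simp
  qed
  then show "matrix_mult X A (one_matrix X) = A" by blast
qed

lemma matrix_mult_distrib:
  assumes "A \<in> weighted_matrices X W" "B \<in> weighted_matrices X W" "C \<in> weighted_matrices X W"
  shows "matrix_mult X (\<lambda>k l. A k l + B k l) C = (\<lambda>k l. matrix_mult X A C k l + matrix_mult X B C k l)"
    and "matrix_mult X C (\<lambda>k l. A k l + B k l) = (\<lambda>k l. matrix_mult X C A k l + matrix_mult X C B k l)"
  unfolding matrix_mult_def
  by (auto simp: fun_eq_iff bounded_bilinear.add_left[OF bounded_bilinear_blinfun_compose]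
      bounded_bilinear.add_right[OF bounded_bilinear_blinfun_compose]
      infsum_add matrix_mult_summable assms)

lemma matrix_mult_scale:
  assumes A: "A \<in> weighted_matrices X W" and B: "B \<in> weighted_matrices X W"
  shows "matrix_mult X (scale_matrix c A) B = scale_matrix c (matrix_mult X A B)"
    and "matrix_mult X A (scale_matrix c B) = scale_matrix c (matrix_mult X A B)"
proof -
  have *: "(\<Sum>\<^sub>\<infinity>n\<in>X. scale_op c (A k n o\<^sub>L B n l)) = scale_op c (\<Sum>\<^sub>\<infinity>n\<in>X. A k n o\<^sub>L B n l)" for k l
    by (intro infsumI has_sum_bounded_linear[OF bounded_linear_scale_op] has_sum_infsum
        matrix_mult_summable assms)
  have "scale_op c S o\<^sub>L T = scale_op c (S o\<^sub>L T)" for S T :: "'a \<Rightarrow>\<^sub>L 'a"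
    by (rule blinfun_eqI) simp
  then show "matrix_mult X (scale_matrix c A) B = scale_matrix c (matrix_mult X A B)"
    by (simp add: matrix_mult_def scale_matrix_def fun_eq_iff *)
  have "A k n o\<^sub>L scale_op c T = scale_op c (A k n o\<^sub>L T)" for k n T
    using op_matricesD(1)[OF weighted_matrices_op[OF A]]
    by (intro blinfun_eqI) (simp add: clinear_op_def)
  then show "matrix_mult X A (scale_matrix c B) = scale_matrix c (matrix_mult X A B)"
    by (simp add: matrix_mult_def scale_matrix_def fun_eq_iff *)
qed

lemma adj_matrix_mult:
  assumes "A \<in> weighted_matrices X W" "B \<in> weighted_matrices X W"
  shows "adj_matrix (matrix_mult X A B) = matrix_mult X (adj_matrix B) (adj_matrix A)"
proof (intro ext)
  fix k l
  have cl: "clinear_op (A k l)" "clinear_op (B k l)" for k l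
    using assms[THEN weighted_matrices_op] by (simp_all add: op_matricesD(1))
  have *: "adj_op (A l n o\<^sub>L B n k) = adj_matrix B k n o\<^sub>L adj_matrix A n l" for n
    by (simp add: adj_op_compose cl adj_matrix_def)
  have "adj_matrix (matrix_mult X A B) k l = (\<Sum>\<^sub>\<infinity>n\<in>X. adj_op (A l n o\<^sub>L B n k))"
    unfolding matrix_mult_def adj_matrix_def
  proof (rule adj_op_infsum)
    show "(\<lambda>n. adj_op (A l n o\<^sub>L B n k)) summable_on X"
      unfolding * by (rule matrix_mult_summable[OF assms(2,1)[THEN adj_matrix_weighted(1)]])
  qed (simp_all add: cl clinear_op_compose matrix_mult_summable assms)
  then show "adj_matrix (matrix_mult X A B) k l = matrix_mult X (adj_matrix B) (adj_matrix A) k l"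
    by (simp add: * matrix_mult_def)
qed

lemma minus_weighted:
  assumes "A \<in> weighted_matrices X W"
  shows "(\<lambda>k l. - A k l) \<in> weighted_matrices X W"
  using weighted_diff[OF zero_weighted assms] by simp

lemma abelian_group_weighted_algebra: "abelian_group weighted_algebra"
  by (rule abelian_groupI)
    (auto simp: weighted_algebra_simps weighted_norm_triangle zero_weighted algebra_simps
      intro!: bexI[OF _ minus_weighted])

lemma ring_weighted_algebra: "ring weighted_algebra"
  by (intro ringI abelian_group_weighted_algebra monoidI)
    (simp_all add: weighted_algebra_simps matrix_mult_weighted one_matrix_weighted matrix_mult_assoc
      one_matrix_mult weighted_matrices_op matrix_mult_distrib)

lemma weighted_algebra_minus:
  assumes "A \<in> weighted_matrices X W" "B \<in> weighted_matrices X W"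
  shows "A \<ominus>\<^bsub>weighted_algebra\<^esub> B = (\<lambda>k l. A k l - B k l)"
proof -
  interpret ring weighted_algebra by (rule ring_weighted_algebra)
  have "\<ominus>\<^bsub>weighted_algebra\<^esub> B = (\<lambda>k l. - B k l)"
    by (rule minus_equality) (simp_all add: weighted_algebra_simps assms minus_weighted)
  then show ?thesis by (simp add: a_minus_def weighted_algebra_simps)
qed

theorem banach_star_algebra_weighted_algebra: "banach_star_algebra weighted_algebra"
proof -
  have mod: "Module.module complex_scalars weighted_algebra"
    by (intro moduleI cring_complex_scalars abelian_group_weighted_algebra)
      (auto simp: weighted_algebra_simps scale_matrix_weighted fun_eq_iff complex_scalars_def
        scale_matrix_def blinfun.bilinear_simps scaleC_add_left scaleC_add_right scaleC_scaleC
        intro!: blinfun_eqI scale_matrix_weighted(1)[unfolded scale_matrix_def])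
  show ?thesis
  proof (intro banach_star_algebra.intro mod ring_weighted_algebra banach_star_algebra_axioms.intro,
      unfold weighted_algebra_simps)
    fix A B :: "('i, 'h::complex_hilbert) op_matrix" and c
    assume A: "A \<in> weighted_matrices X W"
    have cl: "clinear_op (A k l)" for k l
      by (rule op_matricesD(1)[OF weighted_matrices_op[OF A]])
    show "0 \<le> K * weighted_norm W A" using K_pos weighted_norm_nonneg[OF A] by simp
    show "K * weighted_norm W A = 0 \<longleftrightarrow> A = (\<lambda>k l. 0)"
      using K_pos weighted_norm_eq_0[OF A] by simp
    show "K * weighted_norm W (scale_matrix c A) = cmod c * (K * weighted_norm W A)"
      by (simp add: scale_matrix_weighted A)
    show "adj_matrix A \<in> weighted_matrices X W" "adj_matrix (adj_matrix A) = A"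
      "K * weighted_norm W (adj_matrix A) = K * weighted_norm W A"
      by (simp_all add: adj_matrix_weighted adj_matrix_adj_matrix[OF weighted_matrices_op] A)
    show "adj_matrix (scale_matrix c A) = scale_matrix (cnj c) (adj_matrix A)"
      by (simp add: adj_matrix_def scale_matrix_def adj_op_scale_op cl)
    assume B: "B \<in> weighted_matrices X W"
    have cl': "clinear_op (B k l)" for k l
      by (rule op_matricesD(1)[OF weighted_matrices_op[OF B]])
    show "matrix_mult X (scale_matrix c A) B = scale_matrix c (matrix_mult X A B)"
      "matrix_mult X A (scale_matrix c B) = scale_matrix c (matrix_mult X A B)"
      by (rule matrix_mult_scale A B)+
    show "K * weighted_norm W (\<lambda>k l. A k l + B k l) \<le> K * weighted_norm W A + K * weighted_norm W B"
      using mult_left_mono[OF weighted_norm_triangle(2)[OF A B], of K] K_pos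
      by (simp add: distrib_left)
    show "K * weighted_norm W (matrix_mult X A B) \<le> K * weighted_norm W A * (K * weighted_norm W B)"
      using mult_left_mono[OF matrix_mult_weighted(2)[OF A B], of K] K_pos
      by (simp add: mult_ac)
    show "adj_matrix (\<lambda>k l. A k l + B k l) = (\<lambda>k l. adj_matrix A k l + adj_matrix B k l)"
      by (simp add: adj_matrix_def adj_op_add cl cl')
    show "adj_matrix (matrix_mult X A B) = matrix_mult X (adj_matrix B) (adj_matrix A)"
      by (rule adj_matrix_mult[OF A B])
  next
    fix u :: "nat \<Rightarrow> ('i, 'h::complex_hilbert) op_matrix"
    assume u: "\<And>n. u n \<in> weighted_matrices X W"
      and C: "\<And>e. e > 0 \<Longrightarrow> \<exists>N. \<forall>m\<ge>N. \<forall>n\<ge>N. K * weighted_norm W (u m \<ominus>\<^bsub>weighted_algebra\<^esub> u n) < e"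
    have "\<exists>N. \<forall>m\<ge>N. \<forall>n\<ge>N. weighted_norm W (\<lambda>k l. u m k l - u n k l) < e" if "0 < e" for e
      using C[of "K * e"] that K_pos by (simp add: weighted_algebra_minus u)
    from weighted_complete[OF u this]
    obtain A where A: "A \<in> weighted_matrices X W"
      "(\<lambda>n. weighted_norm W (\<lambda>k l. u n k l - A k l)) \<longlonglongrightarrow> 0" by blast
    then show "\<exists>A\<in>weighted_matrices X W.
        (\<lambda>n. K * weighted_norm W (u n \<ominus>\<^bsub>weighted_algebra\<^esub> A)) \<longlonglongrightarrow> 0"
      by (intro bexI[of _ A]) (simp_all add: weighted_algebra_minus u tendsto_mult_right_zero)
  qed
qed

lemma solid_weighted_algebra: "solid X weighted_algebra"
  unfolding solid_def weighted_algebra_simps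
proof (intro ballI impI)
  fix A B :: "('i, 'h::complex_hilbert) op_matrix"
  assume A: "A \<in> weighted_matrices X W" and B: "B \<in> op_matrices X"
    and le: "\<forall>k\<in>X. \<forall>l\<in>X. norm (B k l) \<le> norm (A k l)"
  have "norm (B k l) * W k l \<le> weighted_norm W A" if "k \<in> X" "l \<in> X" for k l
  proof -
    have "norm (B k l) * W k l \<le> norm (A k l) * W k l"
      using le that W_pos[of k l] by (intro mult_right_mono) auto
    then show ?thesis using weighted_entry_le[OF A, of k l] by (rule order_trans)
  qed
  from weighted_matricesI[OF B this] show "B \<in> weighted_matrices X W \<and>
      K * weighted_norm W B \<le> K * weighted_norm W A"
    using weighted_norm_nonneg[OF A] K_pos by simp
qed

end

section \<open>Neumann series\<close>

context ring
begin

lemma add_cancel_middle: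
  assumes "a \<in> carrier R" "b \<in> carrier R"
  shows "a \<oplus> (b \<oplus> \<ominus> a) = b" "c \<in> carrier R \<Longrightarrow> a \<oplus> (b \<oplus> (\<ominus> a \<oplus> c)) = b \<oplus> c"
  using assms a_comm[of a b] by (simp_all add: r_neg r_neg2 a_assoc a_lcomm[of a b])

lemma one_add_minus_one_add:
  "\<lbrakk>a \<in> carrier R; b \<in> carrier R\<rbrakk> \<Longrightarrow> (\<one> \<oplus> a) \<ominus> (\<one> \<oplus> b) = a \<ominus> b"
  by (simp add: minus_eq minus_add a_ac add_cancel_middle)

lemma minus_telescope:
  "\<lbrakk>x \<in> carrier R; z \<in> carrier R; u \<in> carrier R\<rbrakk> \<Longrightarrow> x \<ominus> z = \<ominus> (u \<ominus> x) \<oplus> (u \<ominus> z)"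
  by (simp add: minus_eq minus_add minus_minus a_ac r_neg1 r_neg2)

lemma eq_if_minus_eq_zero:
  assumes "a \<in> carrier R" "b \<in> carrier R" "a \<ominus> b = \<zero>"
  shows "a = b"
proof -
  have "a = (a \<ominus> b) \<oplus> b" using assms(1,2) by (simp add: minus_eq a_assoc l_neg)
  then show ?thesis using assms by simp
qed

lemma add_minus_cancel: "\<lbrakk>a \<in> carrier R; b \<in> carrier R\<rbrakk> \<Longrightarrow> (b \<oplus> a) \<ominus> a = b"
  by (simp add: minus_eq a_assoc r_neg)

lemma minus_swap: "\<lbrakk>a \<in> carrier R; b \<in> carrier R\<rbrakk> \<Longrightarrow> b \<ominus> a = \<ominus> (a \<ominus> b)"
  by (simp add: minus_eq minus_add a_ac)

lemma one_minus_square: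
  assumes "y \<in> carrier R"
  shows "\<one> \<ominus> y \<otimes> y = (\<one> \<ominus> y) \<otimes> (\<one> \<oplus> y)" "\<one> \<ominus> y \<otimes> y = (\<one> \<oplus> y) \<otimes> (\<one> \<ominus> y)"
proof -
  show "\<one> \<ominus> y \<otimes> y = (\<one> \<ominus> y) \<otimes> (\<one> \<oplus> y)"
    using assms by (simp add: minus_eq l_distr r_distr l_minus r_minus a_ac add_cancel_middle)
  show "\<one> \<ominus> y \<otimes> y = (\<one> \<oplus> y) \<otimes> (\<one> \<ominus> y)"
    using assms by (simp add: minus_eq l_distr r_distr l_minus r_minus minus_add a_ac add_cancel_middle)
qed

end

context banach_star_algebra
begin

text \<open>The partial sums of the Neumann series are the iterates of x -> 1 + y x from 0. A right
  inverse is the fixed point of this contraction, a left inverse that of x -> 1 + x y, and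
  associativity identifies them. Both fixed points come from one statement about an abstract
  additive contraction \<open>f\<close>.\<close>

lemma one_minus_Units_if_nrm_less_1:
  assumes y: "y \<in> carrier A" and less: "nrm A y < 1"
  shows "\<one> \<ominus> y \<in> Units A"
proof -
  define q where "q = nrm A y"
  have q: "0 \<le> q" "q < 1" using less nrm_nonneg[OF y] by (auto simp: q_def)
  have minus_closed: "a \<ominus> b \<in> carrier A" if "a \<in> carrier A" "b \<in> carrier A" for a b
    using that by (rule M.minus_closed)
  \<comment> \<open>The norm axioms speak of scalar multiples, so the additive inverse is first
    identified with (-1) a: the sum of (-1) a and a is (-1 + 1) a, which has norm 0.\<close>
  have nrm_uminus: "nrm A (\<ominus> a) = nrm A a" if "a \<in> carrier A" for a
  proof -
    have "(-1) \<odot> a \<oplus> a = (-1) \<odot> a \<oplus> 1 \<odot> a"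
      using smult_one[OF that] by (simp add: complex_scalars_def)
    also have "\<dots> = (-1 + 1) \<odot> a"
      using smult_l_distr[of "-1" 1 a] that by (simp add: complex_scalars_def)
    also have "nrm A \<dots> = 0" using nrm_smult[OF that, of 0] by simp
    finally have "(-1) \<odot> a \<oplus> a = \<zero>"
      using that smult_closed[of "-1" a] by (subst (asm) nrm_eq_zero) (auto simp: complex_scalars_def)
    then have "\<ominus> a = (-1) \<odot> a"
      using that smult_closed[of "-1" a] by (intro minus_equality) (auto simp: complex_scalars_def)
    then show ?thesis using nrm_smult[OF that, of "-1"] by simp
  qed
  have fixed_point: "\<exists>x\<in>carrier A. x = \<one> \<oplus> f x"
    if f: "\<And>x. x \<in> carrier A \<Longrightarrow> f x \<in> carrier A"
      "\<And>x x'. x \<in> carrier A \<Longrightarrow> x' \<in> carrier A \<Longrightarrow> f x \<ominus> f x' = f (x \<ominus> x')"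
      "\<And>x. x \<in> carrier A \<Longrightarrow> nrm A (f x) \<le> q * nrm A x" for f
  proof -
    define u where "u n = ((\<lambda>x. \<one> \<oplus> f x) ^^ n) \<zero>" for n :: nat
    have u_Suc: "u (Suc n) = \<one> \<oplus> f (u n)" for n by (simp add: u_def)
    have u: "u n \<in> carrier A" for n by (induction n) (auto simp: u_def f)
    have diff: "(\<one> \<oplus> f a) \<ominus> (\<one> \<oplus> f b) = f (a \<ominus> b)"
      if "a \<in> carrier A" "b \<in> carrier A" for a b
    proof -
      have "(\<one> \<oplus> f a) \<ominus> (\<one> \<oplus> f b) = f a \<ominus> f b"
        by (rule one_add_minus_one_add) (simp_all add: f that)
      then show ?thesis by (simp add: f that)
    qed
    \<comment> \<open>\<open>B\<close> is the fixed point of b -> ||1|| + q b, so the recursive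
      bound on the iterates reproduces itself.\<close>
    define B where "B = nrm A \<one> / (1 - q)"
    have B: "nrm A \<one> + q * B = B" using q by (simp add: B_def field_simps)
    have B0: "0 \<le> B" using q nrm_nonneg[of \<one>] by (simp add: B_def)
    have bound: "nrm A (u n) \<le> B" for n
    proof (induction n)
      case 0
      then show ?case using nrm_eq_zero[of \<zero>] B0 by (simp add: u_def)
    next
      case (Suc n)
      have "nrm A (u (Suc n)) \<le> nrm A \<one> + nrm A (f (u n))"
        unfolding u_Suc by (rule nrm_triangle) (auto simp: f u)
      also have "\<dots> \<le> nrm A \<one> + q * nrm A (u n)" using f(3)[OF u] by simp
      also have "\<dots> \<le> nrm A \<one> + q * B" using q Suc by (simp add: mult_left_mono)
      finally show ?case by (simp add: B)
    qed
    have tail: "nrm A (u (n + k) \<ominus> u n) \<le> q ^ n * B" for n k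
    proof (induction n)
      case 0
      have "u k \<ominus> \<zero> = u k" using u[of k] by (simp add: minus_eq)
      then show ?case using bound[of k] by (simp add: u_def)
    next
      case (Suc n)
      have "u (Suc n + k) \<ominus> u (Suc n) = f (u (n + k) \<ominus> u n)"
        using diff[OF u u] by (simp add: u_Suc)
      then have "nrm A (u (Suc n + k) \<ominus> u (Suc n)) \<le> q * nrm A (u (n + k) \<ominus> u n)"
        using f(3)[OF minus_closed[OF u u]] by simp
      also have "\<dots> \<le> q * (q ^ n * B)" using q Suc by (intro mult_left_mono) auto
      finally show ?case by (simp add: mult.assoc)
    qed
    have lim0: "(\<lambda>n. q ^ n * B) \<longlonglongrightarrow> 0"
      using q by (intro tendsto_mult_left_zero LIMSEQ_realpow_zero) auto
    have "\<exists>N. \<forall>m\<ge>N. \<forall>n\<ge>N. nrm A (u m \<ominus> u n) < e" if e: "0 < e" for e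
    proof -
      obtain N where N: "\<And>n. N \<le> n \<Longrightarrow> q ^ n * B < e"
        using order_tendstoD(2)[OF lim0 e] by (auto simp: eventually_sequentially)
      have *: "nrm A (u m \<ominus> u n) < e" if "N \<le> n" "n \<le> m" for m n
        using tail[of n "m - n"] N[OF that(1)] that(2) by simp
      have sym: "nrm A (u n \<ominus> u m) = nrm A (u m \<ominus> u n)" for m n
        unfolding minus_swap[OF u[of m] u[of n]] by (rule nrm_uminus[OF minus_closed[OF u u]])
      have "nrm A (u m \<ominus> u n) < e" if "N \<le> m" "N \<le> n" for m n
        using *[of n m] *[of m n] sym[of n m] that by (cases "n \<le> m") auto
      then show ?thesis by blast
    qed
    from nrm_complete[OF u this] obtain x where x: "x \<in> carrier A"
      "(\<lambda>n. nrm A (u n \<ominus> x)) \<longlonglongrightarrow> 0" by blast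
    have c: "x \<ominus> (\<one> \<oplus> f x) \<in> carrier A"
      by (intro minus_closed x(1) a_closed one_closed f(1))
    have "nrm A (x \<ominus> (\<one> \<oplus> f x)) \<le> nrm A (u (Suc n) \<ominus> x) + q * nrm A (u n \<ominus> x)" for n
    proof -
      have "x \<ominus> (\<one> \<oplus> f x) = \<ominus> (u (Suc n) \<ominus> x) \<oplus> (u (Suc n) \<ominus> (\<one> \<oplus> f x))"
        by (rule minus_telescope) (simp_all add: u x(1) f)
      also have "u (Suc n) \<ominus> (\<one> \<oplus> f x) = f (u n \<ominus> x)"
        unfolding u_Suc by (rule diff[OF u x(1)])
      finally have "nrm A (x \<ominus> (\<one> \<oplus> f x)) \<le> nrm A (\<ominus> (u (Suc n) \<ominus> x)) + nrm A (f (u n \<ominus> x))"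
        using nrm_triangle minus_closed[OF u x(1)] f(1) by simp
      then show ?thesis
        using nrm_uminus[OF minus_closed[OF u x(1)]] f(3)[OF minus_closed[OF u[of n] x(1)]] by simp
    qed
    moreover have "(\<lambda>n. nrm A (u (Suc n) \<ominus> x) + q * nrm A (u n \<ominus> x)) \<longlonglongrightarrow> 0 + q * 0"
      by (intro tendsto_intros x(2) LIMSEQ_Suc[OF x(2)])
    ultimately have "nrm A (x \<ominus> (\<one> \<oplus> f x)) \<le> 0"
      by (intro LIMSEQ_le_const[of _ 0]) auto
    then have "x \<ominus> (\<one> \<oplus> f x) = \<zero>"
      using nrm_nonneg[OF c] nrm_eq_zero[OF c] by simp
    then show ?thesis using f(1)[OF x(1)] x(1) by (intro bexI[OF _ x(1)]) (rule eq_if_minus_eq_zero, auto)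
  qed
  obtain r where r: "r \<in> carrier A" "r = \<one> \<oplus> y \<otimes> r"
  proof -
    have "\<exists>x\<in>carrier A. x = \<one> \<oplus> y \<otimes> x"
    proof (rule fixed_point)
      show "nrm A (y \<otimes> x) \<le> q * nrm A x" if "x \<in> carrier A" for x
        using nrm_mult[OF y that] by (simp add: q_def)
    qed (use y in \<open>simp_all add: r_minus r_distr minus_eq\<close>)
    then show ?thesis using that by blast
  qed
  obtain l where l: "l \<in> carrier A" "l = \<one> \<oplus> l \<otimes> y"
  proof -
    have "\<exists>x\<in>carrier A. x = \<one> \<oplus> x \<otimes> y"
    proof (rule fixed_point)
      show "nrm A (x \<otimes> y) \<le> q * nrm A x" if "x \<in> carrier A" for x
        using nrm_mult[OF that y] by (simp add: q_def mult.commute)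
    qed (use y in \<open>simp_all add: l_minus l_distr minus_eq\<close>)
    then show ?thesis using that by blast
  qed
  have 1: "(\<one> \<ominus> y) \<otimes> r = \<one>"
  proof -
    have "(\<one> \<ominus> y) \<otimes> r = r \<ominus> y \<otimes> r" using y r(1) by (simp add: minus_eq l_distr l_minus)
    also have "\<dots> = (\<one> \<oplus> y \<otimes> r) \<ominus> y \<otimes> r" using r(2) by simp
    also have "\<dots> = \<one>" using y r(1) by (intro add_minus_cancel) auto
    finally show ?thesis .
  qed
  have 2: "l \<otimes> (\<one> \<ominus> y) = \<one>"
  proof -
    have "l \<otimes> (\<one> \<ominus> y) = l \<ominus> l \<otimes> y" using y l(1) by (simp add: minus_eq r_distr r_minus)
    also have "\<dots> = (\<one> \<oplus> l \<otimes> y) \<ominus> l \<otimes> y" using l(2) by simp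
    also have "\<dots> = \<one>" using y l(1) by (intro add_minus_cancel) auto
    finally show ?thesis .
  qed
  have "l = l \<otimes> ((\<one> \<ominus> y) \<otimes> r)" using 1 l(1) by simp
  also have "\<dots> = (l \<otimes> (\<one> \<ominus> y)) \<otimes> r"
    by (intro m_assoc[symmetric] l(1) minus_closed one_closed y r(1))
  also have "\<dots> = r" using 2 r(1) by simp
  finally have "l = r" .
  then show ?thesis using 1 2 r(1) y minus_closed by (auto simp: Units_def)
qed

text \<open>1 - y^2 factors as (1 - y)(1 + y) in either order, so its inverse gives 1 - y a right
  and a left inverse. This is the way back from a high power of R to R itself.\<close>

lemma one_minus_Units_if_square:
  assumes y: "y \<in> carrier A" and "\<one> \<ominus> y \<otimes> y \<in> Units A"
  shows "\<one> \<ominus> y \<in> Units A"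
proof -
  obtain z where z: "z \<in> carrier A" "z \<otimes> (\<one> \<ominus> y \<otimes> y) = \<one>" "(\<one> \<ominus> y \<otimes> y) \<otimes> z = \<one>"
    using assms(2) by (auto simp: Units_def)
  have y1: "\<one> \<ominus> y \<in> carrier A" using y by simp
  note f = one_minus_square[OF y]
  have r: "(\<one> \<ominus> y) \<otimes> ((\<one> \<oplus> y) \<otimes> z) = \<one>" using f(1) z y y1 by (simp add: m_assoc)
  have l: "(z \<otimes> (\<one> \<oplus> y)) \<otimes> (\<one> \<ominus> y) = \<one>" using f(2) z y y1 by (simp add: m_assoc)
  have "z \<otimes> (\<one> \<oplus> y) = (\<one> \<oplus> y) \<otimes> z"
  proof -
    have "z \<otimes> (\<one> \<oplus> y) = (z \<otimes> (\<one> \<oplus> y)) \<otimes> ((\<one> \<ominus> y) \<otimes> ((\<one> \<oplus> y) \<otimes> z))"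
      using r z(1) y by simp
    also have "\<dots> = ((z \<otimes> (\<one> \<oplus> y)) \<otimes> (\<one> \<ominus> y)) \<otimes> ((\<one> \<oplus> y) \<otimes> z)"
      using z(1) y y1 by (simp add: m_assoc)
    finally show ?thesis using l z(1) y by simp
  qed
  then show ?thesis using r l z(1) y y1 by (auto simp: Units_def intro!: bexI[of _ "(\<one> \<oplus> y) \<otimes> z"])
qed

end

section \<open>Square-summable families\<close>

lemma ell2_summable: "f \<in> ell2 X \<Longrightarrow> (\<lambda>k. (norm (f k))\<^sup>2) summable_on X"
  by (simp add: ell2_def)

lemma ell2_outside: "f \<in> ell2 X \<Longrightarrow> k \<notin> X \<Longrightarrow> f k = 0"
  by (simp add: ell2_def)

lemma ell2_norm_sq: "(ell2_norm X f)\<^sup>2 = (\<Sum>\<^sub>\<infinity>k\<in>X. (norm (f k))\<^sup>2)"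
  by (simp add: ell2_norm_def infsum_nonneg)

lemma ell2_norm_nonneg: "0 \<le> ell2_norm X f"
  by (simp add: ell2_norm_def infsum_nonneg)

lemma norm_le_ell2_norm:
  assumes "f \<in> ell2 X"
  shows "norm (f k) \<le> ell2_norm X f"
proof (cases "k \<in> X")
  case True
  have "(norm (f k))\<^sup>2 \<le> (ell2_norm X f)\<^sup>2"
    using finite_sum_le_infsum[OF ell2_summable[OF assms], of "{k}"] True by (simp add: ell2_norm_sq)
  then show ?thesis by (rule power2_le_imp_le[OF _ ell2_norm_nonneg])
qed (use ell2_outside[OF assms] in \<open>simp add: ell2_norm_nonneg\<close>)

lemma ell2_scale: "f \<in> ell2 X \<Longrightarrow> (\<lambda>k. c *\<^sub>C f k) \<in> ell2 X"
  by (auto simp: ell2_def norm_scaleC power_mult_distrib intro: summable_on_cmult_right)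

lemma ell2_add:
  assumes "f \<in> ell2 X" "g \<in> ell2 X"
  shows "(\<lambda>k. f k + g k) \<in> ell2 X"
proof -
  have "(\<lambda>k. 2 * (norm (f k))\<^sup>2 + 2 * (norm (g k))\<^sup>2) summable_on X"
    by (intro summable_on_add summable_on_cmult_right ell2_summable assms)
  moreover have "(norm (f k + g k))\<^sup>2 \<le> 2 * (norm (f k))\<^sup>2 + 2 * (norm (g k))\<^sup>2" for k
  proof -
    have "(norm (f k + g k))\<^sup>2 \<le> (norm (f k) + norm (g k))\<^sup>2"
      by (intro power_mono norm_triangle_ineq) simp
    also have "\<dots> \<le> 2 * (norm (f k))\<^sup>2 + 2 * (norm (g k))\<^sup>2"
      using zero_le_power2[of "norm (f k) - norm (g k)"] unfolding power2_sum power2_diff by argo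
    finally show ?thesis .
  qed
  ultimately have "(\<lambda>k. (norm (f k + g k))\<^sup>2) summable_on X"
    by (rule summable_on_comparison_test) simp
  then show ?thesis using assms by (simp add: ell2_def)
qed

lemma mult_le_sum_squares: "0 \<le> a \<Longrightarrow> 0 \<le> b \<Longrightarrow> a * b \<le> a\<^sup>2 + b\<^sup>2" for a b :: real
proof -
  assume "0 \<le> a" "0 \<le> b"
  then have "0 \<le> a * b" by simp
  with sum_squares_bound[of a b] show ?thesis unfolding mult.assoc by linarith
qed

lemma ell2_inner_abs_summable:
  assumes "f \<in> ell2 X" "g \<in> ell2 X"
  shows "(\<lambda>k. norm (cinner (f k) (g k))) summable_on X"
proof (rule Infinite_Sum.abs_summable_on_comparison_test')
  show "(\<lambda>k. (norm (f k))\<^sup>2 + (norm (g k))\<^sup>2) summable_on X"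
    by (intro summable_on_add ell2_summable assms)
  show "norm (cinner (f k) (g k)) \<le> (norm (f k))\<^sup>2 + (norm (g k))\<^sup>2" for k
    using cinner_Cauchy_Schwarz mult_le_sum_squares[OF norm_ge_zero norm_ge_zero] by (rule order_trans)
qed

lemma ell2_inner_has_sum:
  assumes "f \<in> ell2 X" "g \<in> ell2 X"
  shows "((\<lambda>k. cinner (f k) (g k)) has_sum ell2_inner X f g) X"
  unfolding ell2_inner_def
  by (rule has_sum_infsum, rule abs_summable_summable, rule ell2_inner_abs_summable[OF assms])

lemma ell2_inner_self:
  assumes "f \<in> ell2 X"
  shows "ell2_inner X f f = of_real ((ell2_norm X f)\<^sup>2)"
proof -
  have "((\<lambda>k. complex_of_real ((norm (f k))\<^sup>2)) has_sum of_real ((ell2_norm X f)\<^sup>2)) X"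
    unfolding ell2_norm_sq by (intro has_sum_of_real has_sum_infsum ell2_summable assms)
  then show ?thesis by (simp add: ell2_inner_def cinner_self infsumI)
qed

text \<open>Both estimates for A* A rest on this expansion: the contraction property of 1 - t A* A
  and the lower bound for z - A* A.\<close>

lemma ell2_norm_scale_minus_sq:
  assumes "f \<in> ell2 X" "g \<in> ell2 X"
  shows "(ell2_norm X (\<lambda>k. c *\<^sub>C f k - g k))\<^sup>2 =
    (cmod c)\<^sup>2 * (ell2_norm X f)\<^sup>2 - 2 * Re (c * ell2_inner X f g) + (ell2_norm X g)\<^sup>2"
proof -
  have "((\<lambda>k. (cmod c)\<^sup>2 * (norm (f k))\<^sup>2 + 2 * - Re (c * cinner (f k) (g k)) + (norm (g k))\<^sup>2) has_sum
      (cmod c)\<^sup>2 * (ell2_norm X f)\<^sup>2 + 2 * - Re (c * ell2_inner X f g) + (ell2_norm X g)\<^sup>2) X"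
    unfolding ell2_norm_sq
    by (intro has_sum_add has_sum_cmult_right has_sum_uminusI has_sum_Re ell2_inner_has_sum has_sum_infsum
        ell2_summable assms)
  moreover have "(norm (c *\<^sub>C f k - g k))\<^sup>2 =
      (cmod c)\<^sup>2 * (norm (f k))\<^sup>2 + 2 * - Re (c * cinner (f k) (g k)) + (norm (g k))\<^sup>2" for k
    by (simp add: norm_diff_sq norm_scaleC power_mult_distrib cinner_scaleC_left)
  ultimately have "((\<lambda>k. (norm (c *\<^sub>C f k - g k))\<^sup>2) has_sum
      (cmod c)\<^sup>2 * (ell2_norm X f)\<^sup>2 + 2 * - Re (c * ell2_inner X f g) + (ell2_norm X g)\<^sup>2) X"
    by presburger
  from infsumI[OF this] show ?thesis unfolding ell2_norm_sq[symmetric] by argo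
qed

text \<open>Pairing with these families recovers coordinates, and applying a matrix to them recovers
  its columns. They give uniqueness of adjoints, injectivity of \<open>matrix_op\<close> and the
  bound of entries by the operator norm.\<close>

definition unit_family :: "'i \<Rightarrow> 'h::complex_hilbert \<Rightarrow> 'i \<Rightarrow> 'h" where
  "unit_family k x = (\<lambda>i. if i = k then x else 0)"

lemma infsum_unit_family:
  assumes "k \<in> X" "\<And>i. i \<noteq> k \<Longrightarrow> h i = 0"
  shows "infsum h X = h k"
proof -
  have "infsum h X = infsum h {k}"
    by (rule infsum_cong_neutral) (use assms in auto)
  then show ?thesis by simp
qed

lemma unit_family_ell2: "k \<in> X \<Longrightarrow> unit_family k x \<in> ell2 X"
  unfolding ell2_def unit_family_def
  by (auto intro!: finite_nonzero_values_imp_summable_on intro: finite_subset[of _ "{k}"])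

lemma ell2_norm_unit_family: "k \<in> X \<Longrightarrow> ell2_norm X (unit_family k x) = norm x"
  unfolding ell2_norm_def by (subst infsum_unit_family[of k]) (auto simp: unit_family_def)

lemma ell2_inner_unit_family: "k \<in> X \<Longrightarrow> ell2_inner X (unit_family k x) g = cinner x (g k)"
  unfolding ell2_inner_def by (subst infsum_unit_family[of k]) (auto simp: unit_family_def)

lemma ell2_inner_eqI:
  assumes "g \<in> ell2 X" "g' \<in> ell2 X" "\<And>f. f \<in> ell2 X \<Longrightarrow> ell2_inner X f g = ell2_inner X f g'"
  shows "g = g'"
proof
  fix k
  show "g k = g' k"
  proof (cases "k \<in> X")
    case True
    then show ?thesis
      using assms(3)[OF unit_family_ell2[OF True]]
      by (intro cinner_eqI) (simp add: ell2_inner_unit_family)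
  qed (use assms ell2_outside in metis)
qed

lemma bounded_ell2_opsD:
  assumes "T \<in> bounded_ell2_ops X"
  shows "f \<in> ell2 X \<Longrightarrow> T f \<in> ell2 X" "T \<in> extensional (ell2 X)"
    "\<exists>C>0. \<forall>f\<in>ell2 X. ell2_norm X (T f) \<le> C * ell2_norm X f"
proof -
  show "f \<in> ell2 X \<Longrightarrow> T f \<in> ell2 X" "T \<in> extensional (ell2 X)"
    using assms by (auto simp: bounded_ell2_ops_def PiE_def)
  obtain C where C: "\<forall>f\<in>ell2 X. ell2_norm X (T f) \<le> C * ell2_norm X f"
    using assms by (auto simp: bounded_ell2_ops_def)
  \<comment> \<open>The constant in \<open>bounded_ell2_ops\<close> may be zero or negative. A
    positive one can be inverted, which turns a bound on an inverse operator into a lower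
    bound.\<close>
  have "ell2_norm X (T f) \<le> max C 1 * ell2_norm X f" if "f \<in> ell2 X" for f
    using C that mult_right_mono[of C "max C 1" "ell2_norm X f"] ell2_norm_nonneg[of X f] by fastforce
  then show "\<exists>C>0. \<forall>f\<in>ell2 X. ell2_norm X (T f) \<le> C * ell2_norm X f"
    by (intro exI[of _ "max C 1"]) auto
qed

text \<open>Units and inverses of \<open>B_ell2\<close> are notions of composition, so the monoid
  laws are the structure on which inverse-closedness rests.\<close>

lemma monoid_B_ell2: "monoid (B_ell2 X)"
proof (rule monoidI, unfold B_ell2_def, simp_all)
  show "(\<lambda>f\<in>ell2 X. f) \<in> bounded_ell2_ops X"
    by (auto simp: bounded_ell2_ops_def ell2_add ell2_scale intro: exI[of _ 1])
  fix S T :: "('a \<Rightarrow> 'b) \<Rightarrow> 'a \<Rightarrow> 'b"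
  assume S: "S \<in> bounded_ell2_ops X"
  show "compose (ell2 X) (\<lambda>f\<in>ell2 X. f) S = S" "compose (ell2 X) S (\<lambda>f\<in>ell2 X. f) = S"
    using bounded_ell2_opsD[OF S] by (auto simp: compose_def fun_eq_iff extensional_def)
  assume T: "T \<in> bounded_ell2_ops X"
  obtain C where C: "C > 0" "\<forall>f\<in>ell2 X. ell2_norm X (S f) \<le> C * ell2_norm X f"
    using bounded_ell2_opsD(3)[OF S] by blast
  obtain D where D: "D > 0" "\<forall>f\<in>ell2 X. ell2_norm X (T f) \<le> D * ell2_norm X f"
    using bounded_ell2_opsD(3)[OF T] by blast
  have "ell2_norm X (S (T f)) \<le> C * D * ell2_norm X f" if f: "f \<in> ell2 X" for f
  proof -
    have "ell2_norm X (S (T f)) \<le> C * ell2_norm X (T f)"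
      using C bounded_ell2_opsD(1)[OF T f] by blast
    also have "\<dots> \<le> C * (D * ell2_norm X f)" using C D f by (intro mult_left_mono) auto
    finally show ?thesis by (simp add: mult.assoc)
  qed
  then show "compose (ell2 X) S T \<in> bounded_ell2_ops X"
    using S T by (auto simp: bounded_ell2_ops_def compose_def PiE_def Pi_def ell2_add ell2_scale
        intro!: exI[of _ "C * D"])
  fix R :: "('a \<Rightarrow> 'b) \<Rightarrow> 'a \<Rightarrow> 'b"
  assume R: "R \<in> bounded_ell2_ops X"
  show "compose (ell2 X) (compose (ell2 X) S T) R = compose (ell2 X) S (compose (ell2 X) T R)"
    using bounded_ell2_opsD(1)[OF R] by (auto simp: compose_def fun_eq_iff)
qed

section \<open>Weighted matrices as operators\<close>

lemma matrix_op_outside: "f \<notin> ell2 X \<Longrightarrow> matrix_op X A f = undefined"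
  by (simp add: matrix_op_def)

context decay_weight
begin

lemma matrix_op_abs_summable:
  assumes "A \<in> weighted_matrices X W" "f \<in> ell2 X" "k \<in> X"
  shows "(\<lambda>l. norm (blinfun_apply (A k l) (f l))) summable_on X"
proof (rule Infinite_Sum.abs_summable_on_comparison_test')
  show "(\<lambda>l. norm (A k l) * ell2_norm X f) summable_on X"
    by (intro summable_on_cmult_left weighted_rows assms)
  show "norm (blinfun_apply (A k l) (f l)) \<le> norm (A k l) * ell2_norm X f" for l
    using norm_blinfun[of "A k l" "f l"] mult_left_mono[OF norm_le_ell2_norm[OF assms(2), of l], of "norm (A k l)"]
    by simp
qed

lemma matrix_op_summable:
  assumes "A \<in> weighted_matrices X W" "f \<in> ell2 X"
  shows "(\<lambda>l. blinfun_apply (A k l) (f l)) summable_on X"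
proof (cases "k \<in> X")
  case True
  show ?thesis
    by (rule abs_summable_summable) (rule matrix_op_abs_summable[OF assms True])
qed (use op_matricesD(2)[OF weighted_matrices_op[OF assms(1)]] in \<open>simp add: blinfun.zero_left\<close>)

lemma matrix_op_apply:
  "f \<in> ell2 X \<Longrightarrow> matrix_op X A f k = (\<Sum>\<^sub>\<infinity>l\<in>X. blinfun_apply (A k l) (f l))"
  by (simp add: matrix_op_def)

lemma matrix_op_has_sum:
  assumes "A \<in> weighted_matrices X W" "f \<in> ell2 X"
  shows "((\<lambda>l. blinfun_apply (A k l) (f l)) has_sum matrix_op X A f k) X"
  unfolding matrix_op_apply[OF assms(2)] by (rule has_sum_infsum, rule matrix_op_summable[OF assms])

text \<open>Schur's test with \<open>S\<close> bounding all row and column sums. Cauchy-Schwarz for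
  sqrt(a) * (sqrt(a) ||f l||), where a = ||A k l||, spends one \<open>S\<close> on a row sum;
  summing over k and interchanging spends the second on a column sum.\<close>

lemma matrix_op_ell2:
  assumes A: "A \<in> weighted_matrices X W" and f: "f \<in> ell2 X"
  shows "matrix_op X A f \<in> ell2 X"
    and "ell2_norm X (matrix_op X A f) \<le> K * weighted_norm W A * ell2_norm X f"
proof -
  define S where "S = K * weighted_norm W A"
  have S0: "0 \<le> S" using K_pos weighted_norm_nonneg[OF A] by (simp add: S_def)
  let ?a = "\<lambda>k l. norm (A k l)" and ?h = "\<lambda>l. norm (f l)"
  have sq: "(\<lambda>(l, k). norm ((?h l)\<^sup>2 * ?a k l)) summable_on X \<times> X"
    by (rule abs_summable_on_double[where p="\<lambda>l. (?h l)\<^sup>2" and b="\<lambda>l k. ?a k l" and C=S])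
      (auto simp: S_def ell2_summable[OF f] weighted_columns[OF A])
  note sums = abs_summable_on_double_sums[OF abs_summable_on_double_swap[OF sq]]
    abs_summable_on_double_rows[OF abs_summable_on_double_swap[OF sq]]
  have pt: "(norm (matrix_op X A f k))\<^sup>2 \<le> S * (\<Sum>\<^sub>\<infinity>l\<in>X. (?h l)\<^sup>2 * ?a k l)" if k: "k \<in> X" for k
  proof -
    define T where "T = (\<Sum>\<^sub>\<infinity>l\<in>X. (?h l)\<^sup>2 * ?a k l)"
    have T0: "0 \<le> T" unfolding T_def by (intro infsum_nonneg) simp
    have row: "(\<lambda>l. (?h l)\<^sup>2 * ?a k l) summable_on X" using sums(3)[OF k] by simp
    note ms = matrix_op_abs_summable[OF A f k]
    have "norm (matrix_op X A f k) \<le> (\<Sum>\<^sub>\<infinity>l\<in>X. norm (blinfun_apply (A k l) (f l)))"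
      unfolding matrix_op_apply[OF f] by (rule norm_infsum_bound[OF ms])
    also have "\<dots> \<le> sqrt (S * T)"
    proof (rule infsum_le_finite_sums[OF ms])
      fix F assume F: "finite F" "F \<subseteq> X"
      have "(\<Sum>l\<in>F. norm (blinfun_apply (A k l) (f l))) \<le> (\<Sum>l\<in>F. sqrt (?a k l) * (sqrt (?a k l) * ?h l))"
        using norm_blinfun by (intro sum_mono) (simp add: mult.assoc[symmetric])
      also have "\<dots> \<le> sqrt (S * T)"
      proof (rule real_le_rsqrt)
        have "(\<Sum>l\<in>F. sqrt (?a k l) * (sqrt (?a k l) * ?h l))\<^sup>2
            \<le> (\<Sum>l\<in>F. (sqrt (?a k l))\<^sup>2) * (\<Sum>l\<in>F. (sqrt (?a k l) * ?h l)\<^sup>2)"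
          by (rule Cauchy_Schwarz_ineq_sum)
        also have "\<dots> = (\<Sum>l\<in>F. ?a k l) * (\<Sum>l\<in>F. (?h l)\<^sup>2 * ?a k l)"
          by (simp add: power_mult_distrib mult.commute)
        also have "\<dots> \<le> S * T"
        proof (rule mult_mono)
          show "(\<Sum>l\<in>F. ?a k l) \<le> S"
            using finite_sum_le_infsum[OF weighted_rows(1)[OF A k] F] weighted_rows(2)[OF A k]
            by (simp add: S_def)
          show "(\<Sum>l\<in>F. (?h l)\<^sup>2 * ?a k l) \<le> T"
            unfolding T_def by (rule finite_sum_le_infsum[OF row F]) simp
        qed (auto simp: S0 sum_nonneg)
        finally show "(\<Sum>l\<in>F. sqrt (?a k l) * (sqrt (?a k l) * ?h l))\<^sup>2 \<le> S * T" .
      qed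
      finally show "(\<Sum>l\<in>F. norm (blinfun_apply (A k l) (f l))) \<le> sqrt (S * T)" .
    qed
    finally have "(norm (matrix_op X A f k))\<^sup>2 \<le> (sqrt (S * T))\<^sup>2" by (intro power_mono) auto
    then show ?thesis using S0 T0 by (simp add: T_def)
  qed
  have sT: "(\<lambda>k. S * (\<Sum>\<^sub>\<infinity>l\<in>X. (?h l)\<^sup>2 * ?a k l)) summable_on X"
    by (intro summable_on_cmult_right sums(1))
  have sm: "(\<lambda>k. (norm (matrix_op X A f k))\<^sup>2) summable_on X"
    by (rule summable_on_comparison_test[OF sT pt]) auto
  have zero: "matrix_op X A f k = 0" if "k \<notin> X" for k
    using op_matricesD(2)[OF weighted_matrices_op[OF A] that]
    by (simp add: matrix_op_apply[OF f] blinfun.zero_left)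
  show "matrix_op X A f \<in> ell2 X" using sm zero by (simp add: ell2_def)
  have "(\<Sum>\<^sub>\<infinity>k\<in>X. \<Sum>\<^sub>\<infinity>l\<in>X. (?h l)\<^sup>2 * ?a k l) = (\<Sum>\<^sub>\<infinity>l\<in>X. \<Sum>\<^sub>\<infinity>k\<in>X. (?h l)\<^sup>2 * ?a k l)"
    by (rule sums(2))
  also have "\<dots> = (\<Sum>\<^sub>\<infinity>l\<in>X. (?h l)\<^sup>2 * (\<Sum>\<^sub>\<infinity>k\<in>X. ?a k l))"
    by (intro infsum_cong infsum_cmult_right) (rule weighted_columns(1)[OF A])
  also have "\<dots> \<le> (\<Sum>\<^sub>\<infinity>l\<in>X. (?h l)\<^sup>2 * S)"
  proof (rule infsum_mono)
    show le: "(?h l)\<^sup>2 * (\<Sum>\<^sub>\<infinity>k\<in>X. ?a k l) \<le> (?h l)\<^sup>2 * S" if "l \<in> X" for l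
      using weighted_columns(2)[OF A that] by (intro mult_left_mono) (auto simp: S_def)
    show sS: "(\<lambda>l. (?h l)\<^sup>2 * S) summable_on X" by (intro summable_on_cmult_left ell2_summable f)
    show "(\<lambda>l. (?h l)\<^sup>2 * (\<Sum>\<^sub>\<infinity>k\<in>X. ?a k l)) summable_on X"
      by (rule summable_on_comparison_test[OF sS le]) (auto intro!: mult_nonneg_nonneg infsum_nonneg)
  qed
  also have "\<dots> = S * (ell2_norm X f)\<^sup>2"
    unfolding ell2_norm_sq by (subst infsum_cmult_left) (auto simp: ell2_summable[OF f])
  finally have double: "(\<Sum>\<^sub>\<infinity>k\<in>X. \<Sum>\<^sub>\<infinity>l\<in>X. (?h l)\<^sup>2 * ?a k l) \<le> S * (ell2_norm X f)\<^sup>2" .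
  have "(ell2_norm X (matrix_op X A f))\<^sup>2 \<le> (\<Sum>\<^sub>\<infinity>k\<in>X. S * (\<Sum>\<^sub>\<infinity>l\<in>X. (?h l)\<^sup>2 * ?a k l))"
    unfolding ell2_norm_sq by (rule infsum_mono[OF sm sT pt])
  also have "\<dots> = S * (\<Sum>\<^sub>\<infinity>k\<in>X. \<Sum>\<^sub>\<infinity>l\<in>X. (?h l)\<^sup>2 * ?a k l)"
    by (rule infsum_cmult_right) (use sums(1) in auto)
  also have "\<dots> \<le> S * (S * (ell2_norm X f)\<^sup>2)" by (rule mult_left_mono[OF double S0])
  finally have "(ell2_norm X (matrix_op X A f))\<^sup>2 \<le> (S * ell2_norm X f)\<^sup>2"
    by (simp add: power_mult_distrib power2_eq_square mult_ac)
  then show "ell2_norm X (matrix_op X A f) \<le> K * weighted_norm W A * ell2_norm X f"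
    unfolding S_def[symmetric]
    by (rule power2_le_imp_le) (intro mult_nonneg_nonneg S0 ell2_norm_nonneg)
qed

lemma matrix_op_linear:
  assumes A: "A \<in> weighted_matrices X W" and f: "f \<in> ell2 X" and g: "g \<in> ell2 X"
  shows "matrix_op X A (\<lambda>k. f k + g k) = (\<lambda>k. matrix_op X A f k + matrix_op X A g k)"
    and "matrix_op X A (\<lambda>k. c *\<^sub>C f k) = (\<lambda>k. c *\<^sub>C matrix_op X A f k)"
proof -
  show "matrix_op X A (\<lambda>k. f k + g k) = (\<lambda>k. matrix_op X A f k + matrix_op X A g k)"
    by (rule ext) (simp add: matrix_op_apply ell2_add f g blinfun.add_right infsum_add
        matrix_op_summable[OF A])
  have "blinfun_apply (A k l) (c *\<^sub>C f l) = c *\<^sub>C blinfun_apply (A k l) (f l)" for k l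
    using op_matricesD(1)[OF weighted_matrices_op[OF A]] by (simp add: clinear_op_def)
  then show "matrix_op X A (\<lambda>k. c *\<^sub>C f k) = (\<lambda>k. c *\<^sub>C matrix_op X A f k)"
    using has_sum_bounded_linear[OF bounded_linear_scaleC matrix_op_has_sum[OF A f], of c]
    by (auto simp: matrix_op_apply[OF ell2_scale[OF f]] fun_eq_iff infsumI)
qed

lemma matrix_op_bounded:
  assumes "A \<in> weighted_matrices X W"
  shows "matrix_op X A \<in> bounded_ell2_ops X"
  unfolding bounded_ell2_ops_def
  using matrix_op_ell2[OF assms] matrix_op_linear[OF assms]
  by (auto simp: PiE_def Pi_def matrix_op_def[of X A])

lemma matrix_op_mult:
  assumes A: "A \<in> weighted_matrices X W" and B: "B \<in> weighted_matrices X W" and f: "f \<in> ell2 X"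
  shows "matrix_op X (matrix_mult X A B) f = matrix_op X A (matrix_op X B f)"
proof
  fix k
  show "matrix_op X (matrix_mult X A B) f k = matrix_op X A (matrix_op X B f) k"
  proof (cases "k \<in> X")
    case False
    then show ?thesis
      using op_matricesD(2)[OF weighted_matrices_op[OF A]]
      by (simp add: matrix_mult_def matrix_op_apply f matrix_op_ell2[OF B] blinfun.zero_left)
  next
    case k: True
    define g where "g n m = blinfun_apply (A k n) (blinfun_apply (B n m) (f m))" for n m
    have "(\<lambda>(n, m). norm (g n m)) summable_on X \<times> X"
    proof (rule abs_summable_on_double)
      show "(\<lambda>m. norm (B n m) * ell2_norm X f) summable_on X" if "n \<in> X" for n
        by (rule summable_on_cmult_left[OF weighted_rows(1)[OF B that]])
      show "(\<Sum>\<^sub>\<infinity>m\<in>X. norm (B n m) * ell2_norm X f) \<le> K * weighted_norm W B * ell2_norm X f" if "n \<in> X" for n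
        using weighted_rows[OF B that]
        by (subst infsum_cmult_left) (auto intro!: mult_right_mono ell2_norm_nonneg)
      show "norm (g n m) \<le> norm (A k n) * (norm (B n m) * ell2_norm X f)" for n m
        unfolding g_def
        by (intro order_trans[OF norm_blinfun] mult_left_mono mult_mono norm_le_ell2_norm f) auto
    qed (auto intro: weighted_rows A k)
    note swap = abs_summable_on_double_sums(2)[OF this]
    have "matrix_op X (matrix_mult X A B) f k = (\<Sum>\<^sub>\<infinity>m\<in>X. \<Sum>\<^sub>\<infinity>n\<in>X. g n m)"
      unfolding matrix_mult_def matrix_op_apply[OF f] g_def
      by (simp add: infsum_blinfun_apply[OF matrix_mult_summable[OF A B]])
    also have "\<dots> = (\<Sum>\<^sub>\<infinity>n\<in>X. \<Sum>\<^sub>\<infinity>m\<in>X. g n m)" by (rule swap[symmetric])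
    also have "\<dots> = matrix_op X A (matrix_op X B f) k"
      unfolding matrix_op_apply[OF matrix_op_ell2(1)[OF B f]] g_def
      by (intro infsum_cong infsumI has_sum_bounded_linear[OF blinfun.bounded_linear_right]
          matrix_op_has_sum[OF B f])
    finally show ?thesis .
  qed
qed

lemma matrix_op_add:
  assumes "A \<in> weighted_matrices X W" "B \<in> weighted_matrices X W" "f \<in> ell2 X"
  shows "matrix_op X (\<lambda>k l. A k l + B k l) f = (\<lambda>k. matrix_op X A f k + matrix_op X B f k)"
  by (rule ext) (simp add: matrix_op_apply assms blinfun.add_left infsum_add matrix_op_summable)

lemma matrix_op_scale:
  assumes "A \<in> weighted_matrices X W" "f \<in> ell2 X"
  shows "matrix_op X (scale_matrix c A) f = (\<lambda>k. c *\<^sub>C matrix_op X A f k)"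
  using has_sum_bounded_linear[OF bounded_linear_scaleC matrix_op_has_sum[OF assms], of c]
  by (auto simp: matrix_op_apply[OF assms(2)] scale_matrix_def fun_eq_iff infsumI)

lemma matrix_op_diff:
  assumes "A \<in> weighted_matrices X W" "B \<in> weighted_matrices X W" "f \<in> ell2 X"
  shows "matrix_op X (\<lambda>k l. A k l - B k l) f = (\<lambda>k. matrix_op X A f k - matrix_op X B f k)"
proof -
  have "matrix_op X A f k = matrix_op X (\<lambda>k l. A k l - B k l) f k + matrix_op X B f k" for k
    using matrix_op_add[OF weighted_diff[OF assms(1,2)] assms(2,3)] by (simp add: fun_eq_iff)
  then show ?thesis by (simp add: fun_eq_iff)
qed

lemma matrix_op_one:
  assumes "f \<in> ell2 X"
  shows "matrix_op X (one_matrix X) f = f"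
proof
  fix k
  show "matrix_op X (one_matrix X) f k = f k"
  proof (cases "k \<in> X")
    case True
    have "matrix_op X (one_matrix X) f k = blinfun_apply (one_matrix X k k) (f k)"
      unfolding matrix_op_apply[OF assms]
      by (rule infsum_unit_family[OF True]) (simp add: one_matrix_def blinfun.zero_left)
    then show ?thesis using True by (simp add: one_matrix_def)
  qed (simp add: matrix_op_apply assms one_matrix_def blinfun.zero_left ell2_outside[OF assms])
qed

lemma matrix_op_unit_family:
  assumes "l \<in> X"
  shows "matrix_op X A (unit_family l x) k = blinfun_apply (A k l) x"
  unfolding matrix_op_apply[OF unit_family_ell2[OF assms]]
  by (subst infsum_unit_family[OF assms]) (auto simp: unit_family_def blinfun.zero_right)

text \<open>An entry is a coordinate of the image of a one-point family. Through this bound the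
  operator norm enters the interpolation.\<close>

lemma norm_entry_le_if_op_bounded:
  assumes A: "A \<in> weighted_matrices X W" and q: "0 \<le> q"
    and le: "\<And>f. f \<in> ell2 X \<Longrightarrow> ell2_norm X (matrix_op X A f) \<le> q * ell2_norm X f"
  shows "norm (A k l) \<le> q"
proof (cases "l \<in> X")
  case True
  show ?thesis
  proof (rule norm_blinfun_bound[OF q])
    fix x
    note u = unit_family_ell2[OF True, of x]
    have "norm (blinfun_apply (A k l) x) \<le> ell2_norm X (matrix_op X A (unit_family l x))"
      using norm_le_ell2_norm[OF matrix_op_ell2(1)[OF A u], of k]
      by (simp add: matrix_op_unit_family[OF True])
    also have "\<dots> \<le> q * norm x" using le[OF u] by (simp add: ell2_norm_unit_family[OF True])
    finally show "norm (blinfun_apply (A k l) x) \<le> q * norm x" .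
  qed
qed (use q op_matricesD(3)[OF weighted_matrices_op[OF A]] in simp)

lemma inj_on_matrix_op: "inj_on (matrix_op X) (weighted_matrices X W)"
proof (rule inj_onI, intro ext blinfun_eqI)
  fix A B :: "('i, 'b::complex_hilbert) op_matrix" and k l x
  assume A: "A \<in> weighted_matrices X W" and B: "B \<in> weighted_matrices X W"
    and eq: "matrix_op X A = matrix_op X B"
  show "blinfun_apply (A k l) x = blinfun_apply (B k l) x"
  proof (cases "l \<in> X")
    case True
    then show ?thesis using matrix_op_unit_family[of l _ x k] eq by metis
  qed (use op_matricesD(3)[OF weighted_matrices_op[OF A]] op_matricesD(3)[OF weighted_matrices_op[OF B]] in simp)
qed

text \<open>The double family is dominated by ||A k l|| (||f l||^2 + ||g k||^2). The first half is
  summable because column sums are bounded, the second because row sums are.\<close>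

lemma ell2_inner_matrix_op:
  assumes A: "A \<in> weighted_matrices X W" and f: "f \<in> ell2 X" and g: "g \<in> ell2 X"
  shows "ell2_inner X (matrix_op X A f) g = ell2_inner X f (matrix_op X (adj_matrix A) g)"
proof -
  have cl: "clinear_op (A k l)" for k l
    by (rule op_matricesD(1)[OF weighted_matrices_op[OF A]])
  have "(\<lambda>(l, k). norm ((norm (f l))\<^sup>2 * norm (A k l))) summable_on X \<times> X"
    by (rule abs_summable_on_double[where p="\<lambda>l. (norm (f l))\<^sup>2" and b="\<lambda>l k. norm (A k l)"])
      (auto intro: weighted_columns[OF A] ell2_summable[OF f])
  then have 1: "(\<lambda>(k, l). norm ((norm (f l))\<^sup>2 * norm (A k l))) summable_on X \<times> X"
    by (rule abs_summable_on_double_swap)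
  have 2: "(\<lambda>(k, l). norm ((norm (g k))\<^sup>2 * norm (A k l))) summable_on X \<times> X"
    by (rule abs_summable_on_double[where p="\<lambda>k. (norm (g k))\<^sup>2" and b="\<lambda>k l. norm (A k l)"])
      (auto intro: weighted_rows[OF A] ell2_summable[OF g])
  let ?s = "\<lambda>k l. cinner (blinfun_apply (A k l) (f l)) (g k)"
  have "(\<lambda>(k, l). norm (?s k l)) summable_on X \<times> X"
  proof (rule summable_on_comparison_test[OF summable_on_add[OF 1 2]])
    fix p :: "'i \<times> 'i"
    obtain k l where p: "p = (k, l)" by fastforce
    have "norm (?s k l) \<le> norm (blinfun_apply (A k l) (f l)) * norm (g k)"
      by (rule cinner_Cauchy_Schwarz)
    also have "\<dots> \<le> norm (A k l) * (norm (f l) * norm (g k))"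
      using mult_right_mono[OF norm_blinfun[of "A k l" "f l"], of "norm (g k)"] by (simp add: mult.assoc)
    also have "\<dots> \<le> norm (A k l) * ((norm (f l))\<^sup>2 + (norm (g k))\<^sup>2)"
    proof (rule mult_left_mono)
      show "norm (f l) * norm (g k) \<le> (norm (f l))\<^sup>2 + (norm (g k))\<^sup>2"
        by (rule mult_le_sum_squares) auto
    qed simp
    finally show "(case p of (k, l) \<Rightarrow> norm (?s k l)) \<le>
        (case p of (k, l) \<Rightarrow> norm ((norm (f l))\<^sup>2 * norm (A k l))) +
        (case p of (k, l) \<Rightarrow> norm ((norm (g k))\<^sup>2 * norm (A k l)))"
      by (simp add: p distrib_left mult.commute)
  qed auto
  note swap = abs_summable_on_double_sums(2)[OF this]
  have "ell2_inner X (matrix_op X A f) g = (\<Sum>\<^sub>\<infinity>k\<in>X. \<Sum>\<^sub>\<infinity>l\<in>X. ?s k l)"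
    unfolding ell2_inner_def
    by (intro infsum_cong infsumI[symmetric] has_sum_bounded_linear[OF bounded_linear_cinner_left]
        matrix_op_has_sum A f)
  also have "\<dots> = (\<Sum>\<^sub>\<infinity>l\<in>X. \<Sum>\<^sub>\<infinity>k\<in>X. ?s k l)" by (rule swap)
  also have "\<dots> = (\<Sum>\<^sub>\<infinity>l\<in>X. \<Sum>\<^sub>\<infinity>k\<in>X. cinner (f l) (blinfun_apply (adj_matrix A l k) (g k)))"
    by (simp add: cinner_adj_op cl adj_matrix_def)
  also have "\<dots> = ell2_inner X f (matrix_op X (adj_matrix A) g)"
    unfolding ell2_inner_def
    by (intro infsum_cong infsumI has_sum_bounded_linear[OF bounded_linear_cinner_right]
        matrix_op_has_sum adj_matrix_weighted A g)
  finally show ?thesis .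
qed

text \<open>The description in \<open>B_ell2\<close> is resolved by exhibiting an adjoint. Inner
  products determine any other one on \<open>ell2 X\<close>, and extensionality determines it
  elsewhere.\<close>

lemma star_B_ell2_matrix_op:
  assumes "A \<in> weighted_matrices X W"
  shows "star (B_ell2 X) (matrix_op X A) = matrix_op X (adj_matrix A)"
proof -
  have "(THE S. S \<in> bounded_ell2_ops X \<and>
      (\<forall>f\<in>ell2 X. \<forall>g\<in>ell2 X. ell2_inner X (matrix_op X A f) g = ell2_inner X f (S g)))
    = matrix_op X (adj_matrix A)"
  proof (rule the_equality)
    show "matrix_op X (adj_matrix A) \<in> bounded_ell2_ops X \<and> (\<forall>f\<in>ell2 X. \<forall>g\<in>ell2 X.
        ell2_inner X (matrix_op X A f) g = ell2_inner X f (matrix_op X (adj_matrix A) g))"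
      by (simp add: matrix_op_bounded adj_matrix_weighted ell2_inner_matrix_op assms)
  next
    fix S
    assume S: "S \<in> bounded_ell2_ops X \<and>
      (\<forall>f\<in>ell2 X. \<forall>g\<in>ell2 X. ell2_inner X (matrix_op X A f) g = ell2_inner X f (S g))"
    show "S = matrix_op X (adj_matrix A)"
    proof (rule extensionalityI[of _ "ell2 X"])
      show "S \<in> extensional (ell2 X)" "matrix_op X (adj_matrix A) \<in> extensional (ell2 X)"
        using S bounded_ell2_opsD(2) by (auto simp: matrix_op_def)
      show "S g = matrix_op X (adj_matrix A) g" if g: "g \<in> ell2 X" for g
        using S g assms
        by (intro ell2_inner_eqI[of _ X])
          (auto simp: bounded_ell2_opsD(1) matrix_op_ell2 adj_matrix_weighted
            ell2_inner_matrix_op[symmetric])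
    qed
  qed
  then show ?thesis by (simp add: B_ell2_def)
qed

lemma matrix_op_star_hom: "matrix_op X \<in> star_hom weighted_algebra (B_ell2 X)"
  unfolding star_hom_def
proof (intro CollectI conjI allI ballI)
  have carr: "carrier (B_ell2 X) = bounded_ell2_ops X"
    "\<And>S T. S \<otimes>\<^bsub>B_ell2 X\<^esub> T = compose (ell2 X) S T" "\<one>\<^bsub>B_ell2 X\<^esub> = (\<lambda>f\<in>ell2 X. f)"
    "\<And>S T. S \<oplus>\<^bsub>B_ell2 X\<^esub> T = (\<lambda>f\<in>ell2 X. \<lambda>k. S f k + T f k)"
    by (simp_all add: B_ell2_def)
  show "matrix_op X \<in> ring_hom weighted_algebra (B_ell2 X)"
    by (rule ring_hom_memI; simp only: weighted_algebra_simps carr)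
      (auto simp: matrix_op_bounded matrix_op_mult matrix_op_add
        matrix_op_one compose_def restrict_def matrix_op_outside fun_eq_iff)
next
  fix c and A :: "('i, 'a::complex_hilbert) op_matrix" assume A: "A \<in> carrier weighted_algebra"
  show "matrix_op X (c \<odot>\<^bsub>weighted_algebra\<^esub> A) = c \<odot>\<^bsub>B_ell2 X\<^esub> matrix_op X A"
    using A by (simp only: weighted_algebra_simps, simp add: B_ell2_def)
      (auto simp: matrix_op_scale matrix_op_outside fun_eq_iff)
next
  fix A :: "('i, 'a::complex_hilbert) op_matrix" assume "A \<in> carrier weighted_algebra"
  then show "matrix_op X (star weighted_algebra A) = star (B_ell2 X) (matrix_op X A)"
    by (simp only: weighted_algebra_simps star_B_ell2_matrix_op)
qed

lemma series_converge_weighted: "series_converge X (weighted_matrices X W)"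
  by (simp add: series_converge_def matrix_mult_summable matrix_op_summable)

end

section \<open>Spectral invariance by Brandenburg's trick\<close>

text \<open>
  Iterating the recursion gives \<open>(E x\<^sub>m)\<^sup>2 \<le> ((E x\<^sub>0)\<^sup>2 p\<^sup>m) ^ 2 ^ m\<close>.
\<close>

lemma ex_less_if_quadratic_recursion:
  fixes x :: "nat \<Rightarrow> real"
  assumes p: "0 < p" "p < 1" and \<kappa>: "0 < \<kappa>" and E: "0 < E" and nonneg: "\<And>m. 0 \<le> x m"
    and rec: "\<And>m. \<kappa> \<le> x m \<Longrightarrow> x (Suc m) \<le> E * (x m)\<^sup>2 * p ^ 2 ^ m"
  shows "\<exists>m. x m < \<kappa>"
proof (rule ccontr)
  assume "\<not> ?thesis"
  then have ge: "\<kappa> \<le> x m" for m by (meson not_le)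
  \<comment> \<open>Scaling by \<open>E\<close> removes the constant from the recursion.\<close>
  define z where "z m = E * x m" for m
  have z0: "0 \<le> z m" for m using E nonneg by (simp add: z_def)
  have zrec: "z (Suc m) \<le> (z m)\<^sup>2 * p ^ 2 ^ m" for m
    using mult_left_mono[OF rec[OF ge[of m]], of E] E by (simp add: z_def power2_eq_square mult_ac)
  \<comment> \<open>The recursion alone leads to p to the power m 2^(m-1). Squaring makes this
    (p^m)^(2^m), so that everything sits under one exponent.\<close>
  have bound: "(z m)\<^sup>2 \<le> ((z 0)\<^sup>2 * p ^ m) ^ 2 ^ m" for m
  proof (induction m)
    case (Suc m)
    let ?r = "(z 0)\<^sup>2 * p ^ m"
    have "(z (Suc m))\<^sup>2 \<le> ((z m)\<^sup>2 * p ^ 2 ^ m)\<^sup>2"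
      using zrec z0 by (intro power_mono) auto
    also have "\<dots> \<le> (?r ^ 2 ^ m * p ^ 2 ^ m)\<^sup>2"
      using Suc p by (intro power_mono mult_right_mono) auto
    also have "\<dots> = ((z 0)\<^sup>2 * p ^ Suc m) ^ 2 ^ Suc m"
      by (simp add: power_mult_distrib[symmetric] power_mult[symmetric] mult_ac)
    finally show ?case .
  qed simp
  \<comment> \<open>Below 1, so that powers of r do not exceed r; below (E \<kappa>)^2, so that they
    contradict x m \<ge> \<kappa>.\<close>
  define r where "r = min (1/2) ((E * \<kappa>)\<^sup>2 / 2)"
  have r: "0 < r" "r < 1" "r < (E * \<kappa>)\<^sup>2" using E \<kappa> by (auto simp: r_def min_def)
  have "(\<lambda>m. (z 0)\<^sup>2 * p ^ m) \<longlonglongrightarrow> 0"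
    using p by (intro tendsto_mult_right_zero LIMSEQ_realpow_zero) auto
  from order_tendstoD(2)[OF this r(1)] obtain m where m: "(z 0)\<^sup>2 * p ^ m < r"
    by (auto simp: eventually_sequentially)
  have "(E * \<kappa>)\<^sup>2 \<le> (z m)\<^sup>2"
    using ge[of m] E \<kappa> by (intro power_mono) (auto simp: z_def)
  also have "\<dots> \<le> ((z 0)\<^sup>2 * p ^ m) ^ 2 ^ m" by (rule bound)
  also have "\<dots> \<le> r ^ 2 ^ m" using m p by (intro power_mono) auto
  also have "\<dots> \<le> r ^ 1" using r by (intro power_decreasing) auto
  finally show False using r(3) by simp
qed

text \<open>\<theta> is the share of the decay given up in the interpolation: W to the power
  \<theta> - 1 must still have uniformly bounded row sums. \<open>quasi_triangle\<close> lets the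
  weight of a product rest on one factor at a time.\<close>

locale interpolation_weight = decay_weight X W K
  for X :: "'i set" and W :: "'i \<Rightarrow> 'i \<Rightarrow> real" and K :: real +
  fixes \<theta> c S :: real
  assumes \<theta>: "0 < \<theta>" "\<theta> < 1"
    and S_pos: "0 < S"
    and quasi_triangle: "W k l \<le> c * (W k n + W n l)"
    and sum_powr_W_le: "\<lbrakk>k \<in> X; finite F; F \<subseteq> X\<rbrakk> \<Longrightarrow> (\<Sum>n\<in>F. W k n powr (\<theta> - 1)) \<le> S"
begin

lemma c_pos: "0 < c"
  using quasi_triangle[of undefined undefined undefined] by (simp add: W_refl)

text \<open>Each entry norm is split into its powers 1 - \<theta> and \<theta>. The first is
  estimated by the decay, the second by the uniform bound \<open>b\<close>.\<close>

lemma finite_row_sum_le: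
  assumes A: "A \<in> weighted_matrices X W" and k: "k \<in> X" and F: "finite F" "F \<subseteq> X"
    and b: "\<And>k l. norm (A k l) \<le> b"
  shows "(\<Sum>n\<in>F. norm (A k n)) \<le> S * (weighted_norm W A powr (1 - \<theta>) * b powr \<theta>)"
proof -
  let ?a = "weighted_norm W A"
  have b0: "0 \<le> b" using b[of k k] norm_ge_zero order_trans by blast
  have "norm (A k n) \<le> W k n powr (\<theta> - 1) * (?a powr (1 - \<theta>) * b powr \<theta>)" for n
  proof -
    have "norm (A k n) = norm (A k n) powr (1 - \<theta>) * norm (A k n) powr \<theta>"
      by (simp flip: powr_add)
    also have "\<dots> \<le> (?a / W k n) powr (1 - \<theta>) * b powr \<theta>"
      using \<theta> b norm_entry_le(1)[OF A, of k n]
      by (intro mult_mono powr_mono2) auto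
    also have "(?a / W k n) powr (1 - \<theta>) = ?a powr (1 - \<theta>) * W k n powr (\<theta> - 1)"
      using weighted_norm_nonneg[OF A] W_pos[of k n] powr_minus[of "W k n" "1 - \<theta>"]
      by (simp add: powr_divide field_simps)
    finally show ?thesis by (simp add: mult_ac)
  qed
  then have "(\<Sum>n\<in>F. norm (A k n)) \<le> (\<Sum>n\<in>F. W k n powr (\<theta> - 1) * (?a powr (1 - \<theta>) * b powr \<theta>))"
    by (rule sum_mono)
  also have "\<dots> = (\<Sum>n\<in>F. W k n powr (\<theta> - 1)) * (?a powr (1 - \<theta>) * b powr \<theta>)"
    by (rule sum_distrib_right[symmetric])
  also have "\<dots> \<le> S * (?a powr (1 - \<theta>) * b powr \<theta>)"
    by (intro mult_right_mono sum_powr_W_le k F) simp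
  finally show ?thesis .
qed

text \<open>By the quasi-triangle inequality W(k,l) is charged to one of the two factors, which is
  then at most the weighted norm; the other factor is summed along a row or a column by
  interpolation. The two cases give the factor 2. The total degree in the weighted norm is 2 -
  \<theta>, strictly below 2.\<close>

lemma weighted_norm_square_le:
  assumes A: "A \<in> weighted_matrices X W" and b: "\<And>k l. norm (A k l) \<le> b"
  shows "weighted_norm W (matrix_mult X A A)
    \<le> 2 * c * S * weighted_norm W A * (weighted_norm W A powr (1 - \<theta>) * b powr \<theta>)"
proof -
  define a where "a = weighted_norm W A"
  define T where "T = S * (a powr (1 - \<theta>) * b powr \<theta>)"
  have a0: "0 \<le> a" unfolding a_def by (rule weighted_norm_nonneg[OF A])
  have T0: "0 \<le> T" using S_pos by (simp add: T_def)
  have entry: "norm (matrix_mult X A A k l) * W k l \<le> 2 * c * a * T" if kl: "k \<in> X" "l \<in> X" for k l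
  proof -
    have abs: "(\<lambda>n. norm (A k n o\<^sub>L A n l)) summable_on X"
      by (rule matrix_mult_abs_summable[where c=b]) (use A kl b in auto)
    have "norm (matrix_mult X A A k l) \<le> (\<Sum>\<^sub>\<infinity>n\<in>X. norm (A k n o\<^sub>L A n l))"
      unfolding matrix_mult_def by (rule norm_infsum_bound[OF abs])
    also have "\<dots> \<le> 2 * c * a * T / W k l"
    proof (rule infsum_le_finite_sums[OF abs])
      fix F assume F: "finite F" "F \<subseteq> X"
      have "(\<Sum>n\<in>F. norm (A k n o\<^sub>L A n l)) * W k l \<le> (\<Sum>n\<in>F. c * a * (norm (A k n) + norm (A n l)))"
        unfolding sum_distrib_right
      proof (rule sum_mono)
        fix n
        have "norm (A k n o\<^sub>L A n l) * W k l
            \<le> (norm (A k n) * norm (A n l)) * (c * (W k n + W n l))"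
          by (intro mult_mono norm_blinfun_compose quasi_triangle mult_nonneg_nonneg less_imp_le[OF W_pos]) auto
        also have "\<dots> = c * ((norm (A k n) * W k n) * norm (A n l) + (norm (A n l) * W n l) * norm (A k n))"
          by (simp add: algebra_simps)
        also have "\<dots> \<le> c * (a * norm (A n l) + a * norm (A k n))"
          unfolding a_def using c_pos
          by (intro mult_left_mono add_mono mult_right_mono weighted_entry_le[OF A]) auto
        finally show "norm (A k n o\<^sub>L A n l) * W k l \<le> c * a * (norm (A k n) + norm (A n l))"
          by (simp add: algebra_simps)
      qed
      also have "\<dots> = c * a * ((\<Sum>n\<in>F. norm (A k n)) + (\<Sum>n\<in>F. norm (A n l)))"
        by (simp add: sum.distrib sum_distrib_left[symmetric])
      also have "\<dots> \<le> c * a * (T + T)"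
      proof (intro mult_left_mono add_mono)
        show "(\<Sum>n\<in>F. norm (A k n)) \<le> T"
          unfolding T_def a_def by (rule finite_row_sum_le[OF A kl(1) F b])
        have "norm (adj_matrix A l n) = norm (A n l)" for n l
          using op_matricesD(1)[OF weighted_matrices_op[OF A]] by (simp add: adj_matrix_def norm_adj_op)
        then show "(\<Sum>n\<in>F. norm (A n l)) \<le> T"
          using finite_row_sum_le[OF adj_matrix_weighted(1)[OF A] kl(2) F, of b] b
          by (simp add: T_def a_def adj_matrix_weighted(2)[OF A])
      qed (use c_pos a0 in simp)
      finally show "(\<Sum>n\<in>F. norm (A k n o\<^sub>L A n l)) \<le> 2 * c * a * T / W k l"
        using W_pos[of k l] by (simp add: pos_le_divide_eq)
    qed
    finally show ?thesis using W_pos[of k l] by (simp add: pos_le_divide_eq)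
  qed
  have "weighted_norm W (matrix_mult X A A) \<le> 2 * c * a * T"
    by (rule weighted_matricesI(2)[OF weighted_matrices_op[OF matrix_mult_weighted(1)[OF A A]] entry])
      (use c_pos a0 T0 in simp_all)
  then show ?thesis by (simp add: a_def T_def mult_ac)
qed

text \<open>\<open>Q m\<close> is R to the power 2^m, with operator bound q^(2^m). The gain
  (q^(2^m))^\<theta> in each squaring eventually beats the quadratic growth of the weighted
  norms.\<close>

lemma one_minus_Units_if_contraction:
  assumes R: "R \<in> weighted_matrices X W" and q: "0 < q" "q < 1"
    and le: "\<And>f. f \<in> ell2 X \<Longrightarrow> ell2_norm X (matrix_op X R f) \<le> q * ell2_norm X f"
  shows "\<one>\<^bsub>weighted_algebra\<^esub> \<ominus>\<^bsub>weighted_algebra\<^esub> R \<in> Units weighted_algebra"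
proof -
  interpret M: banach_star_algebra weighted_algebra by (rule banach_star_algebra_weighted_algebra)
  define Q where "Q m = ((\<lambda>A. matrix_mult X A A) ^^ m) R" for m
  have Q_Suc: "Q (Suc m) = matrix_mult X (Q m) (Q m)" for m by (simp add: Q_def)
  have Q: "Q m \<in> weighted_matrices X W" for m
    by (induction m) (simp_all add: Q_def R matrix_mult_weighted)
  have Q_le: "ell2_norm X (matrix_op X (Q m) f) \<le> q ^ 2 ^ m * ell2_norm X f" if "f \<in> ell2 X" for m f
    using that
  proof (induction m arbitrary: f)
    case 0
    then show ?case using le by (simp add: Q_def)
  next
    case (Suc m)
    have "ell2_norm X (matrix_op X (Q (Suc m)) f) = ell2_norm X (matrix_op X (Q m) (matrix_op X (Q m) f))"
      by (simp add: Q_Suc matrix_op_mult Q Suc.prems)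
    also have "\<dots> \<le> q ^ 2 ^ m * ell2_norm X (matrix_op X (Q m) f)"
      by (rule Suc.IH[OF matrix_op_ell2(1)[OF Q Suc.prems]])
    also have "\<dots> \<le> q ^ 2 ^ m * (q ^ 2 ^ m * ell2_norm X f)"
      using q by (intro mult_left_mono Suc) auto
    finally show ?case by (simp add: power_add[symmetric] mult_2 mult.assoc[symmetric])
  qed
  have entries: "norm (Q m k l) \<le> q ^ 2 ^ m" for m k l
    by (rule norm_entry_le_if_op_bounded[OF Q _ Q_le]) (use q in auto)
  define x where "x m = weighted_norm W (Q m)" for m
  \<comment> \<open>Below this threshold the algebra norm, K times the weighted norm, is less than
    1.\<close>
  define \<kappa> where "\<kappa> = 1 / K"
  \<comment> \<open>The bound of degree 2 - \<theta> is turned into a quadratic one: as long as x m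
    \<ge> \<kappa>, the factor \<open>x m powr (- \<theta>)\<close> is at most
    \<open>\<kappa> powr (- \<theta>)\<close>.\<close>
  define E where "E = 2 * c * S * \<kappa> powr (- \<theta>)"
  have \<kappa>: "0 < \<kappa>" using K_pos by (simp add: \<kappa>_def)
  have "\<exists>m. x m < \<kappa>"
  proof (rule ex_less_if_quadratic_recursion)
    show "0 < q powr \<theta>" "q powr \<theta> < 1"
      using q \<theta> powr_less_mono2[of \<theta> q 1] by auto
    show "0 < E" using c_pos S_pos \<kappa> by (simp add: E_def)
    show "0 \<le> x m" for m unfolding x_def by (rule weighted_norm_nonneg[OF Q])
    show "x (Suc m) \<le> E * (x m)\<^sup>2 * (q powr \<theta>) ^ 2 ^ m" if ge: "\<kappa> \<le> x m" for m
    proof -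
      have xm: "0 < x m" using ge \<kappa> by simp
      have pw: "(q ^ 2 ^ m) powr \<theta> = (q powr \<theta>) ^ 2 ^ m"
        using q by (simp add: powr_power powr_realpow[symmetric] powr_powr mult.commute)
      have "x (Suc m) \<le> 2 * c * S * x m * (x m powr (1 - \<theta>) * (q ^ 2 ^ m) powr \<theta>)"
        unfolding x_def Q_Suc by (rule weighted_norm_square_le[OF Q entries])
      also have "x m powr (1 - \<theta>) = x m * x m powr (- \<theta>)"
        using xm powr_add[of "x m" 1 "- \<theta>"] by simp
      also have "2 * c * S * x m * (x m * x m powr (- \<theta>) * (q ^ 2 ^ m) powr \<theta>)
          = 2 * c * S * (x m)\<^sup>2 * (q ^ 2 ^ m) powr \<theta> * x m powr (- \<theta>)"
        by (simp add: power2_eq_square mult_ac)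
      also have "\<dots> \<le> 2 * c * S * (x m)\<^sup>2 * (q ^ 2 ^ m) powr \<theta> * \<kappa> powr (- \<theta>)"
        using ge \<kappa> \<theta> c_pos S_pos
        by (intro mult_left_mono powr_mono2') auto
      finally show ?thesis by (simp add: pw E_def mult_ac)
    qed
  qed (fact \<kappa>)
  then obtain m where m: "x m < \<kappa>" by blast
  have "\<one>\<^bsub>weighted_algebra\<^esub> \<ominus>\<^bsub>weighted_algebra\<^esub> Q m \<in> Units weighted_algebra"
  proof (rule M.one_minus_Units_if_nrm_less_1; unfold weighted_algebra_simps)
    show "K * weighted_norm W (Q m) < 1"
      using m K_pos by (simp add: x_def \<kappa>_def field_simps)
  qed (rule Q)
  \<comment> \<open>Invertibility descends from exponent 2^(m+1) to 2^m, and so down to R.\<close>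
  moreover have "\<one>\<^bsub>weighted_algebra\<^esub> \<ominus>\<^bsub>weighted_algebra\<^esub> Q m \<in> Units weighted_algebra"
    if "\<one>\<^bsub>weighted_algebra\<^esub> \<ominus>\<^bsub>weighted_algebra\<^esub> Q (Suc m) \<in> Units weighted_algebra" for m
    by (rule M.one_minus_Units_if_square) (use that Q in \<open>simp_all only: weighted_algebra_simps Q_Suc\<close>)
  ultimately have "\<one>\<^bsub>weighted_algebra\<^esub> \<ominus>\<^bsub>weighted_algebra\<^esub> Q 0 \<in> Units weighted_algebra"
    by (induction m) auto
  then show ?thesis by (simp add: Q_def)
qed

end

section \<open>Matrices bounded below and the inversion of A* A\<close>

context decay_weight
begin

definition bounded_below :: "('i, 'h::complex_hilbert) op_matrix \<Rightarrow> bool" where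
  "bounded_below A \<longleftrightarrow> (\<exists>\<delta>>0. \<forall>f\<in>ell2 X. \<delta> * ell2_norm X f \<le> ell2_norm X (matrix_op X A f))"

lemma ell2_inner_adj_mult:
  assumes A: "A \<in> weighted_matrices X W" and f: "f \<in> ell2 X"
  shows "ell2_inner X f (matrix_op X (matrix_mult X (adj_matrix A) A) f)
      = of_real ((ell2_norm X (matrix_op X A f))\<^sup>2)"
    and "ell2_inner X (matrix_op X (matrix_mult X (adj_matrix A) A) f) f
      = of_real ((ell2_norm X (matrix_op X A f))\<^sup>2)"
proof -
  note Af = matrix_op_ell2(1)[OF A f] and A' = adj_matrix_weighted(1)[OF A]
  show "ell2_inner X f (matrix_op X (matrix_mult X (adj_matrix A) A) f)
      = of_real ((ell2_norm X (matrix_op X A f))\<^sup>2)"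
    unfolding matrix_op_mult[OF A' A f] ell2_inner_matrix_op[OF A f Af, symmetric]
    by (rule ell2_inner_self[OF Af])
  show "ell2_inner X (matrix_op X (matrix_mult X (adj_matrix A) A) f) f
      = of_real ((ell2_norm X (matrix_op X A f))\<^sup>2)"
    unfolding matrix_op_mult[OF A' A f] ell2_inner_matrix_op[OF A' Af f]
      adj_matrix_adj_matrix[OF weighted_matrices_op[OF A]]
    by (rule ell2_inner_self[OF Af])
qed

lemma UnitsI_matrix:
  assumes "G \<in> weighted_matrices X W" "A \<in> weighted_matrices X W"
    and "matrix_mult X G A = one_matrix X" "matrix_mult X A G = one_matrix X"
  shows "A \<in> Units weighted_algebra"
  unfolding Units_def weighted_algebra_simps using assms by blast

lemma UnitsE_matrix:
  assumes "A \<in> Units weighted_algebra"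
  obtains G where "G \<in> weighted_matrices X W" "A \<in> weighted_matrices X W"
    "matrix_mult X G A = one_matrix X" "matrix_mult X A G = one_matrix X"
  using assms unfolding Units_def weighted_algebra_simps by blast

end

context interpolation_weight
begin

text \<open>
  For small \<open>t > 0\<close> the operator \<open>1 - t A\<^sup>* A\<close> is a strict contraction, because \<open>A\<^sup>* A\<close> is
  bounded and bounded below.
\<close>

lemma adj_mult_Units_if_bounded_below:
  assumes A: "A \<in> weighted_matrices X W" and "bounded_below A"
  shows "matrix_mult X (adj_matrix A) A \<in> Units weighted_algebra"
proof -
  obtain \<delta> where \<delta>: "0 < \<delta>"
    "\<And>f. f \<in> ell2 X \<Longrightarrow> \<delta> * ell2_norm X f \<le> ell2_norm X (matrix_op X A f)"
    using assms(2) unfolding bounded_below_def by blast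
  define P where "P = matrix_mult X (adj_matrix A) A"
  have P: "P \<in> weighted_matrices X W"
    unfolding P_def by (intro matrix_mult_weighted adj_matrix_weighted A)
  \<comment> \<open>A bound for the operator A* A. The first entry of the maximum makes B positive
    and \<delta>^4 / B^2 at most 1/4, so that \<open>Q\<close> is not only below 1 but also
    positive.\<close>
  define B where "B = max (2 * \<delta>\<^sup>2) (K * weighted_norm W P)"
  have B0: "0 < B" using \<delta> by (simp add: B_def less_max_iff_disj)
  have B: "ell2_norm X (matrix_op X P f) \<le> B * ell2_norm X f" if "f \<in> ell2 X" for f
    using matrix_op_ell2(2)[OF P that] mult_right_mono[OF _ ell2_norm_nonneg[of X f], of "K * weighted_norm W P" B]
    by (simp add: B_def)
  \<comment> \<open>This t minimizes t^2 B^2 - 2 t \<delta>^2 + 1, and \<open>Q\<close> is the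
    minimum.\<close>
  define t where "t = \<delta>\<^sup>2 / B\<^sup>2"
  have t0: "0 < t" using \<delta> B0 by (simp add: t_def)
  define Q where "Q = 1 - \<delta>\<^sup>2 * \<delta>\<^sup>2 / B\<^sup>2"
  have "2 * \<delta>\<^sup>2 \<le> B" by (simp add: B_def)
  then have "(2 * \<delta>\<^sup>2)\<^sup>2 \<le> B\<^sup>2" by (rule power_mono) simp
  then have "\<delta>\<^sup>2 * \<delta>\<^sup>2 * 4 \<le> B\<^sup>2" by (simp add: power2_eq_square algebra_simps)
  moreover have "0 < \<delta>\<^sup>2 * \<delta>\<^sup>2" using \<delta> by simp
  ultimately have "\<delta>\<^sup>2 * \<delta>\<^sup>2 < B\<^sup>2" by linarith
  then have Q: "0 < Q" "Q < 1" using \<delta> B0 by (simp_all add: Q_def)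
  let ?R = "\<lambda>k l. one_matrix X k l - scale_matrix (of_real t) P k l"
  have tP: "scale_matrix (of_real t) P \<in> weighted_matrices X W" by (rule scale_matrix_weighted(1)[OF P])
  have R: "?R \<in> weighted_matrices X W" by (intro weighted_diff one_matrix_weighted tP)
  have "ell2_norm X (matrix_op X ?R f) \<le> sqrt Q * ell2_norm X f" if f: "f \<in> ell2 X" for f
  proof -
    have op: "matrix_op X ?R f = (\<lambda>k. f k - of_real t *\<^sub>C matrix_op X P f k)"
      by (simp only: matrix_op_diff[OF one_matrix_weighted tP f] matrix_op_one[OF f] matrix_op_scale[OF P f])
    have "ell2_norm X (matrix_op X ?R f) = ell2_norm X (\<lambda>k. of_real t *\<^sub>C matrix_op X P f k - f k)"
      by (simp add: op ell2_norm_def norm_minus_commute)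
    then have eq: "(ell2_norm X (matrix_op X ?R f))\<^sup>2
        = t\<^sup>2 * (ell2_norm X (matrix_op X P f))\<^sup>2 - 2 * t * (ell2_norm X (matrix_op X A f))\<^sup>2 + (ell2_norm X f)\<^sup>2"
      using ell2_norm_scale_minus_sq[OF matrix_op_ell2(1)[OF P f] f, of "of_real t"]
        ell2_inner_adj_mult(2)[OF A f, folded P_def] by simp
    have 1: "t\<^sup>2 * (ell2_norm X (matrix_op X P f))\<^sup>2 \<le> t\<^sup>2 * (B * ell2_norm X f)\<^sup>2"
      by (intro mult_left_mono power_mono B f ell2_norm_nonneg) simp
    have 2: "2 * t * (\<delta> * ell2_norm X f)\<^sup>2 \<le> 2 * t * (ell2_norm X (matrix_op X A f))\<^sup>2"
      using t0 \<delta> by (intro mult_left_mono power_mono \<delta>(2) f) (auto simp: ell2_norm_nonneg)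
    have "t\<^sup>2 * (B * ell2_norm X f)\<^sup>2 - 2 * t * (\<delta> * ell2_norm X f)\<^sup>2 + (ell2_norm X f)\<^sup>2
        = Q * (ell2_norm X f)\<^sup>2"
      using B0 by (simp add: t_def Q_def field_simps power2_eq_square)
    then have "(ell2_norm X (matrix_op X ?R f))\<^sup>2 \<le> Q * (ell2_norm X f)\<^sup>2"
      using eq 1 2 by linarith
    also have "\<dots> = (sqrt Q * ell2_norm X f)\<^sup>2" using Q by (simp add: power_mult_distrib)
    finally show ?thesis
      by (rule power2_le_imp_le) (use Q in \<open>simp add: ell2_norm_nonneg\<close>)
  qed
  from one_minus_Units_if_contraction[OF R _ _ this]
  have "\<one>\<^bsub>weighted_algebra\<^esub> \<ominus>\<^bsub>weighted_algebra\<^esub> ?R \<in> Units weighted_algebra"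
    using Q by simp
  also have "\<one>\<^bsub>weighted_algebra\<^esub> \<ominus>\<^bsub>weighted_algebra\<^esub> ?R = scale_matrix (of_real t) P"
    unfolding weighted_algebra_simps weighted_algebra_minus[OF one_matrix_weighted R] by simp
  finally obtain G where G: "G \<in> weighted_matrices X W"
    "matrix_mult X G (scale_matrix (of_real t) P) = one_matrix X"
    "matrix_mult X (scale_matrix (of_real t) P) G = one_matrix X"
    by (rule UnitsE_matrix)
  have "P \<in> Units weighted_algebra"
    by (rule UnitsI_matrix[OF scale_matrix_weighted(1)[OF G(1), of "of_real t"] P])
      (use G in \<open>simp_all add: matrix_mult_scale P\<close>)
  then show ?thesis by (simp add: P_def)
qed

end

section \<open>Inverse-closedness, symmetry and the Leibniz rule\<close>

context decay_weight
begin

text \<open>The left inverse is (A* A)^-1 A*, as in a least-squares problem.\<close>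

lemma left_inverse_if_adj_mult_Units:
  assumes A: "A \<in> weighted_matrices X W" and "matrix_mult X (adj_matrix A) A \<in> Units weighted_algebra"
  obtains L where "L \<in> weighted_matrices X W" "matrix_mult X L A = one_matrix X"
proof -
  obtain G where G: "G \<in> weighted_matrices X W"
    "matrix_mult X G (matrix_mult X (adj_matrix A) A) = one_matrix X"
    using UnitsE_matrix[OF assms(2)] by metis
  have "matrix_mult X (matrix_mult X G (adj_matrix A)) A = one_matrix X"
    using G matrix_mult_assoc[OF G(1) adj_matrix_weighted(1)[OF A] A] by simp
  then show ?thesis
    using that matrix_mult_weighted(1)[OF G(1) adj_matrix_weighted(1)[OF A]] by blast
qed

text \<open>\<open>H\<close> isolates the analytic input, which is proved for a general \<alpha>
  only in the final theorem. An invertible operator is bounded below by the reciprocal of a bound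
  for its inverse, so \<open>H\<close> yields a left inverse L in the class. In
  \<open>B_ell2\<close> a left inverse of a unit is its inverse, so the operator of L is the inverse
  sought.\<close>

lemma inverse_closed_weighted_algebra:
  assumes H: "\<And>A :: ('i, 'h::complex_hilbert) op_matrix. A \<in> weighted_matrices X W \<Longrightarrow> bounded_below A \<Longrightarrow>
    matrix_mult X (adj_matrix A) A \<in> Units weighted_algebra"
  shows "inverse_closed_via (matrix_op X) weighted_algebra
    (B_ell2 X :: (('i \<Rightarrow> 'h) \<Rightarrow> ('i \<Rightarrow> 'h)) star_algebra)"
  unfolding inverse_closed_via_def
proof (intro conjI ballI impI)
  show "matrix_op X \<in> star_hom weighted_algebra (B_ell2 X :: (('i \<Rightarrow> 'h) \<Rightarrow> ('i \<Rightarrow> 'h)) star_algebra)"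
    by (rule matrix_op_star_hom)
  show "inj_on (matrix_op X) (carrier weighted_algebra :: ('i, 'h) op_matrix set)"
    unfolding weighted_algebra_simps by (rule inj_on_matrix_op)
  fix A :: "('i, 'h) op_matrix"
  assume "A \<in> carrier weighted_algebra" and U: "matrix_op X A \<in> Units (B_ell2 X)"
  then have A: "A \<in> weighted_matrices X W" by (simp only: weighted_algebra_simps)
  interpret B: monoid "B_ell2 X :: (('i \<Rightarrow> 'h) \<Rightarrow> ('i \<Rightarrow> 'h)) star_algebra" by (rule monoid_B_ell2)
  let ?T = "inv\<^bsub>B_ell2 X\<^esub> (matrix_op X A)"
  have T: "?T \<in> bounded_ell2_ops X" using B.Units_inv_closed[OF U] by (simp add: B_ell2_def)
  have TA: "?T (matrix_op X A f) = f" if f: "f \<in> ell2 X" for f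
    using fun_cong[OF B.Units_l_inv[OF U], of f] f by (simp add: B_ell2_def compose_def)
  obtain C where C: "0 < C" "\<forall>f\<in>ell2 X. ell2_norm X (?T f) \<le> C * ell2_norm X f"
    using bounded_ell2_opsD(3)[OF T] by blast
  have "bounded_below A"
    unfolding bounded_below_def
  proof (intro exI[of _ "1 / C"] conjI ballI)
    fix f :: "'i \<Rightarrow> 'h" assume f: "f \<in> ell2 X"
    have "ell2_norm X f \<le> C * ell2_norm X (matrix_op X A f)"
      using C(2) matrix_op_ell2(1)[OF A f] TA[OF f] by metis
    then show "1 / C * ell2_norm X f \<le> ell2_norm X (matrix_op X A f)"
      using C(1) by (simp add: field_simps)
  qed (use C in simp)
  from left_inverse_if_adj_mult_Units[OF A H[OF A this]]
  obtain L where L: "L \<in> weighted_matrices X W" "matrix_mult X L A = one_matrix X" .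
  have hom: "matrix_op X \<in> ring_hom weighted_algebra (B_ell2 X :: (('i \<Rightarrow> 'h) \<Rightarrow> ('i \<Rightarrow> 'h)) star_algebra)"
    using matrix_op_star_hom by (auto simp: star_hom_def)
  have LA: "matrix_op X L \<otimes>\<^bsub>B_ell2 X\<^esub> matrix_op X A = \<one>\<^bsub>B_ell2 X\<^esub>"
    using ring_hom_mult[OF hom, of L A] ring_hom_one[OF hom] L A
    unfolding weighted_algebra_simps by simp
  have "matrix_op X L \<in> carrier (B_ell2 X)"
    using matrix_op_bounded[OF L(1)] by (simp add: B_ell2_def)
  from B.inv_unique[OF LA B.Units_r_inv[OF U] B.Units_closed[OF U] this B.Units_inv_closed[OF U]]
  show "?T \<in> matrix_op X ` carrier weighted_algebra"
    unfolding weighted_algebra_simps using L(1) by (metis imageI)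
qed

text \<open>As A* A is positive, the lower bound is the distance from z to the half-line [0,
  infinity); this is \<delta>.\<close>

lemma bounded_below_scalar_minus_adj_mult:
  assumes A: "A \<in> weighted_matrices X W" and z: "z \<notin> \<real>\<^sub>\<ge>\<^sub>0"
  shows "bounded_below (\<lambda>k l. scale_matrix z (one_matrix X) k l - matrix_mult X (adj_matrix A) A k l)"
proof -
  let ?P = "matrix_mult X (adj_matrix A) A"
  let ?D = "\<lambda>k l. scale_matrix z (one_matrix X) k l - ?P k l"
  have P: "?P \<in> weighted_matrices X W" by (intro matrix_mult_weighted adj_matrix_weighted A)
  define \<delta> where "\<delta> = (if Re z \<le> 0 then cmod z else \<bar>Im z\<bar>)"
  have \<delta>0: "0 < \<delta>" using z by (auto simp: \<delta>_def complex_nonneg_Reals_iff)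
  have "\<delta> * ell2_norm X f \<le> ell2_norm X (matrix_op X ?D f)" if f: "f \<in> ell2 X" for f
  proof -
    note Pf = matrix_op_ell2(1)[OF P f] and one = scale_matrix_weighted(1)[OF one_matrix_weighted]
    have op: "matrix_op X ?D f = (\<lambda>k. z *\<^sub>C f k - matrix_op X ?P f k)"
      by (simp only: matrix_op_diff[OF one P f] matrix_op_scale[OF one_matrix_weighted f] matrix_op_one[OF f])
    let ?n = "ell2_norm X f" and ?a = "ell2_norm X (matrix_op X A f)" and ?p = "ell2_norm X (matrix_op X ?P f)"
    have eq: "(ell2_norm X (\<lambda>k. w *\<^sub>C f k - matrix_op X ?P f k))\<^sup>2 = (cmod w)\<^sup>2 * ?n\<^sup>2 - 2 * Re w * ?a\<^sup>2 + ?p\<^sup>2" for w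
      using ell2_norm_scale_minus_sq[OF f Pf, of w] ell2_inner_adj_mult(1)[OF A f] by simp
    have "(\<delta> * ?n)\<^sup>2 \<le> (ell2_norm X (matrix_op X ?D f))\<^sup>2"
    proof (cases "Re z \<le> 0")
      case True
      have "2 * Re z * ?a\<^sup>2 \<le> 0" using True by (simp add: mult_nonpos_nonneg)
      then have "2 * Re z * ?a\<^sup>2 \<le> ?p\<^sup>2" using zero_le_power2 by (rule order_trans)
      then show ?thesis unfolding op eq using True by (simp add: \<delta>_def power_mult_distrib)
    next
      case False
      \<comment> \<open>The expansion at the real number Re z is a square. Passing from Re z to z
        adds exactly (Im z)^2 times the squared norm of f.\<close>
      have "0 \<le> (cmod (of_real (Re z)))\<^sup>2 * ?n\<^sup>2 - 2 * Re (of_real (Re z)) * ?a\<^sup>2 + ?p\<^sup>2"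
        unfolding eq[symmetric] by simp
      moreover have "(cmod z)\<^sup>2 * ?n\<^sup>2 = (Re z)\<^sup>2 * ?n\<^sup>2 + (Im z)\<^sup>2 * ?n\<^sup>2"
        by (simp add: cmod_power2 distrib_right)
      ultimately show ?thesis unfolding op eq using False by (simp add: \<delta>_def power_mult_distrib)
    qed
    then show ?thesis by (rule power2_le_imp_le[OF _ ell2_norm_nonneg])
  qed
  then show ?thesis unfolding bounded_below_def using \<delta>0 by blast
qed

text \<open>Boundedness below gives z - A* A a left inverse only. It is also the adjoint of cnj z -
  A* A, and cnj z lies off the half-line too; the adjoint of a left inverse there is a right inverse
  here.\<close>

lemma symmetric_weighted_algebra:
  assumes H: "\<And>A :: ('i, 'h::complex_hilbert) op_matrix. A \<in> weighted_matrices X W \<Longrightarrow> bounded_below A \<Longrightarrow>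
    matrix_mult X (adj_matrix A) A \<in> Units weighted_algebra"
  shows "symmetric_algebra (weighted_algebra :: ('i, 'h) op_matrix star_algebra)"
  unfolding symmetric_algebra_def
proof (intro ballI subsetI)
  fix A :: "('i, 'h) op_matrix" and z
  assume "A \<in> carrier weighted_algebra"
    and sp: "z \<in> spectrum weighted_algebra (star weighted_algebra A \<otimes>\<^bsub>weighted_algebra\<^esub> A)"
  then have A: "A \<in> weighted_matrices X W" by (simp only: weighted_algebra_simps)
  let ?P = "matrix_mult X (adj_matrix A) A"
  let ?D = "\<lambda>z k l. scale_matrix z (one_matrix X) k l - ?P k l"
  have P: "?P \<in> weighted_matrices X W" by (intro matrix_mult_weighted adj_matrix_weighted A)
  have one: "scale_matrix z (one_matrix X) \<in> (weighted_matrices X W :: ('i, 'h) op_matrix set)" for z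
    by (rule scale_matrix_weighted(1)[OF one_matrix_weighted])
  have D: "?D z \<in> weighted_matrices X W" for z by (intro weighted_diff one P)
  have notin: "?D z \<notin> Units weighted_algebra"
    using sp by (simp only: spectrum_def weighted_algebra_simps weighted_algebra_minus[OF one P] mem_Collect_eq not_False_eq_True)
  show "z \<in> \<real>\<^sub>\<ge>\<^sub>0"
  proof (rule ccontr)
    assume z: "z \<notin> \<real>\<^sub>\<ge>\<^sub>0"
    then have z': "cnj z \<notin> \<real>\<^sub>\<ge>\<^sub>0" by (simp add: complex_nonneg_Reals_iff)
    have adjP: "adj_matrix ?P = ?P"
      using adj_matrix_mult[OF adj_matrix_weighted(1)[OF A] A]
        adj_matrix_adj_matrix[OF weighted_matrices_op[OF A]] by simp
    have "adj_matrix (?D (cnj z)) k l = ?D z k l" for k l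
    proof -
      have cl: "clinear_op (?P k l)" for k l by (rule op_matricesD(1)[OF weighted_matrices_op[OF P]])
      have "adj_op (?P l k) = ?P k l"
        using fun_cong[OF fun_cong[OF adjP], of k l] by (simp only: adj_matrix_def[of ?P])
      moreover have "adj_op (scale_matrix (cnj z) (one_matrix X :: ('i, 'h) op_matrix) l k)
          = scale_matrix z (one_matrix X) k l"
        by (auto simp: scale_matrix_def one_matrix_def adj_op_scale_op)
      moreover have "clinear_op (scale_matrix (cnj z) (one_matrix X :: ('i, 'h) op_matrix) l k)"
        by (rule op_matricesD(1)[OF weighted_matrices_op[OF one]])
      ultimately show ?thesis
        by (simp only: adj_matrix_def[of "?D (cnj z)"] adj_op_diff cl)
    qed
    then have adjD: "adj_matrix (?D (cnj z)) = ?D z" by (intro ext)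
    obtain L where L: "L \<in> weighted_matrices X W" "matrix_mult X L (?D z) = one_matrix X"
      using left_inverse_if_adj_mult_Units[OF D H[OF D bounded_below_scalar_minus_adj_mult[OF A z]]] .
    obtain L' where L': "L' \<in> weighted_matrices X W" "matrix_mult X L' (?D (cnj z)) = one_matrix X"
      using left_inverse_if_adj_mult_Units[OF D H[OF D bounded_below_scalar_minus_adj_mult[OF A z']]] .
    let ?R = "adj_matrix L'"
    have R: "?R \<in> weighted_matrices X W" by (rule adj_matrix_weighted(1)[OF L'(1)])
    have adj_one: "adj_matrix (one_matrix X) = (one_matrix X :: ('i, 'h) op_matrix)"
      by (auto simp: adj_matrix_def one_matrix_def fun_eq_iff)
    have DR: "matrix_mult X (?D z) ?R = one_matrix X"
      using adj_matrix_mult[OF L'(1) D[of "cnj z"]] L'(2) by (simp add: adjD adj_one)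
    have "L = matrix_mult X L (matrix_mult X (?D z) ?R)"
      unfolding DR by (rule one_matrix_mult(2)[OF weighted_matrices_op[OF L(1)], symmetric])
    also have "\<dots> = matrix_mult X (matrix_mult X L (?D z)) ?R"
      by (rule matrix_mult_assoc[OF L(1) D R, symmetric])
    also have "\<dots> = ?R" unfolding L(2) by (rule one_matrix_mult(1)[OF weighted_matrices_op[OF R]])
    finally have "?D z \<in> Units weighted_algebra"
      using UnitsI_matrix[OF R D] L(2) DR by simp
    with notin show False by contradiction
  qed
qed

text \<open>
  With \<open>\<delta> A = ((t k - t l) A\<^sub>k\<^sub>l)\<close>, the Leibniz rule gives \<open>\<delta> G = - G (\<delta> P) G\<close> for \<open>G = P\<^sup>-\<^sup>1\<close>. Only the
  entries of \<open>\<delta> G\<close> are known to be bounded, which suffices for \<open>G (P \<delta>G) = (G P) \<delta>G\<close>.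
\<close>

lemma derivation_inverse:
  fixes t :: "'i \<Rightarrow> real"
  assumes P: "P \<in> weighted_matrices X W" and G: "G \<in> weighted_matrices X W"
    and PG: "matrix_mult X P G = one_matrix X" and GP: "matrix_mult X G P = one_matrix X"
    and dP: "(\<lambda>k l. (t k - t l) *\<^sub>R P k l) \<in> weighted_matrices X W"
    and t: "\<And>k l. \<bar>t k - t l\<bar> \<le> W k l"
  shows "(\<lambda>k l. (t k - t l) *\<^sub>R G k l) =
    scale_matrix (-1) (matrix_mult X G (matrix_mult X (\<lambda>k l. (t k - t l) *\<^sub>R P k l) G))"
proof -
  let ?dP = "\<lambda>k l. (t k - t l) *\<^sub>R P k l" and ?dG = "\<lambda>k l. (t k - t l) *\<^sub>R G k l"
  have dG_op: "?dG \<in> op_matrices X"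
    using op_matricesD[OF weighted_matrices_op[OF G]] by (auto simp: op_matrices_def clinear_op_scaleR)
  \<comment> \<open>One factor W pays for the difference of t, which leaves no decay but a uniform
    bound.\<close>
  have bd: "norm (?dG k l) \<le> weighted_norm W G" for k l
  proof -
    have "norm (?dG k l) \<le> norm (G k l) * W k l"
      using mult_right_mono[OF t[of k l], of "norm (G k l)"] by (simp add: mult.commute)
    then show ?thesis using weighted_entry_le[OF G] by (rule order_trans)
  qed
  have dPG: "matrix_mult X ?dP G \<in> weighted_matrices X W" by (rule matrix_mult_weighted(1)[OF dP G])
  have "matrix_mult X P ?dG n l = scale_matrix (-1) (matrix_mult X ?dP G) n l" for n l
  proof (cases "n \<in> X")
    case n: True
    \<comment> \<open>The derivation kills the identity matrix: off the diagonal its entries vanish,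
      on it t n - t l = 0.\<close>
    have "0 = (t n - t l) *\<^sub>R matrix_mult X P G n l" by (simp add: PG one_matrix_def)
    also have "\<dots> = (\<Sum>\<^sub>\<infinity>m\<in>X. (t n - t l) *\<^sub>R (P n m o\<^sub>L G m l))"
      unfolding matrix_mult_def
      by (intro infsumI[symmetric] has_sum_bounded_linear[OF bounded_linear_scaleR_right] has_sum_infsum
          matrix_mult_summable P G)
    also have "\<dots> = (\<Sum>\<^sub>\<infinity>m\<in>X. (?dP n m o\<^sub>L G m l) + (P n m o\<^sub>L ?dG m l))"
      by (intro infsum_cong blinfun_eqI) (simp add: blinfun.bilinear_simps algebra_simps)
    also have "\<dots> = matrix_mult X ?dP G n l + matrix_mult X P ?dG n l"
      unfolding matrix_mult_def
    proof (rule infsum_add)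
      show "(\<lambda>m. ?dP n m o\<^sub>L G m l) summable_on X" by (rule matrix_mult_summable[OF dP G])
      show "(\<lambda>m. P n m o\<^sub>L ?dG m l) summable_on X"
        by (rule abs_summable_summable)
          (rule matrix_mult_abs_summable[where B="?dG" and c="weighted_norm W G", OF P n bd])
    qed
    finally have "matrix_mult X P ?dG n l = - matrix_mult X ?dP G n l"
      by (simp add: eq_neg_iff_add_eq_0 add.commute)
    then show ?thesis
      by (auto simp: scale_matrix_def blinfun.bilinear_simps scaleC_minus_left intro!: blinfun_eqI)
  next
    case False
    then show ?thesis
      using op_matricesD(2)[OF weighted_matrices_op[OF P]] op_matricesD(2)[OF weighted_matrices_op[OF dPG]]
      by (simp add: matrix_mult_def[of X P] scale_matrix_def)
  qed
  then have PdG: "matrix_mult X P ?dG = scale_matrix (-1) (matrix_mult X ?dP G)" by blast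
  have "?dG = matrix_mult X (matrix_mult X G P) ?dG"
    unfolding GP by (rule one_matrix_mult(1)[OF dG_op, symmetric])
  also have "\<dots> = matrix_mult X G (matrix_mult X P ?dG)"
    by (rule matrix_mult_assoc_bounded[OF G P bd])
  finally show ?thesis unfolding PdG matrix_mult_scale(2)[OF G dPG] .
qed

end

section \<open>Polynomial weights on relatively separated sets\<close>

text \<open>Absolute value is injective on the nonnegative and on the negative integers, so two
  copies of the series over the naturals suffice. The maximum with 1 keeps the base positive at i =
  0 and, by \<open>max_1_floor_le\<close>, still bounds 1 + |y| from below when i is the floor of
  y.\<close>

lemma sum_int_powr_bounded:
  fixes \<tau> :: real
  assumes "\<tau> > 1"
  obtains H where "0 \<le> H" "\<And>I :: int set. finite I \<Longrightarrow> (\<Sum>i\<in>I. max 1 \<bar>real_of_int i\<bar> powr (- \<tau>)) \<le> H"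
proof -
  define g where "g n = max 1 (real n) powr (- \<tau>)" for n :: nat
  have "summable (\<lambda>n. real n powr (- \<tau>))"
    using assms by (simp add: summable_real_powr_iff)
  moreover have "\<forall>\<^sub>F n in sequentially. g n = real n powr (- \<tau>)"
    by (rule eventually_sequentiallyI[of 1]) (simp add: g_def max_def)
  ultimately have sg: "summable g" by (subst summable_cong)
  have g0: "0 \<le> g n" for n by (simp add: g_def)
  have part: "(\<Sum>i\<in>J. max 1 \<bar>real_of_int i\<bar> powr (- \<tau>)) \<le> suminf g"
    if J: "finite J" "inj_on (\<lambda>i. nat \<bar>i\<bar>) J" for J :: "int set"
  proof -
    have "(\<Sum>i\<in>J. max 1 \<bar>real_of_int i\<bar> powr (- \<tau>)) = (\<Sum>i\<in>J. g (nat \<bar>i\<bar>))"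
      by (simp add: g_def)
    also have "\<dots> = sum g ((\<lambda>i. nat \<bar>i\<bar>) ` J)" by (simp add: sum.reindex J)
    also have "\<dots> \<le> suminf g" by (rule sum_le_suminf[OF sg]) (use J g0 in auto)
    finally show ?thesis .
  qed
  show ?thesis
  proof (rule that[of "suminf g + suminf g"])
    show "0 \<le> suminf g + suminf g" using suminf_nonneg[OF sg g0] by simp
    fix I :: "int set" assume I: "finite I"
    have "(\<Sum>i\<in>I. max 1 \<bar>real_of_int i\<bar> powr (- \<tau>)) =
        (\<Sum>i\<in>I \<inter> {0..}. max 1 \<bar>real_of_int i\<bar> powr (- \<tau>)) + (\<Sum>i\<in>I - {0..}. max 1 \<bar>real_of_int i\<bar> powr (- \<tau>))"
      by (rule sum.Int_Diff[OF I])
    also have "\<dots> \<le> suminf g + suminf g"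
      by (intro add_mono part) (use I in \<open>auto intro!: inj_onI\<close>)
    finally show "(\<Sum>i\<in>I. max 1 \<bar>real_of_int i\<bar> powr (- \<tau>)) \<le> suminf g + suminf g" .
  qed
qed

lemma max_1_floor_le: "max 1 \<bar>real_of_int \<lfloor>y\<rfloor>\<bar> \<le> 1 + \<bar>y\<bar>" for y :: real
  by linarith

text \<open>
  By \<open>(1 + \<bar>y\<bar>)\<^sup>-\<^sup>t \<le> (\<Prod>j. (1 + \<bar>y\<^sub>j\<bar>) powr (- t / d))\<close>, the sum over the unit cubes of a grid
  factorizes into one-dimensional sums.
\<close>

lemma relatively_separated_sum_bounded:
  fixes X :: "(real ^ 'd) set"
  assumes X: "relatively_separated X" and t: "t > real CARD('d)"
  obtains S where "0 < S"
    "\<And>x F. finite F \<Longrightarrow> F \<subseteq> X \<Longrightarrow> (\<Sum>n\<in>F. (1 + norm (x - n)) powr (- t)) \<le> S"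
proof -
  obtain N where N: "\<And>x. finite (X \<inter> (+) x ` cbox 0 1) \<and> card (X \<inter> (+) x ` cbox 0 1) \<le> N"
    using X by (auto simp: relatively_separated_def)
  define \<tau> where "\<tau> = t / real CARD('d)"
  have \<tau>: "\<tau> > 1" using t by (simp add: \<tau>_def)
  obtain H where H: "0 \<le> H" "\<And>I :: int set. finite I \<Longrightarrow> (\<Sum>i\<in>I. max 1 \<bar>real_of_int i\<bar> powr (- \<tau>)) \<le> H"
    using sum_int_powr_bounded[OF \<tau>] by blast
  have "(\<Sum>n\<in>F. (1 + norm (x - n)) powr (- t)) \<le> real N * H ^ CARD('d)" if F: "finite F" "F \<subseteq> X" for x F
  proof -
    define z where "z n = (\<lambda>j. \<lfloor>n $ j - x $ j\<rfloor>)" for n :: "real ^ 'd"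
    define \<phi> where "\<phi> v = (\<Prod>j\<in>UNIV. max 1 \<bar>real_of_int (v j)\<bar> powr (- \<tau>))" for v :: "'d \<Rightarrow> int"
    define I where "I j = (\<lambda>v. v j) ` z ` F" for j
    have \<phi>0: "0 \<le> \<phi> v" for v unfolding \<phi>_def by (intro prod_nonneg) simp
    have "(1 + norm (x - n)) powr (- t) \<le> \<phi> (z n)" for n
    proof -
      have "(1 + norm (x - n)) powr (- t) = (\<Prod>j\<in>(UNIV :: 'd set). (1 + norm (x - n)) powr (- \<tau>))"
        using powr_realpow[of "(1 + norm (x - n)) powr (- \<tau>)" "CARD('d)"]
        by (simp add: powr_powr \<tau>_def powr_gt_zero add_nonneg_eq_0_iff)
      also have "\<dots> \<le> \<phi> (z n)"
        unfolding \<phi>_def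
      proof (intro prod_mono conjI powr_mono2')
        fix j :: 'd
        have "\<bar>n $ j - x $ j\<bar> \<le> norm (x - n)"
          using component_le_norm_cart[of "x - n" j] by (simp add: abs_minus_commute)
        then show "max 1 \<bar>real_of_int (z n j)\<bar> \<le> 1 + norm (x - n)"
          unfolding z_def by (rule order_trans[OF max_1_floor_le add_left_mono])
      qed (use \<tau> in auto)
      finally show ?thesis .
    qed
    then have "(\<Sum>n\<in>F. (1 + norm (x - n)) powr (- t)) \<le> (\<Sum>n\<in>F. \<phi> (z n))" by (rule sum_mono)
    also have "\<dots> = (\<Sum>v\<in>z ` F. real (card {n \<in> F. z n = v}) * \<phi> v)"
      by (rule sum_fun_comp) (use F in auto)
    also have "\<dots> \<le> (\<Sum>v\<in>z ` F. real N * \<phi> v)"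
    proof (intro sum_mono mult_right_mono \<phi>0)
      fix v
      \<comment> \<open>The lower corner of the grid cube labelled v. All points with this label lie
        in the closed unit cube at y, so there are at most N of them.\<close>
      define y where "y = x + (\<chi> j. real_of_int (v j))"
      have "{n \<in> F. z n = v} \<subseteq> X \<inter> (+) y ` cbox 0 1"
      proof
        fix n assume n: "n \<in> {n \<in> F. z n = v}"
        have "n - y \<in> cbox 0 1"
          unfolding mem_box_cart
        proof
          fix j
          have "v j = \<lfloor>n $ j - x $ j\<rfloor>" using n by (auto simp: z_def)
          then show "0 $ j \<le> (n - y) $ j \<and> (n - y) $ j \<le> 1 $ j"
            by (simp add: y_def) linarith
        qed
        then have "n \<in> (+) y ` cbox 0 1" by (intro image_eqI[of _ _ "n - y"]) auto
        then show "n \<in> X \<inter> (+) y ` cbox 0 1" using n F by auto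
      qed
      then have "card {n \<in> F. z n = v} \<le> N" using N[of y] card_mono le_trans by metis
      then show "real (card {n \<in> F. z n = v}) \<le> real N" by simp
    qed
    also have "\<dots> = real N * (\<Sum>v\<in>z ` F. \<phi> v)" by (simp add: sum_distrib_left)
    also have "\<dots> \<le> real N * H ^ CARD('d)"
    proof (rule mult_left_mono)
      \<comment> \<open>The labels are enlarged to the product of their coordinate projections, over
        which the sum of products factorizes.\<close>
      have "(\<Sum>v\<in>z ` F. \<phi> v) \<le> (\<Sum>v\<in>PiE UNIV I. \<phi> v)"
        by (rule sum_mono2) (use F \<phi>0 in \<open>auto simp: I_def intro!: finite_PiE\<close>)
      also have "\<dots> = (\<Prod>j\<in>UNIV. \<Sum>i\<in>I j. max 1 \<bar>real_of_int i\<bar> powr (- \<tau>))"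
        unfolding \<phi>_def by (rule prod_sum_PiE[symmetric]) (use F in \<open>auto simp: I_def\<close>)
      also have "\<dots> \<le> (\<Prod>j\<in>(UNIV :: 'd set). H)"
        by (intro prod_mono conjI H(2) sum_nonneg) (use F in \<open>auto simp: I_def\<close>)
      finally show "(\<Sum>v\<in>z ` F. \<phi> v) \<le> H ^ CARD('d)" by simp
    qed simp
    finally show ?thesis .
  qed
  \<comment> \<open>N or H may be 0; adding 1 makes the constant positive.\<close>
  moreover have "0 < real N * H ^ CARD('d) + 1" using H by (simp add: add_nonneg_pos)
  ultimately show ?thesis using that[of "real N * H ^ CARD('d) + 1"] by (meson add_increasing2 zero_le_one)
qed

definition polynomial_weight :: "real \<Rightarrow> nat ^ 'd \<Rightarrow> real ^ 'd \<Rightarrow> real ^ 'd \<Rightarrow> real" where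
  "polynomial_weight s \<alpha> k l =
    (1 + norm (k - l)) powr s * (\<Prod>j\<in>UNIV. (1 + \<bar>k $ j - l $ j\<bar>) ^ (\<alpha> $ j))"

lemma decay_matrices_eq_weighted_matrices:
  "(decay_matrices X s \<alpha> :: (real ^ 'd, 'h::complex_hilbert) op_matrix set) =
    weighted_matrices X (polynomial_weight s \<alpha>)"
proof -
  have bound: "C * (1 + norm (k - l)) powr (- s) *
      (\<Prod>j\<in>UNIV. (1 + \<bar>k $ j - l $ j\<bar>) powr (- real (\<alpha> $ j))) = C / polynomial_weight s \<alpha> k l" for C k l
    by (simp add: polynomial_weight_def powr_minus powr_realpow prod_inversef[unfolded o_def] divide_inverse add_pos_nonneg)
  have pos: "0 < polynomial_weight s \<alpha> k l" for k l
    unfolding polynomial_weight_def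
    by (intro mult_pos_pos prod_pos) (auto intro!: zero_less_power add_pos_nonneg simp: powr_gt_zero add_nonneg_eq_0_iff)
  have "(\<exists>C>0. \<forall>k\<in>X. \<forall>l\<in>X. norm (A k l) \<le> C / polynomial_weight s \<alpha> k l) \<longleftrightarrow>
      (\<exists>C. \<forall>k\<in>X. \<forall>l\<in>X. norm (A k l) * polynomial_weight s \<alpha> k l \<le> C)" (is "?L \<longleftrightarrow> ?R")
    for A :: "(real ^ 'd, 'h) op_matrix"
  proof
    assume ?R
    then obtain C where "\<And>k l. k \<in> X \<Longrightarrow> l \<in> X \<Longrightarrow> norm (A k l) * polynomial_weight s \<alpha> k l \<le> C" by blast
    then have "\<forall>k\<in>X. \<forall>l\<in>X. norm (A k l) \<le> max 1 C / polynomial_weight s \<alpha> k l"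
      by (auto simp: pos_le_divide_eq[OF pos] le_max_iff_disj)
    then show ?L by (intro exI[of _ "max 1 C"]) auto
  qed (auto simp: pos_le_divide_eq[OF pos])
  then show ?thesis
    unfolding decay_matrices_def weighted_matrices_def bound by simp
qed

lemma polynomial_weight_quasi_triangle:
  assumes "0 \<le> s"
  shows "polynomial_weight s 0 k l \<le> 2 powr s * (polynomial_weight s 0 k n + polynomial_weight s 0 n l)"
proof -
  define a b where "a = 1 + norm (k - n)" and "b = 1 + norm (n - l)"
  have ab: "1 \<le> a" "1 \<le> b" by (auto simp: a_def b_def)
  have "1 + norm (k - l) \<le> 2 * max a b"
    using norm_triangle_ineq[of "k - n" "n - l"] by (simp add: a_def b_def max_def)
  then have "(1 + norm (k - l)) powr s \<le> (2 * max a b) powr s"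
    using assms by (intro powr_mono2) auto
  also have "\<dots> = 2 powr s * max a b powr s" by (rule powr_mult)
  also have "\<dots> \<le> 2 powr s * (a powr s + b powr s)"
    by (intro mult_left_mono) (auto simp: max_def)
  finally show ?thesis by (simp add: polynomial_weight_def a_def b_def)
qed

lemma polynomial_weight_eq:
  "polynomial_weight s \<alpha> k l = polynomial_weight s 0 k l * (\<Prod>j\<in>UNIV. (1 + \<bar>k $ j - l $ j\<bar>) ^ (\<alpha> $ j))"
  by (simp add: polynomial_weight_def)

text \<open>The coordinate factors are submultiplicative and cancel in the convolution quotient. The
  isotropic quotient is at most 2^s (1/W(n,l) + 1/W(k,n)) by the quasi-triangle inequality, and each
  term sums to at most S. The resulting constant does not depend on \<alpha>, which lets the
  induction on \<alpha> keep a single K.\<close>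

lemma decay_weight_polynomial_weight:
  fixes X :: "(real ^ 'd) set"
  assumes s: "0 \<le> s" and S: "0 < S"
    "\<And>x F. finite F \<Longrightarrow> F \<subseteq> X \<Longrightarrow> (\<Sum>n\<in>F. (1 + norm (x - n)) powr (- s)) \<le> S"
  shows "decay_weight X (polynomial_weight s \<alpha>) (2 powr s * (S + S))"
proof
  let ?u = "polynomial_weight s 0" and ?W = "polynomial_weight s \<alpha>"
  define v where "v k l = (\<Prod>j\<in>UNIV. (1 + \<bar>k $ j - l $ j\<bar>) ^ (\<alpha> $ j))" for k l :: "real ^ 'd"
  have W: "?W k l = ?u k l * v k l" for k l unfolding v_def by (rule polynomial_weight_eq)
  have v1: "1 \<le> v k l" for k l
    unfolding v_def by (intro prod_ge_1) simp
  have u1: "1 \<le> ?u k l" for k l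
    using s by (simp add: polynomial_weight_def ge_one_powr_ge_zero)
  have usym: "?u k l = ?u l k" for k l by (simp add: polynomial_weight_def norm_minus_commute)
  have inv_u: "1 / ?u k n = (1 + norm (k - n)) powr (- s)" for k n
    by (simp add: polynomial_weight_def powr_minus divide_inverse)
  have W_ge_u: "?u k l \<le> ?W k l" for k l
    using mult_left_mono[OF v1[of k l], of "?u k l"] u1[of k l] by (simp add: W)
  show W1: "1 \<le> ?W k l" for k l using u1[of k l] W_ge_u[of k l] by simp
  show "?W k k = 1" for k by (simp add: polynomial_weight_def)
  show "?W k l = ?W l k" for k l
    by (simp add: polynomial_weight_def norm_minus_commute abs_minus_commute)
  have two: "1 \<le> (2::real) powr s" using s by (simp add: ge_one_powr_ge_zero)
  show "0 < 2 powr s * (S + S)" using S by simp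
  have uS: "(\<Sum>n\<in>F. 1 / ?u k n) \<le> S" if "finite F" "F \<subseteq> X" for k F
    unfolding inv_u by (rule S(2)[OF that])
  fix k F assume F: "finite F" "F \<subseteq> X"
  have "(\<Sum>n\<in>F. 1 / ?W k n) \<le> (\<Sum>n\<in>F. 1 / ?u k n)"
    by (intro sum_mono divide_left_mono mult_pos_pos W_ge_u less_le_trans[OF zero_less_one u1]
        less_le_trans[OF zero_less_one W1]) simp
  also have "\<dots> \<le> 1 * (S + S)" using uS[OF F, of k] S(1) by simp
  also have "\<dots> \<le> 2 powr s * (S + S)" using two S(1) by (intro mult_right_mono) auto
  finally show "(\<Sum>n\<in>F. 1 / ?W k n) \<le> 2 powr s * (S + S)" .
  fix l
  have "?W k l / (?W k n * ?W n l) \<le> 2 powr s * (1 / ?u l n + 1 / ?u k n)" for n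
  proof -
    have "v k l \<le> (\<Prod>j\<in>UNIV. (1 + \<bar>k $ j - n $ j\<bar>) ^ (\<alpha> $ j) * (1 + \<bar>n $ j - l $ j\<bar>) ^ (\<alpha> $ j))"
      unfolding v_def
    proof (intro prod_mono conjI)
      fix j
      have "1 + \<bar>k $ j - l $ j\<bar> \<le> (1 + \<bar>k $ j - n $ j\<bar>) + \<bar>n $ j - l $ j\<bar>" by linarith
      also have "\<dots> \<le> (1 + \<bar>k $ j - n $ j\<bar>) * (1 + \<bar>n $ j - l $ j\<bar>)"
        by (simp add: distrib_left distrib_right)
      finally show "(1 + \<bar>k $ j - l $ j\<bar>) ^ (\<alpha> $ j)
          \<le> (1 + \<bar>k $ j - n $ j\<bar>) ^ (\<alpha> $ j) * (1 + \<bar>n $ j - l $ j\<bar>) ^ (\<alpha> $ j)"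
        unfolding power_mult_distrib[symmetric] by (rule power_mono) simp
    qed simp
    also have "\<dots> = v k n * v n l" by (simp add: v_def prod.distrib)
    finally have v: "v k l \<le> v k n * v n l" .
    have pos: "0 < ?u k n" "0 < ?u n l" "0 < v k n" "0 < v n l"
      using u1[of k n] u1[of n l] v1[of k n] v1[of n l] by linarith+
    have "?W k l \<le> (2 powr s * (?u k n + ?u n l)) * (v k n * v n l)"
      unfolding W using pos u1[of k l] v1[of k l]
      by (intro mult_mono polynomial_weight_quasi_triangle s v) auto
    then have "?W k l / (?W k n * ?W n l) \<le> (2 powr s * (?u k n + ?u n l)) * (v k n * v n l) / (?W k n * ?W n l)"
      by (rule divide_right_mono) (use pos in \<open>simp add: W\<close>)
    also have "\<dots> = 2 powr s * (1 / ?u n l + 1 / ?u k n)"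
      using pos by (simp add: W field_simps)
    finally show ?thesis by (simp add: usym[of n l])
  qed
  then have "(\<Sum>n\<in>F. ?W k l / (?W k n * ?W n l)) \<le> (\<Sum>n\<in>F. 2 powr s * (1 / ?u l n + 1 / ?u k n))"
    by (rule sum_mono)
  also have "\<dots> = 2 powr s * ((\<Sum>n\<in>F. 1 / ?u l n) + (\<Sum>n\<in>F. 1 / ?u k n))"
    by (simp only: sum_distrib_left[symmetric] sum.distrib)
  also have "\<dots> \<le> 2 powr s * (S + S)" by (intro mult_left_mono add_mono uS F) simp
  finally show "(\<Sum>n\<in>F. ?W k l / (?W k n * ?W n l)) \<le> 2 powr s * (S + S)" .
qed

lemma polynomial_weight_Suc:
  assumes "\<alpha> $ j = Suc m" "\<And>i. \<beta> $ i = (if i = j then m else \<alpha> $ i)"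
  shows "polynomial_weight s \<alpha> k l = polynomial_weight s \<beta> k l * (1 + \<bar>k $ j - l $ j\<bar>)"
proof -
  have "(\<Prod>i\<in>UNIV - {j}. (1 + \<bar>k $ i - l $ i\<bar>) ^ (\<beta> $ i)) = (\<Prod>i\<in>UNIV - {j}. (1 + \<bar>k $ i - l $ i\<bar>) ^ (\<alpha> $ i))"
    by (rule prod.cong) (auto simp: assms(2))
  then show ?thesis
    unfolding polynomial_weight_def prod.remove[OF finite UNIV_I, of _ j]
    by (simp add: assms)
qed

text \<open>Products do not refer to the weight, so G is one fixed matrix and only its known decay
  improves. Raising one exponent multiplies the weight by 1 + |k_j - l_j|, hence the new weighted
  entry of G is the old one plus that of its derivative.\<close>

lemma inverse_in_weighted_matrices:
  fixes X :: "(real ^ 'd) set" and \<alpha> :: "nat ^ 'd"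
  assumes s: "1 \<le> s" and dw: "\<And>\<alpha>. decay_weight X (polynomial_weight s \<alpha>) K"
    and G: "G \<in> weighted_matrices X (polynomial_weight s 0)"
    and PG: "matrix_mult X P G = one_matrix X" and GP: "matrix_mult X G P = one_matrix X"
    and P: "P \<in> weighted_matrices X (polynomial_weight s \<alpha>)"
  shows "G \<in> weighted_matrices X (polynomial_weight s \<alpha>)"
  using P
proof (induction "\<Sum>i\<in>UNIV. \<alpha> $ i" arbitrary: \<alpha>)
  case 0
  then have "\<alpha> = 0" by (simp add: vec_eq_iff)
  then show ?case using G by simp
next
  case (Suc n)
  obtain j where "\<alpha> $ j \<noteq> 0" using Suc(2) by (metis Zero_not_Suc sum.neutral)
  then obtain m where m: "\<alpha> $ j = Suc m" using not0_implies_Suc by blast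
  define \<beta> where "\<beta> = (\<chi> i. if i = j then m else \<alpha> $ i)"
  have \<beta>: "\<beta> $ i = (if i = j then m else \<alpha> $ i)" for i by (simp add: \<beta>_def)
  let ?W = "polynomial_weight s \<beta>"
  note W\<alpha> = polynomial_weight_Suc[OF m \<beta>, of s]
  interpret \<alpha>: decay_weight X "polynomial_weight s \<alpha>" K by (rule dw)
  interpret \<beta>: decay_weight X ?W K by (rule dw)
  have sum\<beta>: "n = (\<Sum>i\<in>UNIV. \<beta> $ i)"
  proof -
    have "(\<Sum>i\<in>UNIV - {j}. \<beta> $ i) = (\<Sum>i\<in>UNIV - {j}. \<alpha> $ i)"
      by (rule sum.cong) (auto simp: \<beta>)
    then show ?thesis using Suc(2) m \<beta>[of j]
      unfolding sum.remove[OF finite UNIV_I, of _ j] by simp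
  qed
  have P\<beta>: "P \<in> weighted_matrices X ?W"
  proof (rule \<beta>.weighted_matricesI(1)[OF \<alpha>.weighted_matrices_op[OF Suc.prems]])
    fix k l
    have "norm (P k l) * ?W k l \<le> norm (P k l) * polynomial_weight s \<alpha> k l"
      unfolding W\<alpha> using \<beta>.W_pos[of k l] by (intro mult_left_mono) (simp_all add: distrib_left)
    then show "norm (P k l) * ?W k l \<le> weighted_norm (polynomial_weight s \<alpha>) P"
      using \<alpha>.weighted_entry_le[OF Suc.prems] by (rule order_trans)
  qed
  have dP: "(\<lambda>k l. (k $ j - l $ j) *\<^sub>R P k l) \<in> weighted_matrices X ?W"
  proof (rule \<beta>.weighted_matricesI(1))
    show "(\<lambda>k l. (k $ j - l $ j) *\<^sub>R P k l) \<in> op_matrices X"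
      using op_matricesD[OF \<alpha>.weighted_matrices_op[OF Suc.prems]]
      by (auto simp: op_matrices_def clinear_op_scaleR)
    fix k l
    have "norm ((k $ j - l $ j) *\<^sub>R P k l) * ?W k l \<le> norm (P k l) * polynomial_weight s \<alpha> k l"
      unfolding W\<alpha> using \<beta>.W_pos[of k l] by (simp add: distrib_left mult_ac)
    then show "norm ((k $ j - l $ j) *\<^sub>R P k l) * ?W k l \<le> weighted_norm (polynomial_weight s \<alpha>) P"
      using \<alpha>.weighted_entry_le[OF Suc.prems] by (rule order_trans)
  qed
  have G\<beta>: "G \<in> weighted_matrices X ?W" by (rule Suc(1)[OF sum\<beta> P\<beta>])
  let ?dG = "\<lambda>k l. (k $ j - l $ j) *\<^sub>R G k l"
  have "?dG = scale_matrix (-1) (matrix_mult X G (matrix_mult X (\<lambda>k l. (k $ j - l $ j) *\<^sub>R P k l) G))"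
  proof (rule \<beta>.derivation_inverse[OF P\<beta> G\<beta> PG GP dP])
    fix k l :: "real ^ 'd"
    have "\<bar>k $ j - l $ j\<bar> \<le> (1 + norm (k - l)) powr 1"
      using component_le_norm_cart[of "k - l" j] by simp
    \<comment> \<open>Here s \<ge> 1 is used: the isotropic factor alone must dominate one
      coordinate difference.\<close>
    also have "\<dots> \<le> (1 + norm (k - l)) powr s" using s by (intro powr_mono) auto
    also have "\<dots> \<le> ?W k l"
      using mult_left_mono[of 1 "\<Prod>j\<in>UNIV. (1 + \<bar>k $ j - l $ j\<bar>) ^ (\<beta> $ j)" "(1 + norm (k - l)) powr s"]
      by (simp add: polynomial_weight_def prod_ge_1)
    finally show "\<bar>k $ j - l $ j\<bar> \<le> ?W k l" .
  qed
  also have "\<dots> \<in> weighted_matrices X ?W"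
    by (intro \<beta>.scale_matrix_weighted \<beta>.matrix_mult_weighted G\<beta> dP)
  finally have dG: "?dG \<in> weighted_matrices X ?W" .
  show ?case
  proof (rule \<alpha>.weighted_matricesI(1)[OF \<beta>.weighted_matrices_op[OF G\<beta>]])
    fix k l
    have "norm (G k l) * polynomial_weight s \<alpha> k l = norm (G k l) * ?W k l + norm (?dG k l) * ?W k l"
      unfolding W\<alpha> by (simp only: norm_scaleR distrib_left mult_1_right mult_ac)
    also have "\<dots> \<le> weighted_norm ?W G + weighted_norm ?W ?dG"
      by (intro add_mono \<beta>.weighted_entry_le[OF G\<beta>] \<beta>.weighted_entry_le[OF dG])
    finally show "norm (G k l) * polynomial_weight s \<alpha> k l \<le> weighted_norm ?W G + weighted_norm ?W ?dG" .
  qed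
qed

theorem corollary6p4:
  fixes X :: "(real ^ 'd) set" and s :: real and \<alpha> :: "nat ^ 'd"
  assumes "separable_space (euclidean :: 'h::complex_hilbert topology)"
    and "relatively_separated X"
    and "s > real CARD('d)"
  shows "series_converge X (decay_matrices X s \<alpha> :: (real ^ 'd, 'h) op_matrix set) \<and>
    (\<exists>\<nu> :: (real ^ 'd, 'h) op_matrix \<Rightarrow> real.
      let M = matrix_algebra X (decay_matrices X s \<alpha>) \<nu> in
        banach_star_algebra M \<and> solid X M \<and>
        inverse_closed_via (matrix_op X) M (B_ell2 X) \<and> symmetric_algebra M)"
proof -
  let ?d = "real CARD('d)"
  have d1: "1 \<le> ?d" using one_le_card_finite[where 'a='d] by linarith
  then have s1: "1 \<le> s" using assms(3) by linarith
  obtain S where S: "0 < S"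
    "\<And>x F. finite F \<Longrightarrow> F \<subseteq> X \<Longrightarrow> (\<Sum>n\<in>F. (1 + norm (x - n)) powr (- s)) \<le> S"
    using relatively_separated_sum_bounded[OF assms(2,3)] by blast
  define K where "K = 2 powr s * (S + S)"
  have dw: "decay_weight X (polynomial_weight s \<alpha>) K" for \<alpha>
    unfolding K_def by (rule decay_weight_polynomial_weight) (use s1 S in auto)
  \<comment> \<open>Chosen so that s (1 - \<theta>) = (s + d) / 2, midway between d and s: the decay
    left after interpolation still exceeds d.\<close>
  define \<theta> where "\<theta> = (s - ?d) / (2 * s)"
  have \<theta>: "0 < \<theta>" "\<theta> < 1" using assms(3) s1 d1 by (auto simp: \<theta>_def field_simps)
  have s\<theta>: "s * (\<theta> - 1) = - ((s + ?d) / 2)" using s1 by (simp add: \<theta>_def field_simps)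
  obtain S' where S': "0 < S'"
    "\<And>x F. finite F \<Longrightarrow> F \<subseteq> X \<Longrightarrow> (\<Sum>n\<in>F. (1 + norm (x - n)) powr (- ((s + ?d) / 2))) \<le> S'"
    using relatively_separated_sum_bounded[OF assms(2), of "(s + ?d) / 2"] assms(3) by auto
  interpret base: interpolation_weight X "polynomial_weight s 0" K \<theta> "2 powr s" S'
  proof (intro interpolation_weight.intro dw interpolation_weight_axioms.intro)
    show "polynomial_weight s 0 k l \<le> 2 powr s * (polynomial_weight s 0 k n + polynomial_weight s 0 n l)" for k l n
      by (rule polynomial_weight_quasi_triangle) (use s1 in simp)
    show "(\<Sum>n\<in>F. polynomial_weight s 0 k n powr (\<theta> - 1)) \<le> S'" if "finite F" "F \<subseteq> X" for k F
      using S'(2)[OF that, of k] by (simp add: polynomial_weight_def powr_powr s\<theta>)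
  qed (use \<theta> S' in auto)
  interpret decay_weight X "polynomial_weight s \<alpha>" K by (rule dw)
  \<comment> \<open>A* A is inverted for exponent 0, where the quasi-triangle inequality is
    available; the inverse found there is then shown to have the full decay.\<close>
  have H: "matrix_mult X (adj_matrix A) A \<in> Units weighted_algebra"
    if A: "A \<in> weighted_matrices X (polynomial_weight s \<alpha>)" and "bounded_below A"
    for A :: "(real ^ 'd, 'h) op_matrix"
  proof -
    let ?P = "matrix_mult X (adj_matrix A) A"
    have "A \<in> weighted_matrices X (polynomial_weight s 0)"
    proof (rule base.weighted_matricesI(1)[OF weighted_matrices_op[OF A]])
      fix k l :: "real ^ 'd"
      have "1 \<le> (\<Prod>j\<in>UNIV. (1 + \<bar>k $ j - l $ j\<bar>) ^ (\<alpha> $ j))" by (intro prod_ge_1) simp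
      then have "polynomial_weight s 0 k l \<le> polynomial_weight s \<alpha> k l"
        using base.W_pos[of k l] unfolding polynomial_weight_eq[of s \<alpha>] by simp
      then have "norm (A k l) * polynomial_weight s 0 k l \<le> norm (A k l) * polynomial_weight s \<alpha> k l"
        by (rule mult_left_mono) simp
      then show "norm (A k l) * polynomial_weight s 0 k l \<le> weighted_norm (polynomial_weight s \<alpha>) A"
        using weighted_entry_le[OF A] by (rule order_trans)
    qed
    from base.UnitsE_matrix[OF base.adj_mult_Units_if_bounded_below[OF this that(2)]]
    obtain G where G: "G \<in> weighted_matrices X (polynomial_weight s 0)"
      "matrix_mult X G ?P = one_matrix X" "matrix_mult X ?P G = one_matrix X" by metis
    have P: "?P \<in> weighted_matrices X (polynomial_weight s \<alpha>)"
      by (intro matrix_mult_weighted adj_matrix_weighted A)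
    have "G \<in> weighted_matrices X (polynomial_weight s \<alpha>)"
      by (rule inverse_in_weighted_matrices[OF s1 dw G(1,3,2) P])
    then show ?thesis using UnitsI_matrix P G(2,3) by blast
  qed
  show ?thesis
    unfolding decay_matrices_eq_weighted_matrices Let_def
    using series_converge_weighted banach_star_algebra_weighted_algebra solid_weighted_algebra
      inverse_closed_weighted_algebra[OF H] symmetric_weighted_algebra[OF H] by blast
qed

end
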